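(* Let $S=\bigl((t_1,a_1),\dots,(t_w,a_w)\bigr)$ be a NE-pattern. Then the following hold: $$J_S=J_{t_1}(a_1)\cdots J_{t_w}(a_w),$$ $$J_S=\bigcap_{u,b}J_u(b)^{e_{ub}(S)},$$ $$I_S=\bigcap_{u,b}I_u(b)^{e_{ub}(S)},$$ where the intersections are over all pairs $(u,b)$ of positive integers with $u\le m$ and $u+b\le n+1$. The last equation gives a primary decomposition of $I_S$. The ideals $I_S$ and $J_S$ are integrally closed.
   Context: Let $K$ be a field, $X=(x_{ij})$ an $m\times n$ matrix of indeterminates and $R=K[x_{ij}:1\le i\le m,\ 1\le j\le n]$. For positive integers $t,a$ with $t\le m$ and $t+a\le n+1$, let $X_t(a)=(x_{ij}:1\le i\le t,\ a\le j\le n)$ and let $I_t(a)\subset R$ be the ideal generated by the $t$-minors of $X_t(a)$. Fix a diagonal monomial order on $R$, i.e. one for which the initial monomial of every minor of $X$ is the product of its main diagonal entries (for instance the lexicographic order with $x_{ij}>x_{uv}$ if $i<u$, or $i=u$ and $j<v$). Set $J_t(a)=\operatorname{in}(I_t(a))$, the initial ideal. A NE-pattern is a finite sequence $S=\bigl((t_1,a_1),\dots,(t_w,a_w)\bigr)$ of pairs of positive integers with $t_i\le m$ and $t_i+a_i\le n+1$, ordered so that for $i<j$ one has $a_i\le a_j$, and $t_i\ge t_j$ if $a_i=a_j$. Set $I_S=I_{t_1}(a_1)\cdots I_{t_w}(a_w)$, $J_S=\operatorname{in}(I_S)$, and for a pair $(u,b)$ set $e_{ub}(S)=|\{i: b\le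 a_i\text{ and }u\le t_i\}|$. A zeroth power of an ideal is $R$ (and such components are disregarded in the primary decomposition). *)

theory Defs
  imports
    "HOL-Algebra.Ideal_Product"
    "HOL-Library.Poly_Mapping"
    "Jordan_Normal_Form.Determinant"
begin

text \<open>
  A monomial is its exponent vector, so multiplication of monomials is addition of exponents and
  the monomial 1 is \<open>0\<close>.  The polynomials over a field \<open>'k\<close> in all variables
  \<open>x\<^sub>i\<^sub>j\<close> (\<open>i, j :: nat\<close>) form a type;
  \<open>K[x\<^sub>i\<^sub>j : 1 \<le> i \<le> m, 1 \<le> j \<le> n]\<close> is the subring of those
  polynomials that involve only variables with indices in the stated range.
\<close>

type_synonym xmonom = "nat \<times> nat \<Rightarrow>\<^sub>0 nat"
type_synonym 'k xpoly = "xmonom \<Rightarrow>\<^sub>0 'k"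

definition monoms :: "nat \<Rightarrow> nat \<Rightarrow> xmonom set" where
  "monoms m n = {\<mu>. Poly_Mapping.keys \<mu> \<subseteq> {1..m} \<times> {1..n}}"

definition poly_ring :: "nat \<Rightarrow> nat \<Rightarrow> 'k::field xpoly ring" where
  "poly_ring m n = \<lparr>carrier = {f. Poly_Mapping.keys f \<subseteq> monoms m n},
     monoid.mult = (*), one = 1, zero = 0, add = (+)\<rparr>"

definition xvar :: "nat \<Rightarrow> nat \<Rightarrow> 'k::field xpoly" where
  "xvar i j = Poly_Mapping.single (Poly_Mapping.single (i, j) 1) 1"

lemma monoms_add: "\<mu> \<in> monoms m n \<Longrightarrow> \<nu> \<in> monoms m n \<Longrightarrow> \<mu> + \<nu> \<in> monoms m n"
  using Poly_Mapping.keys_add[of \<mu> \<nu>] unfolding monoms_def by blast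

lemma cring_poly_ring: "cring (poly_ring m n :: 'k::field xpoly ring)"
proof (rule cringI)
  show "abelian_group (poly_ring m n :: 'k xpoly ring)"
  proof (rule abelian_groupI)
    fix f g :: "'k xpoly"
    assume "f \<in> carrier (poly_ring m n)" "g \<in> carrier (poly_ring m n)"
    then show "f \<oplus>\<^bsub>poly_ring m n\<^esub> g \<in> carrier (poly_ring m n)"
      using Poly_Mapping.keys_add[of f g] by (auto simp: poly_ring_def)
  next
    fix f :: "'k xpoly"
    assume f: "f \<in> carrier (poly_ring m n)"
    show "\<exists>g\<in>carrier (poly_ring m n). g \<oplus>\<^bsub>poly_ring m n\<^esub> f = \<zero>\<^bsub>poly_ring m n\<^esub>"
      using f by (intro bexI[of _ "- f"]) (auto simp: poly_ring_def)
  qed (auto simp: poly_ring_def add_ac)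
next
  show "Group.comm_monoid (poly_ring m n :: 'k xpoly ring)"
  proof (rule Group.comm_monoidI)
    fix f g :: "'k xpoly"
    assume "f \<in> carrier (poly_ring m n)" "g \<in> carrier (poly_ring m n)"
    then show "f \<otimes>\<^bsub>poly_ring m n\<^esub> g \<in> carrier (poly_ring m n)"
      using Poly_Mapping.keys_mult[of f g] by (auto simp: poly_ring_def intro!: monoms_add)
  next
    show "\<one>\<^bsub>poly_ring m n\<^esub> \<in> carrier (poly_ring m n :: 'k xpoly ring)"
      by (simp add: poly_ring_def monoms_def)
  qed (auto simp: poly_ring_def mult_ac)
qed (auto simp: poly_ring_def algebra_simps)

text \<open>
  A minor of size \<open>t\<close> is given by its rows \<open>r 0 < \<dots> < r (t - 1)\<close> and columns
  \<open>c 0 < \<dots> < c (t - 1)\<close>.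
\<close>

definition minor :: "nat \<Rightarrow> (nat \<Rightarrow> nat) \<Rightarrow> (nat \<Rightarrow> nat) \<Rightarrow> 'k::field xpoly" where
  "minor t r c = Determinant.det (Matrix.mat t t (\<lambda>(i, j). xvar (r i) (c j)))"

definition selects :: "nat \<Rightarrow> nat set \<Rightarrow> (nat \<Rightarrow> nat) \<Rightarrow> bool" where
  "selects t A r \<longleftrightarrow> strict_mono_on {..<t} r \<and> r ` {..<t} \<subseteq> A"

definition minor_ideal :: "nat \<Rightarrow> nat \<Rightarrow> nat \<Rightarrow> nat \<Rightarrow> 'k::field xpoly set" where
  "minor_ideal m n t a =
     Idl\<^bsub>poly_ring m n\<^esub> {minor t r c | r c. selects t {1..t} r \<and> selects t {a..n} c}"

text \<open>\<open>(\<mu>, \<nu>) \<in> ord\<close> means that \<open>\<mu>\<close> is smaller than or equal to \<open>\<nu>\<close>.\<close>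

definition monomial_order :: "nat \<Rightarrow> nat \<Rightarrow> (xmonom \<times> xmonom) set \<Rightarrow> bool" where
  "monomial_order m n ord \<longleftrightarrow>
     linear_order_on (monoms m n) ord \<and>
     (\<forall>\<mu>\<in>monoms m n. (0, \<mu>) \<in> ord) \<and>
     (\<forall>\<mu> \<nu>. \<forall>\<rho>\<in>monoms m n. (\<mu>, \<nu>) \<in> ord \<longrightarrow> (\<mu> + \<rho>, \<nu> + \<rho>) \<in> ord)"

definition init_monom :: "(xmonom \<times> xmonom) set \<Rightarrow> 'k::field xpoly \<Rightarrow> xmonom" where
  "init_monom ord f =
     (THE \<mu>. \<mu> \<in> Poly_Mapping.keys f \<and> (\<forall>\<nu>\<in>Poly_Mapping.keys f. (\<nu>, \<mu>) \<in> ord))"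

definition init_ideal ::
    "nat \<Rightarrow> nat \<Rightarrow> (xmonom \<times> xmonom) set \<Rightarrow> 'k::field xpoly set \<Rightarrow> 'k xpoly set" where
  "init_ideal m n ord I =
     Idl\<^bsub>poly_ring m n\<^esub> {Poly_Mapping.single (init_monom ord f) 1 | f. f \<in> I \<and> f \<noteq> 0}"

text \<open>The coefficient field is an explicit argument because the minors live over it.\<close>

definition diagonal_order ::
    "'k::field itself \<Rightarrow> nat \<Rightarrow> nat \<Rightarrow> (xmonom \<times> xmonom) set \<Rightarrow> bool" where
  "diagonal_order K m n ord \<longleftrightarrow>
     monomial_order m n ord \<and>
     (\<forall>t r c. 1 \<le> t \<and> selects t {1..m} r \<and> selects t {1..n} c \<longrightarrow>
        init_monom ord (minor t r c :: 'k xpoly) = (\<Sum>i<t. Poly_Mapping.single (r i, c i) 1))"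

definition index_pairs :: "nat \<Rightarrow> nat \<Rightarrow> (nat \<times> nat) set" where
  "index_pairs m n = {(u, b). 1 \<le> u \<and> 1 \<le> b \<and> u \<le> m \<and> u + b \<le> n + 1}"

definition NE_pattern :: "nat \<Rightarrow> nat \<Rightarrow> (nat \<times> nat) list \<Rightarrow> bool" where
  "NE_pattern m n S \<longleftrightarrow>
     set S \<subseteq> index_pairs m n \<and>
     (\<forall>i j. i < j \<and> j < length S \<longrightarrow>
        snd (S ! i) \<le> snd (S ! j) \<and>
        (snd (S ! i) = snd (S ! j) \<longrightarrow> fst (S ! j) \<le> fst (S ! i)))"

definition pattern_ideal :: "nat \<Rightarrow> nat \<Rightarrow> (nat \<times> nat) list \<Rightarrow> 'k::field xpoly set" where
  "pattern_ideal m n S =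
     (\<Otimes>\<^bsub>ideals_set (poly_ring m n)\<^esub> i\<in>{..<length S}. minor_ideal m n (fst (S ! i)) (snd (S ! i)))"

definition pattern_exp :: "(nat \<times> nat) list \<Rightarrow> nat \<Rightarrow> nat \<Rightarrow> nat" where
  "pattern_exp S u b = card {i. i < length S \<and> b \<le> snd (S ! i) \<and> u \<le> fst (S ! i)}"

text \<open>
  The multiplicative monoid of \<open>ideals_set R\<close> has unit \<open>carrier R\<close>, so the zeroth power of an
  ideal is the whole ring.
\<close>

abbreviation ideal_pow :: "('a, 'b) ring_scheme \<Rightarrow> 'a set \<Rightarrow> nat \<Rightarrow> 'a set" where
  "ideal_pow R I e \<equiv> I [^]\<^bsub>ideals_set R\<^esub> e"

definition primary_ideal :: "('a, 'b) ring_scheme \<Rightarrow> 'a set \<Rightarrow> bool" where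
  "primary_ideal R Q \<longleftrightarrow>
     ideal Q R \<and> Q \<noteq> carrier R \<and>
     (\<forall>x\<in>carrier R. \<forall>y\<in>carrier R.
        x \<otimes>\<^bsub>R\<^esub> y \<in> Q \<longrightarrow> x \<in> Q \<or> (\<exists>k::nat. y [^]\<^bsub>R\<^esub> k \<in> Q))"

text \<open>Intersecting with \<open>carrier R\<close> only matters for the empty decomposition, that of the unit ideal.\<close>

definition primary_decomposition :: "('a, 'b) ring_scheme \<Rightarrow> 'a set \<Rightarrow> 'a set set \<Rightarrow> bool" where
  "primary_decomposition R I \<Q> \<longleftrightarrow>
     finite \<Q> \<and> (\<forall>Q\<in>\<Q>. primary_ideal R Q) \<and> I = carrier R \<inter> \<Inter>\<Q>"

text \<open>
  Equations of integral dependence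
  \<open>f\<^sup>k + a\<^sub>1 f\<^sup>k\<^sup>-\<^sup>1 + \<dots> + a\<^sub>k = 0\<close> with \<open>a\<^sub>i \<in> I\<^sup>i\<close> and \<open>k \<ge> 1\<close>.
\<close>

definition ideal_integral_closure :: "('a, 'b) ring_scheme \<Rightarrow> 'a set \<Rightarrow> 'a set" where
  "ideal_integral_closure R I =
     {f \<in> carrier R. \<exists>k a. 1 \<le> k \<and> a 0 = \<one>\<^bsub>R\<^esub> \<and> (\<forall>i\<in>{1..k}. a i \<in> ideal_pow R I i) \<and>
        (\<Oplus>\<^bsub>R\<^esub> i\<in>{..k}. a i \<otimes>\<^bsub>R\<^esub> (f [^]\<^bsub>R\<^esub> (k - i))) = \<zero>\<^bsub>R\<^esub>}"

definition integrally_closed_ideal :: "('a, 'b) ring_scheme \<Rightarrow> 'a set \<Rightarrow> bool" where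
  "integrally_closed_ideal R I \<longleftrightarrow> ideal I R \<and> ideal_integral_closure R I = I"

end

theory Submission
  imports Defs "HOL-Library.Product_Lexorder"
begin

text \<open>
  The proof compares three descriptions of a product of ideals of minors: by generators, by initial
  monomials and by valuations.

  Combinatorially, the main diagonal of a \<open>u\<close>-minor of \<open>X\<^sub>u(b)\<close> is a chain of cells, and the sets that
  meet all these chains and are minimal with this property are staircases: they contain one cell
  on each diagonal of the block, in weakly increasing rows.  Lemma \<open>chain_packing\<close> is a max-flow
  min-cut theorem for all kinds of chains at once.  If a monomial crosses each staircase for each
  \<open>(u, b)\<close> at least \<open>e\<^sub>u\<^sub>b(S)\<close> times, then it is divisible by a product of main diagonals of minors of
  types \<open>(t\<^sub>1, a\<^sub>1), ..., (t\<^sub>w, a\<^sub>w)\<close>.  Chains are removed greedily, a longest one first and always the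
  leftmost of its kind.

  Algebraically, there is a valuation for each \<open>(u, b)\<close>, the order of vanishing along the matrices
  whose block \<open>X\<^sub>u(b)\<close> has rank less than \<open>u\<close>.  It is the \<open>eps\<close>-adic order along a generic
  deformation of such a matrix.  A \<open>t\<close>-minor of \<open>X\<^sub>t(a)\<close> has positive value if \<open>u \<le> t\<close> and \<open>b \<le> a\<close>, and so
  all elements of \<open>I\<^sub>S\<close> have value at least \<open>e\<^sub>u\<^sub>b(S)\<close>.

  The two sides are linked by lemma \<open>init_monom_crossing\<close>: if \<open>f\<close> has value at least \<open>k\<close> for \<open>(u, b)\<close>,
  then its initial monomial crosses each staircase for \<open>(u, b)\<close> at least \<open>k\<close> times.  Given a
  staircase, a special deformation is built from the minors of the columns that it skips, in such a
  way that leading terms are multiplied by \<open>eps\<close> exactly in the cells of the staircase.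

  Now let \<open>f\<close> have value at least \<open>e\<^sub>u\<^sub>b(S)\<close> for all \<open>(u, b)\<close>.  By the link and the packing theorem, the initial
  monomial of \<open>f\<close> is the initial monomial of a multiple of a product of minors in \<open>I\<^sub>S\<close>.  Reduction shows that
  \<open>f\<close> lies in \<open>I\<^sub>S\<close>.  Thus \<open>I\<^sub>S\<close> is an intersection of valuation ideals, and \<open>J\<^sub>S\<close> is spanned by the
  monomials that cross all staircases often enough.  For constant patterns this identifies the
  powers of \<open>I\<^sub>u(b)\<close> and of \<open>J\<^sub>u(b)\<close>, and both intersection formulas follow.  Proper valuation ideals are
  primary, and intersections of valuation ideals are integrally closed; this applies to \<open>J\<^sub>S\<close> as well, with
  the degree in the variables of a staircase as valuation.
\<close>

abbreviation lookup :: "('a \<Rightarrow>\<^sub>0 'b::zero) \<Rightarrow> 'a \<Rightarrow> 'b" where "lookup \<equiv> Poly_Mapping.lookup"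
abbreviation keys :: "('a \<Rightarrow>\<^sub>0 'b::zero) \<Rightarrow> 'a set" where "keys \<equiv> Poly_Mapping.keys"
abbreviation single :: "'a \<Rightarrow> 'b \<Rightarrow> 'a \<Rightarrow>\<^sub>0 'b::zero" where "single \<equiv> Poly_Mapping.single"

section \<open>Ideals of the polynomial ring\<close>

lemma sum_single_lookup: "(\<Sum>\<nu>\<in>keys f. single \<nu> (lookup f \<nu>)) = f"
proof (rule poly_mapping_eqI)
  fix \<kappa>
  have "lookup (\<Sum>\<nu>\<in>keys f. single \<nu> (lookup f \<nu>)) \<kappa> = (\<Sum>\<nu>\<in>keys f. if \<nu> = \<kappa> then lookup f \<nu> else 0)"
    unfolding lookup_sum by (intro sum.cong) (auto simp: lookup_single when_def)
  then show "lookup (\<Sum>\<nu>\<in>keys f. single \<nu> (lookup f \<nu>)) \<kappa> = lookup f \<kappa>"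
    by (simp add: in_keys_iff)
qed

lemma lookup_const_mult: "lookup (single 0 c * f) \<kappa> = c * lookup f \<kappa>"
  by (simp add: mult_map_scale_conv_mult[symmetric] Poly_Mapping.map.rep_eq when_def)

interpretation PR: cring "poly_ring m n" for m n by (rule cring_poly_ring)

lemma carrier_poly_ring_iff: "f \<in> carrier (poly_ring m n) \<longleftrightarrow> keys f \<subseteq> monoms m n"
  by (simp add: poly_ring_def)

lemma poly_ring_simps [simp]:
  "x \<otimes>\<^bsub>poly_ring m n\<^esub> y = x * y" "\<one>\<^bsub>poly_ring m n\<^esub> = 1"
  "\<zero>\<^bsub>poly_ring m n\<^esub> = 0" "x \<oplus>\<^bsub>poly_ring m n\<^esub> y = x + y"
  by (simp_all add: poly_ring_def)

lemma poly_ring_closed [simp, intro]: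
  "0 \<in> carrier (poly_ring m n)" "1 \<in> carrier (poly_ring m n)"
  "f \<in> carrier (poly_ring m n) \<Longrightarrow> - f \<in> carrier (poly_ring m n)"
  "f \<in> carrier (poly_ring m n) \<Longrightarrow> g \<in> carrier (poly_ring m n) \<Longrightarrow> f + g \<in> carrier (poly_ring m n)"
  "f \<in> carrier (poly_ring m n) \<Longrightarrow> g \<in> carrier (poly_ring m n) \<Longrightarrow> f - g \<in> carrier (poly_ring m n)"
  "f \<in> carrier (poly_ring m n) \<Longrightarrow> g \<in> carrier (poly_ring m n) \<Longrightarrow> f * g \<in> carrier (poly_ring m n)"
proof -
  let ?C = "carrier (poly_ring m n)"
  show "0 \<in> ?C" "1 \<in> ?C" by (auto simp: carrier_poly_ring_iff monoms_def)
  show "- f \<in> ?C" if "f \<in> ?C" using that by (simp add: carrier_poly_ring_iff)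
  show "f + g \<in> ?C" if "f \<in> ?C" "g \<in> ?C"
    using that Poly_Mapping.keys_add[of f g] by (auto simp: carrier_poly_ring_iff)
  show "f - g \<in> ?C" if "f \<in> ?C" "g \<in> ?C"
    using that Poly_Mapping.keys_diff[of f g] by (auto simp: carrier_poly_ring_iff)
  show "f * g \<in> ?C" if "f \<in> ?C" "g \<in> ?C"
    using that Poly_Mapping.keys_mult[of f g] by (auto simp: carrier_poly_ring_iff intro!: monoms_add)
qed

lemma poly_ring_power_closed [simp, intro]:
  "f \<in> carrier (poly_ring m n) \<Longrightarrow> f ^ k \<in> carrier (poly_ring m n)"
  by (induction k) auto

lemma poly_ring_pow [simp]: "x [^]\<^bsub>poly_ring m n\<^esub> (k::nat) = x ^ k"
  by (induction k) (auto simp: PR.nat_pow_Suc mult.commute)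

lemma poly_ring_finsum:
  assumes "finite A" "\<And>i. i \<in> A \<Longrightarrow> f i \<in> carrier (poly_ring m n)"
  shows "finsum (poly_ring m n) f A = sum f A"
  using assms
proof (induction A rule: finite_induct)
  case (insert x A)
  then have "finsum (poly_ring m n) f (insert x A) = f x \<oplus>\<^bsub>poly_ring m n\<^esub> finsum (poly_ring m n) f A"
    by (intro PR.finsum_insert) auto
  then show ?case using insert by simp
qed (simp add: PR.finsum_empty)

lemma poly_idealI:
  assumes "I \<subseteq> carrier (poly_ring m n)" "0 \<in> I" "\<And>f g. f \<in> I \<Longrightarrow> g \<in> I \<Longrightarrow> f + g \<in> I"
    and mult: "\<And>f g. f \<in> I \<Longrightarrow> g \<in> carrier (poly_ring m n) \<Longrightarrow> g * f \<in> I"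
  shows "ideal I (poly_ring m n :: 'k::field xpoly ring)"
proof (rule idealI)
  let ?R = "poly_ring m n :: 'k xpoly ring"
  show "ring ?R" by (rule PR.ring_axioms)
  show "subgroup I (add_monoid ?R)"
  proof (rule PR.add.subgroupI)
    fix f assume f: "f \<in> I"
    have fc: "f \<in> carrier ?R" using f assms(1) by blast
    have "\<ominus>\<^bsub>?R\<^esub> f = - f"
      by (rule PR.minus_equality) (use fc in auto)
    then have inv: "\<ominus>\<^bsub>?R\<^esub> f = - 1 * f" by simp
    have "- 1 * f \<in> I" by (rule mult[OF f]) simp
    then show "\<ominus>\<^bsub>?R\<^esub> f \<in> I" unfolding inv .
  qed (use assms in auto)
  show "x \<otimes>\<^bsub>?R\<^esub> f \<in> I" "f \<otimes>\<^bsub>?R\<^esub> x \<in> I" if "f \<in> I" "x \<in> carrier ?R" for f x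
    using mult[OF that] by (auto simp: mult.commute)
qed

lemma poly_idealD:
  assumes "ideal I (poly_ring m n :: 'k::field xpoly ring)"
  shows "I \<subseteq> carrier (poly_ring m n)" "0 \<in> I" "\<And>f g. f \<in> I \<Longrightarrow> g \<in> I \<Longrightarrow> f + g \<in> I"
    "\<And>f g. f \<in> I \<Longrightarrow> g \<in> carrier (poly_ring m n) \<Longrightarrow> g * f \<in> I"
proof -
  interpret I: ideal I "poly_ring m n :: 'k xpoly ring" by (rule assms)
  show "I \<subseteq> carrier (poly_ring m n)" by (rule I.a_subset)
  show "0 \<in> I" using I.zero_closed by simp
  show "f + g \<in> I" if "f \<in> I" "g \<in> I" for f g using I.a_closed[OF that] by simp
  show "g * f \<in> I" if "f \<in> I" "g \<in> carrier (poly_ring m n)" for f g using I.I_l_closed[OF that] by simp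
qed

lemma poly_ideal_keys:
  "ideal I (poly_ring m n :: 'k::field xpoly ring) \<Longrightarrow> f \<in> I \<Longrightarrow> keys f \<subseteq> monoms m n"
  using poly_idealD(1)[of I m n] carrier_poly_ring_iff by blast

lemma poly_ideal_sum:
  assumes "ideal I (poly_ring m n :: 'k::field xpoly ring)" "\<And>i. i \<in> A \<Longrightarrow> f i \<in> I"
  shows "sum f A \<in> I"
  using assms(2) poly_idealD(2,3)[OF assms(1)]
  by (induction A rule: infinite_finite_induct) auto

interpretation IM: comm_monoid "ideals_set (poly_ring m n)" for m n
  by (rule PR.ideals_set_is_comm_monoid)

lemma carrier_ideals_set [simp]: "I \<in> carrier (ideals_set R) \<longleftrightarrow> ideal I R"
  and mult_ideals_set [simp]: "I \<otimes>\<^bsub>ideals_set R\<^esub> J = ideal_prod R I J"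
  and one_ideals_set [simp]: "\<one>\<^bsub>ideals_set R\<^esub> = carrier R"
  by (auto simp: ideals_set_def)

lemma ideal_pow_1:
  "ideal I (poly_ring m n :: 'k::field xpoly ring) \<Longrightarrow> ideal_pow (poly_ring m n) I 1 = I"
  using IM.l_one[of I m n] by (simp add: IM.nat_pow_Suc)

lemma ideal_finprod:
  assumes "\<And>i. i \<in> A \<Longrightarrow> ideal (F i) (poly_ring m n :: 'k::field xpoly ring)"
  shows "ideal (\<Otimes>\<^bsub>ideals_set (poly_ring m n)\<^esub> i\<in>A. F i) (poly_ring m n :: 'k xpoly ring)"
  using IM.finprod_closed[of F A m n] assms by auto

lemma prod_in_finprod:
  assumes "finite A" "\<And>i. i \<in> A \<Longrightarrow> ideal (F i) (poly_ring m n :: 'k::field xpoly ring)"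
    and "\<And>i. i \<in> A \<Longrightarrow> g i \<in> F i"
  shows "(\<Prod>i\<in>A. g i) \<in> (\<Otimes>\<^bsub>ideals_set (poly_ring m n)\<^esub> i\<in>A. F i)"
  using assms
proof (induction A rule: finite_induct)
  case empty
  then show ?case by simp
next
  case (insert x A)
  then have "(\<Otimes>\<^bsub>ideals_set (poly_ring m n)\<^esub> i\<in>insert x A. F i)
      = ideal_prod (poly_ring m n) (F x) (\<Otimes>\<^bsub>ideals_set (poly_ring m n)\<^esub> i\<in>A. F i)"
    by (subst IM.finprod_insert) auto
  then show ?case
    using ideal_prod.prod[of "g x" "F x" "\<Prod>i\<in>A. g i" _ "poly_ring m n"] insert by simp
qed

text \<open>
  Products of ideals are compared with a multiplicative filtration \<open>V\<close>, here always the filtration of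
  a valuation or a monomial analogue of one.
\<close>

lemma finprod_subset_filtration:
  fixes V :: "nat \<Rightarrow> 'k::field xpoly set"
  assumes "finite A" "\<And>i. i \<in> A \<Longrightarrow> ideal (F i) (poly_ring m n)"
    and V: "\<And>k. ideal (V k) (poly_ring m n)" "V 0 = carrier (poly_ring m n)"
      "\<And>k l f g. f \<in> V k \<Longrightarrow> g \<in> V l \<Longrightarrow> f * g \<in> V (k + l)"
    and "\<And>i. i \<in> A \<Longrightarrow> F i \<subseteq> V (w i)"
  shows "(\<Otimes>\<^bsub>ideals_set (poly_ring m n)\<^esub> i\<in>A. F i) \<subseteq> V (\<Sum>i\<in>A. w i)"
  using assms(1,2,6)
proof (induction A rule: finite_induct)
  case empty
  then show ?case using V(2) by simp
next
  case (insert x A)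
  have eq: "(\<Otimes>\<^bsub>ideals_set (poly_ring m n)\<^esub> i\<in>insert x A. F i)
      = ideal_prod (poly_ring m n) (F x) (\<Otimes>\<^bsub>ideals_set (poly_ring m n)\<^esub> i\<in>A. F i)"
    using insert by (subst IM.finprod_insert) auto
  have "s \<in> V (w x + (\<Sum>i\<in>A. w i))"
    if "s \<in> ideal_prod (poly_ring m n) (F x) (\<Otimes>\<^bsub>ideals_set (poly_ring m n)\<^esub> i\<in>A. F i)" for s
    using that
  proof (induction rule: ideal_prod.induct)
    case (prod i j)
    have "i \<in> V (w x)" using prod(1) insert.prems(2) by blast
    moreover have "j \<in> V (\<Sum>i\<in>A. w i)" using prod(2) insert.IH insert.prems by blast
    ultimately show ?case using V(3) by simp
  next
    case (sum s1 s2)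
    then show ?case using poly_idealD(3)[OF V(1)] by simp
  qed
  then show ?case using insert.hyps by (auto simp: eq)
qed

lemma ideal_pow_eq_finprod:
  assumes "ideal I (poly_ring m n :: 'k::field xpoly ring)"
  shows "ideal_pow (poly_ring m n) I e = (\<Otimes>\<^bsub>ideals_set (poly_ring m n)\<^esub> i\<in>{..<e}. I)"
  using IM.finprod_const[of I m n "{..<e}"] assms by simp

section \<open>Substitution\<close>

text \<open>
  The value of a monomial at a point \<open>h\<close> of a ring, and below it, over a homomorphism of the
  coefficient rings, that of a polynomial: the universal property of a polynomial ring.
\<close>

definition monom_value :: "('v \<Rightarrow> 'r::comm_ring_1) \<Rightarrow> ('v \<Rightarrow>\<^sub>0 nat) \<Rightarrow> 'r" where
  "monom_value h \<nu> = (\<Prod>x\<in>keys \<nu>. h x ^ lookup \<nu> x)"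

lemma monom_value_superset:
  assumes "finite A" "keys \<nu> \<subseteq> A"
  shows "monom_value h \<nu> = (\<Prod>x\<in>A. h x ^ lookup \<nu> x)"
  unfolding monom_value_def
  using assms by (intro prod.mono_neutral_left) (auto simp: in_keys_iff)

lemma monom_value_0 [simp]: "monom_value h 0 = 1"
  by (simp add: monom_value_def)

lemma monom_value_add: "monom_value h (\<mu> + \<nu>) = monom_value h \<mu> * monom_value h \<nu>"
proof -
  let ?A = "keys \<mu> \<union> keys \<nu>"
  have "monom_value h (\<mu> + \<nu>) = (\<Prod>x\<in>?A. h x ^ lookup (\<mu> + \<nu>) x)"
    using Poly_Mapping.keys_add[of \<mu> \<nu>] by (intro monom_value_superset) auto
  also have "\<dots> = (\<Prod>x\<in>?A. h x ^ lookup \<mu> x) * (\<Prod>x\<in>?A. h x ^ lookup \<nu> x)"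
    by (simp add: lookup_add power_add prod.distrib)
  also have "\<dots> = monom_value h \<mu> * monom_value h \<nu>"
    by (subst (1 2) monom_value_superset[of ?A]) auto
  finally show ?thesis .
qed

lemma monom_value_single: "monom_value h (single x e) = h x ^ e"
  by (cases "e = 0") (auto simp: monom_value_def)

lemma monom_value_cong:
  "(\<And>x. x \<in> keys \<nu> \<Longrightarrow> g x = h x) \<Longrightarrow> monom_value g \<nu> = monom_value h \<nu>"
  unfolding monom_value_def by (intro prod.cong) auto

lemma monom_value_indicator:
  assumes "finite P"
  shows "monom_value (\<lambda>x. if x \<in> P then p else 1) \<mu> = p ^ (\<Sum>x\<in>P. lookup \<mu> x)"
proof -
  have "monom_value (\<lambda>x. if x \<in> P then p else 1) \<mu>
      = (\<Prod>x\<in>keys \<mu> \<union> P. (if x \<in> P then p else 1) ^ lookup \<mu> x)"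
    using assms by (intro monom_value_superset) auto
  also have "\<dots> = (\<Prod>x\<in>P. p ^ lookup \<mu> x)"
    using assms by (intro prod.mono_neutral_cong_right) auto
  finally show ?thesis by (simp add: power_sum)
qed

definition subst ::
    "('a::comm_ring_1 \<Rightarrow> 'r::comm_ring_1) \<Rightarrow> ('v \<Rightarrow> 'r) \<Rightarrow> (('v \<Rightarrow>\<^sub>0 nat) \<Rightarrow>\<^sub>0 'a) \<Rightarrow> 'r" where
  "subst \<phi> h f = (\<Sum>\<nu>\<in>keys f. \<phi> (lookup f \<nu>) * monom_value h \<nu>)"

context comm_ring_hom
begin

lemma subst_superset:
  assumes "finite A" "keys f \<subseteq> A"
  shows "subst hom h f = (\<Sum>\<nu>\<in>A. hom (lookup f \<nu>) * monom_value h \<nu>)"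
  unfolding subst_def
  using assms by (intro sum.mono_neutral_left) (auto simp: in_keys_iff)

lemma subst_add: "subst hom h (f + g) = subst hom h f + subst hom h g"
proof -
  let ?A = "keys f \<union> keys g"
  have "subst hom h (f + g) = (\<Sum>\<nu>\<in>?A. hom (lookup (f + g) \<nu>) * monom_value h \<nu>)"
    using Poly_Mapping.keys_add[of f g] by (intro subst_superset) auto
  also have "\<dots> = (\<Sum>\<nu>\<in>?A. hom (lookup f \<nu>) * monom_value h \<nu>)
      + (\<Sum>\<nu>\<in>?A. hom (lookup g \<nu>) * monom_value h \<nu>)"
    by (simp add: lookup_add hom_add algebra_simps sum.distrib)
  also have "\<dots> = subst hom h f + subst hom h g"
    by (subst (1 2) subst_superset[of ?A]) auto
  finally show ?thesis .
qed

lemma subst_0: "subst hom h 0 = 0"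
  by (simp add: subst_def)

lemma subst_sum: "subst hom h (\<Sum>i\<in>A. f i) = (\<Sum>i\<in>A. subst hom h (f i))"
  by (induction A rule: infinite_finite_induct) (auto simp: subst_add subst_0)

lemma subst_single: "subst hom h (single \<nu> c) = hom c * monom_value h \<nu>"
  by (cases "c = 0") (auto simp: subst_def)

lemma subst_mult: "subst hom h (f * g) = subst hom h f * subst hom h g"
proof -
  have "f * g = (\<Sum>\<mu>\<in>keys f. single \<mu> (lookup f \<mu>)) * (\<Sum>\<nu>\<in>keys g. single \<nu> (lookup g \<nu>))"
    by (simp add: sum_single_lookup)
  also have "\<dots> = (\<Sum>\<mu>\<in>keys f. \<Sum>\<nu>\<in>keys g. single (\<mu> + \<nu>) (lookup f \<mu> * lookup g \<nu>))"
    by (simp add: sum_product mult_single)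
  finally have "subst hom h (f * g)
      = (\<Sum>\<mu>\<in>keys f. \<Sum>\<nu>\<in>keys g. hom (lookup f \<mu> * lookup g \<nu>) * monom_value h (\<mu> + \<nu>))"
    by (simp add: subst_sum subst_single)
  also have "\<dots> = subst hom h f * subst hom h g"
    by (simp add: subst_def sum_product hom_mult monom_value_add mult_ac)
  finally show ?thesis .
qed

lemma subst_one: "subst hom h 1 = 1"
  using subst_single[of h 0 1] by simp

lemma comm_ring_hom_subst: "comm_ring_hom (subst hom h)"
  by standard (auto simp: subst_add subst_mult subst_0 subst_one)

end

text \<open>
  The parameter of a deformation.  All valuations below are \<open>eps\<close>-adic orders along a homomorphism
  \<open>h\<close> from \<open>K[X]\<close> into polynomials with coefficients in \<open>K[eps]\<close>.  Keeping \<open>eps\<close> in the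
  coefficients makes the leading coefficient of an image a polynomial in \<open>eps\<close>, whose order can be
  read off.
\<close>

definition eps :: "'k::field poly xpoly" where "eps = single 0 [:0, 1:]"

definition eps_subst :: "(nat \<times> nat \<Rightarrow> 'k::field poly xpoly) \<Rightarrow> 'k xpoly \<Rightarrow> 'k poly xpoly" where
  "eps_subst h = subst (\<lambda>a. single 0 [:a:]) h"

lemma comm_ring_hom_const_eps: "comm_ring_hom (\<lambda>a::'k::field. single 0 [:a:] :: 'k poly xpoly)"
proof
  show "single 0 [:1::'k:] = (1 :: 'k poly xpoly)" by (metis one_pCons single_one)
qed (auto simp: mult_single single_add[symmetric] mult.commute)

lemma comm_ring_hom_eps_subst: "comm_ring_hom (eps_subst h)"
  unfolding eps_subst_def by (rule comm_ring_hom.comm_ring_hom_subst[OF comm_ring_hom_const_eps])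

interpretation eps_subst: comm_ring_hom "eps_subst h" by (rule comm_ring_hom_eps_subst)

lemma eps_power: "eps ^ k = single 0 ([:0, 1:] ^ k)"
  by (induction k) (auto simp: eps_def mult_single)

lemma eps_power_dvd_lookup: "eps ^ k dvd f \<Longrightarrow> [:0, 1:] ^ k dvd lookup f \<kappa>"
  by (auto simp: dvd_def eps_power lookup_const_mult)

lemma eps_dvd_iff: "eps dvd f \<longleftrightarrow> (\<forall>\<kappa>. [:0, 1:] dvd lookup f \<kappa>)"
proof
  assume "eps dvd f"
  then show "\<forall>\<kappa>. [:0, 1:] dvd lookup f \<kappa>" using eps_power_dvd_lookup[of 1 f] by simp
next
  assume *: "\<forall>\<kappa>. [:0, 1:] dvd lookup f \<kappa>"
  then have "\<forall>\<kappa>. \<exists>q. lookup f \<kappa> = [:0, 1:] * q" by (auto simp: dvd_def)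
  then obtain q where q: "\<And>\<kappa>. lookup f \<kappa> = [:0, 1:] * q \<kappa>" by metis
  have "f = (\<Sum>\<nu>\<in>keys f. eps * single \<nu> (q \<nu>))"
    by (subst sum_single_lookup[symmetric], subst q) (simp add: eps_def mult_single)
  also have "\<dots> = eps * (\<Sum>\<nu>\<in>keys f. single \<nu> (q \<nu>))" by (simp only: sum_distrib_left)
  finally show "eps dvd f" by (rule dvdI)
qed

text \<open>
  Setting \<open>eps\<close> to zero in the coefficients is a homomorphism onto the domain of polynomials over
  \<open>K\<close>, with kernel generated by \<open>eps\<close>.
\<close>

lemma prime_elem_eps: "prime_elem (eps :: 'k::field poly xpoly)"
proof -
  define red :: "'k poly xpoly \<Rightarrow> 'k xpoly" where
    "red = subst (\<lambda>p. single 0 (poly p 0)) (\<lambda>x. single (single x 1) 1)"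
  have "comm_ring_hom (\<lambda>p::'k poly. single 0 (poly p 0) :: 'k xpoly)"
    by standard (auto simp: mult_single single_add[symmetric])
  then interpret red: comm_ring_hom red
    unfolding red_def by (rule comm_ring_hom.comm_ring_hom_subst)
  have pw: "single (single x 1) (1::'k) ^ e = single (single x e) 1" for x :: "nat \<times> nat" and e
    by (induction e) (auto simp: mult_single single_add[symmetric])
  have pr: "(\<Prod>x\<in>A. single (f x) (1::'k)) = single (\<Sum>x\<in>A. f x) 1" for A :: "(nat \<times> nat) set" and f :: "nat \<times> nat \<Rightarrow> xmonom"
    by (induction A rule: infinite_finite_induct) (auto simp: mult_single)
  have mv: "monom_value (\<lambda>x. single (single x 1) (1::'k)) \<nu> = single \<nu> 1" for \<nu> :: xmonom
    unfolding monom_value_def pw pr sum_single_lookup ..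
  have lred: "lookup (red f) \<kappa> = poly (lookup f \<kappa>) 0" for f \<kappa>
  proof -
    have "red f = (\<Sum>\<nu>\<in>keys f. single \<nu> (poly (lookup f \<nu>) 0))"
      unfolding red_def subst_def mv by (simp add: mult_single)
    then have "lookup (red f) \<kappa> = (\<Sum>\<nu>\<in>keys f. if \<nu> = \<kappa> then poly (lookup f \<nu>) 0 else 0)"
      by (simp add: lookup_sum lookup_single when_def)
    then show ?thesis by (simp add: in_keys_iff)
  qed
  have iff: "eps dvd f \<longleftrightarrow> red f = 0" for f
    unfolding eps_dvd_iff
    by (auto simp: lred poly_mapping_eq_iff fun_eq_iff poly_eq_0_iff_dvd)
  show ?thesis
  proof (rule prime_elemI)
    show "(eps :: 'k poly xpoly) \<noteq> 0" 
    proof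
      assume "(eps :: 'k poly xpoly) = 0"
      then have "lookup (eps :: 'k poly xpoly) 0 = 0" by simp
      then show False by (simp add: eps_def)
    qed
    show "\<not> (eps :: 'k poly xpoly) dvd 1" by (simp add: iff)
    show "eps dvd f \<or> eps dvd g" if "eps dvd f * g" for f g :: "'k poly xpoly"
      using that by (simp add: iff red.hom_mult)
  qed
qed

lemma X_power_dvd_smult:
  fixes c :: "'k::field"
  assumes "c \<noteq> 0" "[:0, 1:] ^ k dvd smult c ([:0, 1:] ^ w)"
  shows "k \<le> w"
proof -
  have "[:0, 1:] ^ k dvd ([:0, 1:] :: 'k poly) ^ w"
    using assms by (simp only: dvd_smult_iff simp_thms)
  then have "degree (([:0, 1:] :: 'k poly) ^ k) \<le> degree (([:0, 1:] :: 'k poly) ^ w)"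
    by (rule dvd_imp_degree_le) simp
  then show ?thesis by (simp add: degree_power_eq)
qed

lemma eps_subst_cong:
  assumes "f \<in> carrier (poly_ring m n)" "\<And>i j. i \<in> {1..m} \<Longrightarrow> j \<in> {1..n} \<Longrightarrow> g (i, j) = h (i, j)"
  shows "eps_subst g f = eps_subst h f"
  unfolding eps_subst_def subst_def
proof (rule sum.cong[OF refl])
  fix \<nu> assume "\<nu> \<in> keys f"
  then have "keys \<nu> \<subseteq> {1..m} \<times> {1..n}" using assms(1) by (auto simp: carrier_poly_ring_iff monoms_def)
  then have "monom_value g \<nu> = monom_value h \<nu>" using assms(2) by (intro monom_value_cong) auto
  then show "single 0 [:lookup f \<nu>:] * monom_value g \<nu> = single 0 [:lookup f \<nu>:] * monom_value h \<nu>" by simp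
qed

section \<open>Valuation ideals\<close>

lemma prime_elem_power_cancel:
  fixes p :: "'r::idom"
  assumes "prime_elem p" "\<not> p dvd g" "p ^ k dvd f * g"
  shows "p ^ k dvd f"
  using assms(3)
proof (induction k)
  case (Suc k)
  have "p ^ k dvd f * g" by (rule dvd_trans[OF le_imp_power_dvd Suc.prems]) simp
  then have "p ^ k dvd f" by (rule Suc.IH)
  then obtain f' where f': "f = p ^ k * f'" by (auto simp: dvd_def)
  have "p ^ k * p dvd p ^ k * (f' * g)" using Suc.prems by (simp add: f' mult_ac)
  then have "p dvd f' * g" using assms(1) by (simp add: prime_elem_def)
  then have "p dvd f'" using assms(1,2) by (auto simp: prime_elem_def)
  then show ?case by (simp add: f' mult.commute mult_dvd_mono)
qed simp

text \<open>
  The polynomials of value at least \<open>k\<close> for the valuation given by the \<open>eps\<close>-adic order of the image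
  under \<open>x\<^sub>i\<^sub>j \<mapsto> h (i, j)\<close>.
\<close>

definition val_ideal ::
    "nat \<Rightarrow> nat \<Rightarrow> (nat \<times> nat \<Rightarrow> 'k::field poly xpoly) \<Rightarrow> nat \<Rightarrow> 'k xpoly set" where
  "val_ideal m n h k = {f \<in> carrier (poly_ring m n). eps ^ k dvd eps_subst h f}"

lemma val_ideal_0: "val_ideal m n h 0 = carrier (poly_ring m n)"
  by (simp add: val_ideal_def)

lemma ideal_val_ideal: "ideal (val_ideal m n h k) (poly_ring m n)"
proof (rule poly_idealI)
  fix f g :: "'a xpoly" assume "f \<in> val_ideal m n h k" "g \<in> val_ideal m n h k"
  then show "f + g \<in> val_ideal m n h k"
    by (simp add: val_ideal_def eps_subst.hom_add dvd_add)
next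
  fix f g :: "'a xpoly" assume "f \<in> val_ideal m n h k" "g \<in> carrier (poly_ring m n)"
  then show "g * f \<in> val_ideal m n h k"
    by (simp add: val_ideal_def eps_subst.hom_mult dvd_mult)
qed (auto simp: val_ideal_def)

lemma val_ideal_mult:
  assumes "f \<in> val_ideal m n h k" "g \<in> val_ideal m n h l"
  shows "f * g \<in> val_ideal m n h (k + l)"
  using assms by (simp add: val_ideal_def eps_subst.hom_mult power_add mult_dvd_mono)

text \<open>
  If \<open>x y\<close> has value at least \<open>k\<close> and \<open>x\<close> has not, then \<open>y\<close> has positive value because \<open>eps\<close> is
  prime, and so \<open>y ^ k\<close> has value at least \<open>k\<close>.
\<close>

lemma primary_val_ideal:
  assumes "1 \<le> k"
  shows "primary_ideal (poly_ring m n) (val_ideal m n h k)"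
  unfolding primary_ideal_def
proof (intro conjI ballI impI)
  show "ideal (val_ideal m n h k) (poly_ring m n)" by (rule ideal_val_ideal)
  have "\<not> eps ^ k dvd (1 :: 'a poly xpoly)"
  proof
    assume "eps ^ k dvd (1 :: 'a poly xpoly)"
    moreover have "eps dvd (eps ^ k :: 'a poly xpoly)" using assms by (intro dvd_power) simp
    ultimately have "eps dvd (1 :: 'a poly xpoly)" by (blast intro: dvd_trans)
    then show False using prime_elem_eps by (auto simp: prime_elem_def)
  qed
  then have "1 \<notin> val_ideal m n h k" by (simp add: val_ideal_def eps_subst.hom_one)
  then show "val_ideal m n h k \<noteq> carrier (poly_ring m n)" by auto
  fix x y :: "'a xpoly"
  assume x: "x \<in> carrier (poly_ring m n)" and y: "y \<in> carrier (poly_ring m n)"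
    and xy: "x \<otimes>\<^bsub>poly_ring m n\<^esub> y \<in> val_ideal m n h k"
  show "x \<in> val_ideal m n h k \<or> (\<exists>j::nat. y [^]\<^bsub>poly_ring m n\<^esub> j \<in> val_ideal m n h k)"
  proof (cases "eps dvd eps_subst h y")
    case True
    then have "eps ^ k dvd eps_subst h (y ^ k)" by (simp add: eps_subst.hom_power dvd_power_same)
    then have "y [^]\<^bsub>poly_ring m n\<^esub> k \<in> val_ideal m n h k" using y by (simp add: val_ideal_def)
    then show ?thesis by blast
  next
    case False
    have "eps ^ k dvd eps_subst h x * eps_subst h y"
      using xy by (simp add: val_ideal_def eps_subst.hom_mult)
    then have "eps ^ k dvd eps_subst h x" by (rule prime_elem_power_cancel[OF prime_elem_eps False])
    then show ?thesis using x by (simp add: val_ideal_def)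
  qed
qed

lemma prime_elem_dvd_powerD:
  fixes p :: "'r::idom"
  assumes "prime_elem p" "p dvd g ^ k"
  shows "p dvd g"
  using assms by (induction k) (auto simp: prime_elem_def)

text \<open>
  If \<open>p ^ c\<close> is the exact power of \<open>p\<close> in \<open>f\<close> and \<open>c < e\<close>, then every term of the equation other
  than \<open>f ^ k\<close> is divisible by a higher power of \<open>p\<close> than \<open>f ^ k\<close> is, which contradicts the equation.
  The proof raises \<open>c\<close> step by step.
\<close>

lemma dvd_from_integral_equation:
  fixes p :: "'r::idom"
  assumes p: "prime_elem p" and k: "1 \<le> k" and a0: "a 0 = 1"
    and a: "\<And>i. i \<in> {1..k} \<Longrightarrow> p ^ (i * e) dvd a i"
    and eq: "(\<Sum>i\<le>k. a i * f ^ (k - i)) = 0"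
  shows "p ^ e dvd f"
proof -
  have "p ^ c dvd f" if "c \<le> e" for c
    using that
  proof (induction c)
    case (Suc c)
    then obtain g where g: "f = p ^ c * g" by (auto simp: dvd_def)
    have "p ^ Suc (k * c) dvd a i * f ^ (k - i)" if i: "i \<in> {1..k}" for i
    proof -
      have "Suc (k * c) \<le> i * e + c * (k - i)"
      proof -
        have "i + i * c \<le> i * e" using Suc.prems mult_le_mono2[of "Suc c" e i] by simp
        moreover have "k * c = i * c + c * (k - i)" using i by (simp add: diff_mult_distrib2 mult.commute)
        ultimately show ?thesis using i by auto
      qed
      then have "p ^ Suc (k * c) dvd p ^ (i * e) * (p ^ c) ^ (k - i)"
        unfolding power_mult[symmetric] power_add[symmetric] by (rule le_imp_power_dvd)
      also have "\<dots> dvd a i * f ^ (k - i)"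
        by (intro mult_dvd_mono a i dvd_power_same) (simp add: g)
      finally show ?thesis .
    qed
    then have "p ^ Suc (k * c) dvd (\<Sum>i\<in>{1..k}. a i * f ^ (k - i))" by (rule dvd_sum)
    moreover have "(\<Sum>i\<le>k. a i * f ^ (k - i)) = f ^ k + (\<Sum>i\<in>{1..k}. a i * f ^ (k - i))"
    proof -
      have "{..k} = insert 0 {1..k}" by auto
      then show ?thesis using a0 by simp
    qed
    moreover from this have "f ^ k = - (\<Sum>i\<in>{1..k}. a i * f ^ (k - i))"
      using eq by (simp add: eq_neg_iff_add_eq_0)
    ultimately have "p ^ Suc (k * c) dvd f ^ k" by (simp only: dvd_minus_iff)
    then have "p ^ (c * k) * p dvd p ^ (c * k) * g ^ k"
      by (simp add: g power_mult_distrib power_mult[symmetric] mult.commute)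
    moreover have "p \<noteq> 0" using p by (simp add: prime_elem_def)
    ultimately have "p dvd g ^ k" by simp
    then have "p dvd g" by (rule prime_elem_dvd_powerD[OF p])
    then have "p ^ c * p dvd p ^ c * g" by (intro mult_dvd_mono dvd_refl)
    then show ?case unfolding g power_Suc2 .
  qed simp
  then show ?thesis by simp
qed

lemma ideal_pow_val_ideal:
  assumes "ideal I (poly_ring m n)" "I \<subseteq> val_ideal m n h e"
  shows "ideal_pow (poly_ring m n) I i \<subseteq> val_ideal m n h (i * e)"
  unfolding ideal_pow_eq_finprod[OF assms(1)]
  using finprod_subset_filtration[where V = "val_ideal m n h" and A = "{..<i}" and F = "\<lambda>_. I"
      and w = "\<lambda>_. e", OF _ _ ideal_val_ideal val_ideal_0 val_ideal_mult] assms by simp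

text \<open>
  An equation of integral dependence over \<open>I\<close> maps to one over each \<open>eps\<close>-adic filtration, and there
  the valuation gives the bound on \<open>f\<close>.
\<close>

lemma integrally_closed_Inter_val_ideals:
  fixes I :: "'k::field xpoly set"
  assumes I: "I = carrier (poly_ring m n) \<inter> (\<Inter>j\<in>A. val_ideal m n (h j) (e j))"
  shows "integrally_closed_ideal (poly_ring m n) I"
  unfolding integrally_closed_ideal_def
proof
  let ?R = "poly_ring m n :: 'k xpoly ring"
  show id: "ideal I ?R"
  proof (rule poly_idealI)
    show "0 \<in> I" by (simp add: I poly_idealD(2)[OF ideal_val_ideal])
    show "f + g \<in> I" if "f \<in> I" "g \<in> I" for f g
      using that by (simp add: I poly_idealD(3)[OF ideal_val_ideal])
    show "g * f \<in> I" if "f \<in> I" "g \<in> carrier ?R" for f g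
      using that by (simp add: I poly_idealD(4)[OF ideal_val_ideal])
  qed (simp add: I)
  show "ideal_integral_closure ?R I = I"
  proof
    show "ideal_integral_closure ?R I \<subseteq> I"
    proof
      fix f assume "f \<in> ideal_integral_closure ?R I"
      then obtain k a where f: "f \<in> carrier ?R" and k: "1 \<le> k" and a0: "a 0 = 1"
        and a: "\<And>i. i \<in> {1..k} \<Longrightarrow> a i \<in> ideal_pow ?R I i"
        and eq: "(\<Oplus>\<^bsub>?R\<^esub> i\<in>{..k}. a i \<otimes>\<^bsub>?R\<^esub> (f [^]\<^bsub>?R\<^esub> (k - i))) = 0"
        unfolding ideal_integral_closure_def by auto
      have ac: "a i \<in> carrier ?R" if "i \<le> k" for i
      proof (cases "i = 0")
        case True
        then show ?thesis using a0 by simp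
      next
        case False
        then have "a i \<in> ideal_pow ?R I i" using a[of i] that by simp
        moreover have "ideal (ideal_pow ?R I i) ?R"
          using ideal_finprod[of "{..<i}" "\<lambda>_. I" m n] id ideal_pow_eq_finprod[OF id] by simp
        ultimately show ?thesis using poly_idealD(1) by blast
      qed
      have "(\<Oplus>\<^bsub>?R\<^esub> i\<in>{..k}. a i \<otimes>\<^bsub>?R\<^esub> (f [^]\<^bsub>?R\<^esub> (k - i))) = (\<Sum>i\<le>k. a i \<otimes>\<^bsub>?R\<^esub> (f [^]\<^bsub>?R\<^esub> (k - i)))"
        by (rule poly_ring_finsum) (use ac f in auto)
      then have eq: "(\<Sum>i\<le>k. a i * f ^ (k - i)) = 0" using eq by simp
      have "f \<in> val_ideal m n (h j) (e j)" if j: "j \<in> A" for j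
      proof -
        let ?\<theta> = "eps_subst (h j)"
        have "eps ^ (e j) dvd ?\<theta> f"
        proof (rule dvd_from_integral_equation[OF prime_elem_eps k])
          show "?\<theta> (a 0) = 1" by (simp add: a0 eps_subst.hom_one)
          show "eps ^ (i * e j) dvd ?\<theta> (a i)" if "i \<in> {1..k}" for i
            using ideal_pow_val_ideal[OF id, of "h j" "e j" i] a[OF that] j
            by (auto simp: I val_ideal_def)
          have "?\<theta> (\<Sum>i\<le>k. a i * f ^ (k - i)) = 0" by (simp only: eq eps_subst.hom_zero)
          then show "(\<Sum>i\<le>k. ?\<theta> (a i) * ?\<theta> f ^ (k - i)) = 0"
            by (simp add: eps_subst.hom_sum eps_subst.hom_mult eps_subst.hom_power)
        qed
        then show ?thesis using f by (simp add: val_ideal_def)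
      qed
      then show "f \<in> I" using f by (simp add: I)
    qed
    show "I \<subseteq> ideal_integral_closure ?R I"
    proof
      fix f assume f: "f \<in> I"
      then have fc: "f \<in> carrier ?R" by (simp add: I)
      define a where "a i = (if i = (0::nat) then 1 else - f)" for i
      have "- f = - 1 * f" by simp
      also have "\<dots> \<in> I" by (rule poly_idealD(4)[OF id f]) simp
      finally have mf: "- f \<in> I" .
      have "(\<Oplus>\<^bsub>?R\<^esub> i\<in>{..1}. a i \<otimes>\<^bsub>?R\<^esub> (f [^]\<^bsub>?R\<^esub> (1 - i))) = (\<Sum>i\<le>1. a i \<otimes>\<^bsub>?R\<^esub> (f [^]\<^bsub>?R\<^esub> (1 - i)))"
      proof (rule poly_ring_finsum)
        fix i assume "i \<in> {..1::nat}"
        then have "a i \<in> carrier ?R" using fc by (auto simp: a_def)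
        then show "a i \<otimes>\<^bsub>?R\<^esub> (f [^]\<^bsub>?R\<^esub> (1 - i)) \<in> carrier ?R"
          using fc by simp
      qed simp
      then have "(\<Oplus>\<^bsub>?R\<^esub> i\<in>{..1}. a i \<otimes>\<^bsub>?R\<^esub> (f [^]\<^bsub>?R\<^esub> (1 - i))) = 0"
        by (simp add: a_def)
      moreover have "ideal_pow ?R I 1 = I" by (rule ideal_pow_1[OF id])
      then have "a i \<in> ideal_pow ?R I i" if "i \<in> {1..1}" for i
        using that mf by (auto simp: a_def)
      ultimately show "f \<in> ideal_integral_closure ?R I"
        unfolding ideal_integral_closure_def using fc
        by (auto intro!: exI[of _ 1] exI[of _ a] simp: a_def)
    qed
  qed
qed

section \<open>Degrees and leading terms\<close>

definition mdeg :: "xmonom \<Rightarrow> nat" where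
  "mdeg \<mu> = (\<Sum>x\<in>keys \<mu>. lookup \<mu> x)"

lemma mdeg_superset: "finite A \<Longrightarrow> keys \<mu> \<subseteq> A \<Longrightarrow> mdeg \<mu> = (\<Sum>x\<in>A. lookup \<mu> x)"
  unfolding mdeg_def by (intro sum.mono_neutral_left) (auto simp: in_keys_iff)

lemma mdeg_add: "mdeg (\<mu> + \<nu>) = mdeg \<mu> + mdeg \<nu>"
proof -
  let ?A = "keys \<mu> \<union> keys \<nu>"
  have "mdeg (\<mu> + \<nu>) = (\<Sum>x\<in>?A. lookup (\<mu> + \<nu>) x)"
    using Poly_Mapping.keys_add[of \<mu> \<nu>] by (intro mdeg_superset) auto
  also have "\<dots> = (\<Sum>x\<in>?A. lookup \<mu> x) + (\<Sum>x\<in>?A. lookup \<nu> x)"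
    by (simp add: lookup_add sum.distrib)
  also have "\<dots> = mdeg \<mu> + mdeg \<nu>"
    by (subst (1 2) mdeg_superset[of ?A]) auto
  finally show ?thesis .
qed

lemma mdeg_0 [simp]: "mdeg 0 = 0"
  by (simp add: mdeg_def)

lemma mdeg_single [simp]: "mdeg (single x e) = e"
  by (cases "e = 0") (auto simp: mdeg_def)

lemma mdeg_sum: "mdeg (\<Sum>i\<in>A. f i) = (\<Sum>i\<in>A. mdeg (f i))"
  by (induction A rule: infinite_finite_induct) (auto simp: mdeg_add)

lemma finite_monoms_bounded: "finite {\<mu> \<in> monoms m n. mdeg \<mu> \<le> N}"
proof -
  let ?A = "{1..m} \<times> {1..n}"
  let ?S = "{f. \<forall>x. (x \<in> ?A \<longrightarrow> f x \<in> {..N}) \<and> (x \<notin> ?A \<longrightarrow> f x = 0)}"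
  have "finite ?S" by (rule finite_set_of_finite_funs) auto
  moreover have "lookup ` {\<mu> \<in> monoms m n. mdeg \<mu> \<le> N} \<subseteq> ?S"
  proof clarify
    fix \<mu> :: xmonom and i j
    assume \<mu>: "\<mu> \<in> monoms m n" "mdeg \<mu> \<le> N"
    have "lookup \<mu> (i, j) \<le> N"
    proof (cases "(i, j) \<in> keys \<mu>")
      case True
      then have "lookup \<mu> (i, j) \<le> mdeg \<mu>" unfolding mdeg_def by (intro member_le_sum) auto
      then show ?thesis using \<mu>(2) by simp
    qed (simp add: in_keys_iff)
    moreover have "lookup \<mu> (i, j) = 0" if "(i, j) \<notin> ?A"
      using \<mu>(1) that by (auto simp: monoms_def in_keys_iff)
    ultimately show "((i, j) \<in> ?A \<longrightarrow> lookup \<mu> (i, j) \<in> {..N}) \<and> ((i, j) \<notin> ?A \<longrightarrow> lookup \<mu> (i, j) = 0)"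
      by simp
  qed
  ultimately have "finite (lookup ` {\<mu> \<in> monoms m n. mdeg \<mu> \<le> N})" by (rule finite_subset[rotated])
  then show ?thesis
    by (rule finite_imageD) (rule inj_onI, rule poly_mapping_eqI, simp)
qed

lemma monoms_sum: "(\<And>i. i \<in> A \<Longrightarrow> f i \<in> monoms m n) \<Longrightarrow> (\<Sum>i\<in>A. f i) \<in> monoms m n"
  by (induction A rule: infinite_finite_induct) (auto simp: monoms_add, auto simp: monoms_def)

definition homogeneous :: "nat \<Rightarrow> (xmonom \<Rightarrow>\<^sub>0 'a::zero) \<Rightarrow> bool" where
  "homogeneous d f \<longleftrightarrow> (\<forall>\<kappa>\<in>keys f. mdeg \<kappa> = d)"

lemma homogeneous_mult:
  fixes f g :: "xmonom \<Rightarrow>\<^sub>0 'a::comm_ring_1"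
  assumes "homogeneous d f" "homogeneous e g"
  shows "homogeneous (d + e) (f * g)"
  unfolding homogeneous_def
proof
  fix \<kappa> assume "\<kappa> \<in> keys (f * g)"
  then obtain a b where "\<kappa> = a + b" "a \<in> keys f" "b \<in> keys g"
    using Poly_Mapping.keys_mult[of f g] by blast
  then show "mdeg \<kappa> = d + e" using assms by (simp add: homogeneous_def mdeg_add)
qed

lemma homogeneous_1: "homogeneous 0 (1 :: xmonom \<Rightarrow>\<^sub>0 'a::comm_ring_1)"
  by (simp add: homogeneous_def)

lemma homogeneous_diff:
  fixes f g :: "xmonom \<Rightarrow>\<^sub>0 'a::comm_ring_1"
  assumes "homogeneous d f" "homogeneous d g"
  shows "homogeneous d (f - g)"
  using assms Poly_Mapping.keys_diff[of f g] by (auto simp: homogeneous_def)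

lemma homogeneous_single: "homogeneous (mdeg \<mu>) (single \<mu> c)"
  by (simp add: homogeneous_def)

lemma homogeneous_prod:
  fixes f :: "'i \<Rightarrow> (xmonom \<Rightarrow>\<^sub>0 'a::comm_ring_1)"
  shows "(\<And>i. i \<in> A \<Longrightarrow> homogeneous (d i) (f i)) \<Longrightarrow> homogeneous (\<Sum>i\<in>A. d i) (\<Prod>i\<in>A. f i)"
  by (induction A rule: infinite_finite_induct) (auto simp: homogeneous_1 homogeneous_mult)

text \<open>
  The monomial \<open>\<tau>\<close> bounds all monomials of \<open>f\<close>, and \<open>c\<close> is its coefficient.  Zero is allowed for
  \<open>c\<close>: after a reduction step the old initial monomial is still a bound.  The coefficients may come
  from any ring, since images in \<open>K[eps][X]\<close> are treated in the same way.
\<close>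

definition leads ::
    "(xmonom \<times> xmonom) set \<Rightarrow> xmonom \<Rightarrow> 'a::zero \<Rightarrow> (xmonom \<Rightarrow>\<^sub>0 'a) \<Rightarrow> bool" where
  "leads ord \<tau> c f \<longleftrightarrow> lookup f \<tau> = c \<and> (\<forall>\<kappa>\<in>keys f. (\<kappa>, \<tau>) \<in> ord)"

context
  fixes m n :: nat and ord :: "(xmonom \<times> xmonom) set"
  assumes mo: "monomial_order m n ord"
begin

lemma ord_monoms: "(\<mu>, \<nu>) \<in> ord \<Longrightarrow> \<mu> \<in> monoms m n \<and> \<nu> \<in> monoms m n"
  using mo by (auto simp: monomial_order_def order_on_defs)

lemma ord_refl: "\<mu> \<in> monoms m n \<Longrightarrow> (\<mu>, \<mu>) \<in> ord"
  using mo by (auto simp: monomial_order_def order_on_defs refl_on_def)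

lemma ord_trans: "(\<mu>, \<nu>) \<in> ord \<Longrightarrow> (\<nu>, \<rho>) \<in> ord \<Longrightarrow> (\<mu>, \<rho>) \<in> ord"
  using mo by (auto simp: monomial_order_def order_on_defs dest: transD)

lemma ord_antisym: "(\<mu>, \<nu>) \<in> ord \<Longrightarrow> (\<nu>, \<mu>) \<in> ord \<Longrightarrow> \<mu> = \<nu>"
  using mo by (auto simp: monomial_order_def order_on_defs dest: antisymD)

lemma ord_total: "\<mu> \<in> monoms m n \<Longrightarrow> \<nu> \<in> monoms m n \<Longrightarrow> (\<mu>, \<nu>) \<in> ord \<or> (\<nu>, \<mu>) \<in> ord"
  using mo ord_refl[of \<mu>] by (cases "\<mu> = \<nu>") (auto simp: monomial_order_def order_on_defs total_on_def)

lemma ord_add: "(\<mu>, \<nu>) \<in> ord \<Longrightarrow> \<rho> \<in> monoms m n \<Longrightarrow> (\<mu> + \<rho>, \<nu> + \<rho>) \<in> ord"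
  using mo by (auto simp: monomial_order_def)

lemma ord_add_mono: "(\<mu>, \<nu>) \<in> ord \<Longrightarrow> (\<mu>', \<nu>') \<in> ord \<Longrightarrow> (\<mu> + \<mu>', \<nu> + \<nu>') \<in> ord"
  using ord_trans[OF ord_add[of \<mu> \<nu> \<mu>'] ord_add[of \<mu>' \<nu>' \<nu>, unfolded add.commute[of _ \<nu>]]]
    ord_monoms[of \<mu> \<nu>] ord_monoms[of \<mu>' \<nu>'] by blast

lemma ord_add_eqD:
  assumes "(\<mu>, \<nu>) \<in> ord" "(\<mu>', \<nu>') \<in> ord" "\<mu> + \<mu>' = \<nu> + \<nu>'"
  shows "\<mu> = \<nu>" "\<mu>' = \<nu>'"
proof -
  have "(\<nu> + \<mu>', \<nu> + \<nu>') \<in> ord"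
    using ord_add[OF assms(2), of \<nu>] ord_monoms[OF assms(1)] by (simp add: add.commute)
  moreover have "(\<nu> + \<nu>', \<nu> + \<mu>') \<in> ord"
    using ord_add[OF assms(1), of \<mu>'] ord_monoms[OF assms(2)] assms(3) by simp
  ultimately have "\<nu> + \<mu>' = \<nu> + \<nu>'" by (rule ord_antisym)
  then show "\<mu>' = \<nu>'" by simp
  then show "\<mu> = \<nu>" using assms(3) by simp
qed

text \<open>
  By compatibility of the order with multiplication, a sum of two monomials bounded by \<open>\<tau>\<close> and by
  \<open>\<sigma>\<close> equals \<open>\<tau> + \<sigma>\<close> only if both bounds are attained; so one product of terms contributes.
\<close>

lemma leads_mult:
  fixes f g :: "xmonom \<Rightarrow>\<^sub>0 'a::comm_ring_1"
  assumes f: "leads ord \<tau> c f" and g: "leads ord \<sigma> d g"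
  shows "leads ord (\<tau> + \<sigma>) (c * d) (f * g)"
  unfolding leads_def
proof
  show "\<forall>\<kappa>\<in>keys (f * g). (\<kappa>, \<tau> + \<sigma>) \<in> ord"
  proof
    fix \<kappa> assume "\<kappa> \<in> keys (f * g)"
    then obtain a b where "\<kappa> = a + b" "a \<in> keys f" "b \<in> keys g"
      using Poly_Mapping.keys_mult[of f g] by blast
    moreover from this have "(a, \<tau>) \<in> ord" "(b, \<sigma>) \<in> ord" using f g by (auto simp: leads_def)
    ultimately show "(\<kappa>, \<tau> + \<sigma>) \<in> ord" using ord_add_mono[of a \<tau> b \<sigma>] by simp
  qed
  have "f * g = (\<Sum>\<mu>\<in>keys f. single \<mu> (lookup f \<mu>)) * (\<Sum>\<nu>\<in>keys g. single \<nu> (lookup g \<nu>))"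
    by (simp add: sum_single_lookup)
  also have "\<dots> = (\<Sum>\<mu>\<in>keys f. \<Sum>\<nu>\<in>keys g. single (\<mu> + \<nu>) (lookup f \<mu> * lookup g \<nu>))"
    by (simp add: sum_product mult_single)
  finally have "lookup (f * g) (\<tau> + \<sigma>)
      = (\<Sum>\<mu>\<in>keys f. \<Sum>\<nu>\<in>keys g. lookup (single (\<mu> + \<nu>) (lookup f \<mu> * lookup g \<nu>)) (\<tau> + \<sigma>))"
    by (simp add: lookup_sum)
  also have "\<dots> = (\<Sum>\<mu>\<in>keys f. \<Sum>\<nu>\<in>keys g. if \<mu> = \<tau> then if \<nu> = \<sigma> then c * d else 0 else 0)"
  proof (intro sum.cong refl)
    fix \<mu> \<nu> assume "\<mu> \<in> keys f" "\<nu> \<in> keys g"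
    then have "(\<mu>, \<tau>) \<in> ord" "(\<nu>, \<sigma>) \<in> ord" using f g by (auto simp: leads_def)
    then have "\<mu> + \<nu> = \<tau> + \<sigma> \<longleftrightarrow> \<mu> = \<tau> \<and> \<nu> = \<sigma>" using ord_add_eqD by blast
    then show "lookup (single (\<mu> + \<nu>) (lookup f \<mu> * lookup g \<nu>)) (\<tau> + \<sigma>)
        = (if \<mu> = \<tau> then if \<nu> = \<sigma> then c * d else 0 else 0)"
      using f g by (auto simp: lookup_single when_def leads_def)
  qed
  also have "\<dots> = (\<Sum>\<mu>\<in>keys f. if \<mu> = \<tau> then if \<sigma> \<in> keys g then c * d else 0 else 0)"
    by (rule sum.cong) auto
  also have "\<dots> = (if \<tau> \<in> keys f then if \<sigma> \<in> keys g then c * d else 0 else 0)"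
    by simp
  also have "\<dots> = c * d"
    using f g by (auto simp: leads_def in_keys_iff)
  finally show "lookup (f * g) (\<tau> + \<sigma>) = c * d" .
qed

lemma leads_single: "\<tau> \<in> monoms m n \<Longrightarrow> leads ord \<tau> c (single \<tau> c)"
  by (simp add: leads_def ord_refl)

lemma leads_1: "leads ord 0 1 (1 :: xmonom \<Rightarrow>\<^sub>0 'a::comm_ring_1)"
  using leads_single[of 0 "1::'a"] by (simp add: monoms_def)

lemma leads_diff:
  fixes f g :: "xmonom \<Rightarrow>\<^sub>0 'a::comm_ring_1"
  shows "leads ord \<tau> c f \<Longrightarrow> leads ord \<tau> d g \<Longrightarrow> leads ord \<tau> (c - d) (f - g)"
  using Poly_Mapping.keys_diff[of f g] by (auto simp: leads_def lookup_minus)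

lemma leads_prod:
  fixes f :: "'i \<Rightarrow> (xmonom \<Rightarrow>\<^sub>0 'a::comm_ring_1)"
  shows "(\<And>i. i \<in> A \<Longrightarrow> leads ord (\<tau> i) (c i) (f i)) \<Longrightarrow>
    leads ord (\<Sum>i\<in>A. \<tau> i) (\<Prod>i\<in>A. c i) (\<Prod>i\<in>A. f i)"
  by (induction A rule: infinite_finite_induct) (auto simp: leads_1 leads_mult)

lemma leads_init_monom:
  assumes "leads ord \<tau> c f" "c \<noteq> 0"
  shows "init_monom ord f = \<tau>"
  unfolding init_monom_def
proof (rule the_equality)
  show "\<tau> \<in> keys f \<and> (\<forall>\<nu>\<in>keys f. (\<nu>, \<tau>) \<in> ord)" using assms by (auto simp: leads_def in_keys_iff)
  then show "\<mu> = \<tau>" if "\<mu> \<in> keys f \<and> (\<forall>\<nu>\<in>keys f. (\<nu>, \<mu>) \<in> ord)" for \<mu>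
    using that ord_antisym by blast
qed

lemma finite_ord_max:
  assumes "finite A" "A \<noteq> {}" "A \<subseteq> monoms m n"
  shows "\<exists>\<tau>\<in>A. \<forall>\<kappa>\<in>A. (\<kappa>, \<tau>) \<in> ord"
  using assms
proof (induction A rule: finite_ne_induct)
  case (singleton x)
  then show ?case by (simp add: ord_refl)
next
  case (insert x A)
  then obtain \<tau> where \<tau>: "\<tau> \<in> A" "\<forall>\<kappa>\<in>A. (\<kappa>, \<tau>) \<in> ord" by auto
  then have "(x, \<tau>) \<in> ord \<or> (\<tau>, x) \<in> ord" using insert.prems ord_total by auto
  then show ?case
  proof
    assume "(x, \<tau>) \<in> ord"
    then show ?thesis using \<tau> by auto
  next
    assume "(\<tau>, x) \<in> ord"
    moreover have "(x, x) \<in> ord" using insert.prems ord_refl by simp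
    ultimately show ?thesis using \<tau> ord_trans by blast
  qed
qed

lemma init_monom_leads:
  assumes "f \<noteq> 0" "keys f \<subseteq> monoms m n"
  shows "leads ord (init_monom ord f) (lookup f (init_monom ord f)) f"
    and "init_monom ord f \<in> keys f"
proof -
  obtain \<tau> where \<tau>: "\<tau> \<in> keys f" "\<forall>\<kappa>\<in>keys f. (\<kappa>, \<tau>) \<in> ord"
    using finite_ord_max[of "keys f"] assms by auto
  then have l: "leads ord \<tau> (lookup f \<tau>) f" by (simp add: leads_def)
  then have "init_monom ord f = \<tau>" using \<tau>(1) by (intro leads_init_monom) (auto simp: in_keys_iff)
  then show "leads ord (init_monom ord f) (lookup f (init_monom ord f)) f" "init_monom ord f \<in> keys f"
    using l \<tau>(1) by auto
qed

end

lemma xmonom_split: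
  fixes \<nu> :: xmonom
  assumes "x \<in> keys \<nu>"
  shows "\<nu> = single x 1 + (\<nu> - single x 1)"
  by (rule poly_mapping_eqI) (use assms in \<open>auto simp: lookup_add lookup_minus lookup_single when_def in_keys_iff\<close>)

lemma leads_monom_value:
  fixes \<theta> :: "nat \<times> nat \<Rightarrow> (xmonom \<Rightarrow>\<^sub>0 'a::comm_ring_1)"
  assumes mo: "monomial_order m n ord"
    and lead: "\<And>x. x \<in> {1..m} \<times> {1..n} \<Longrightarrow> leads ord (\<sigma> + single x 1) (c x) (\<theta> x)"
    and hom: "\<And>x. x \<in> {1..m} \<times> {1..n} \<Longrightarrow> homogeneous (Suc (mdeg \<sigma>)) (\<theta> x)"
    and \<nu>: "\<nu> \<in> monoms m n"
  shows "leads ord ((\<Sum>i<mdeg \<nu>. \<sigma>) + \<nu>) (monom_value c \<nu>) (monom_value \<theta> \<nu>)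
    \<and> homogeneous (mdeg \<nu> * Suc (mdeg \<sigma>)) (monom_value \<theta> \<nu>)"
  using \<nu>
proof (induction "mdeg \<nu>" arbitrary: \<nu>)
  case 0
  then have "\<forall>x\<in>keys \<nu>. lookup \<nu> x = 0" by (simp add: mdeg_def)
  then have "\<nu> = 0" by (intro poly_mapping_eqI) (metis in_keys_iff lookup_zero)
  then show ?case using leads_1[OF mo] homogeneous_1 by simp
next
  case (Suc k)
  then have "keys \<nu> \<noteq> {}" by (auto simp: mdeg_def)
  then obtain x where x: "x \<in> keys \<nu>" by blast
  define \<nu>' where "\<nu>' = \<nu> - single x 1"
  have \<nu>: "\<nu> = single x 1 + \<nu>'" unfolding \<nu>'_def by (rule xmonom_split[OF x])
  have k: "k = mdeg \<nu>'" using Suc.hyps(2) by (simp add: \<nu> mdeg_add)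
  have x': "x \<in> {1..m} \<times> {1..n}" using x Suc.prems by (auto simp: monoms_def)
  have "\<nu>' \<in> monoms m n" using Suc.prems by (auto simp: monoms_def \<nu> in_keys_iff lookup_add subset_iff)
  from Suc.hyps(1)[OF k this]
  have IH: "leads ord ((\<Sum>i<k. \<sigma>) + \<nu>') (monom_value c \<nu>') (monom_value \<theta> \<nu>')"
    "homogeneous (k * Suc (mdeg \<sigma>)) (monom_value \<theta> \<nu>')" by (simp_all add: k)
  have mv: "monom_value c \<nu> = c x * monom_value c \<nu>'" "monom_value \<theta> \<nu> = \<theta> x * monom_value \<theta> \<nu>'"
    unfolding \<nu> monom_value_add monom_value_single by simp_all
  have mk: "mdeg \<nu> = Suc k" using Suc.hyps(2) by simp
  have deg: "mdeg \<nu> * Suc (mdeg \<sigma>) = Suc (mdeg \<sigma>) + k * Suc (mdeg \<sigma>)" by (simp add: mk)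
  have top: "(\<Sum>i<mdeg \<nu>. \<sigma>) + \<nu> = (\<sigma> + single x 1) + ((\<Sum>i<k. \<sigma>) + \<nu>')"
    unfolding mk by (subst \<nu>) (simp add: add_ac)
  show ?case
    unfolding mv top deg
    using leads_mult[OF mo lead[OF x'] IH(1)] homogeneous_mult[OF hom[OF x'] IH(2)] by blast
qed

text \<open>
  If every variable \<open>x\<close> is replaced by a polynomial with leading monomial \<open>\<sigma> + x\<close>, then smaller
  monomials of the same degree stay smaller.  Those of other degrees cannot interfere because the
  substituted polynomials are homogeneous of one and the same degree.
\<close>

lemma lookup_subst_lead:
  fixes \<theta> :: "nat \<times> nat \<Rightarrow> 'k::field poly xpoly"
  assumes mo: "monomial_order m n ord"
    and lead: "\<And>x. x \<in> {1..m} \<times> {1..n} \<Longrightarrow> leads ord (\<sigma> + single x 1) (c x) (\<theta> x)"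
    and hom: "\<And>x. x \<in> {1..m} \<times> {1..n} \<Longrightarrow> homogeneous (Suc (mdeg \<sigma>)) (\<theta> x)"
    and \<sigma>: "\<sigma> \<in> monoms m n" and f: "leads ord \<mu> d f" "\<mu> \<in> monoms m n"
  shows "lookup (eps_subst \<theta> f) ((\<Sum>i<mdeg \<mu>. \<sigma>) + \<mu>) = [:d:] * monom_value c \<mu>"
proof -
  define \<tau> where "\<tau> \<nu> = (\<Sum>i<mdeg \<nu>. \<sigma>) + \<nu>" for \<nu>
  have lv: "leads ord (\<tau> \<nu>) (monom_value c \<nu>) (monom_value \<theta> \<nu>)"
    and hv: "homogeneous (mdeg \<nu> * Suc (mdeg \<sigma>)) (monom_value \<theta> \<nu>)" if "\<nu> \<in> monoms m n" for \<nu>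
    using leads_monom_value[OF mo lead hom that] by (auto simp: \<tau>_def)
  have deg: "mdeg (\<tau> \<mu>) = mdeg \<mu> * Suc (mdeg \<sigma>)" by (simp add: \<tau>_def mdeg_add mdeg_sum)
  have zero: "lookup (monom_value \<theta> \<nu>) (\<tau> \<mu>) = 0" if \<nu>: "\<nu> \<in> keys f" "\<nu> \<noteq> \<mu>" for \<nu>
  proof (rule ccontr)
    assume "lookup (monom_value \<theta> \<nu>) (\<tau> \<mu>) \<noteq> 0"
    then have key: "\<tau> \<mu> \<in> keys (monom_value \<theta> \<nu>)" by (simp add: in_keys_iff)
    have le: "(\<nu>, \<mu>) \<in> ord" using f(1) \<nu>(1) by (simp add: leads_def)
    then have \<nu>m: "\<nu> \<in> monoms m n" using ord_monoms[OF mo] by blast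
    have "mdeg \<mu> * Suc (mdeg \<sigma>) = mdeg \<nu> * Suc (mdeg \<sigma>)"
      using hv[OF \<nu>m] key unfolding homogeneous_def deg[symmetric] by blast
    then have "mdeg \<mu> = mdeg \<nu>" by (simp del: mult_Suc_right)
    then have \<tau>eq: "\<tau> \<nu> = (\<Sum>i<mdeg \<mu>. \<sigma>) + \<nu>" by (simp add: \<tau>_def)
    have "(\<Sum>i<mdeg \<mu>. \<sigma>) \<in> monoms m n" using \<sigma> by (intro monoms_sum)
    then have "(\<tau> \<nu>, \<tau> \<mu>) \<in> ord"
      unfolding \<tau>eq \<tau>_def[of \<mu>] add.commute[of "\<Sum>i<mdeg \<mu>. \<sigma>"] by (rule ord_add[OF mo le])
    moreover have "(\<tau> \<mu>, \<tau> \<nu>) \<in> ord" using lv[OF \<nu>m] key by (simp add: leads_def)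
    ultimately have "\<tau> \<nu> = \<tau> \<mu>" by (rule ord_antisym[OF mo])
    then show False using \<nu>(2) unfolding \<tau>eq \<tau>_def[of \<mu>] by simp
  qed
  have "lookup (eps_subst \<theta> f) (\<tau> \<mu>) = (\<Sum>\<nu>\<in>keys f. [:lookup f \<nu>:] * lookup (monom_value \<theta> \<nu>) (\<tau> \<mu>))"
    unfolding eps_subst_def subst_def lookup_sum lookup_const_mult ..
  also have "\<dots> = (\<Sum>\<nu>\<in>keys f. if \<nu> = \<mu> then [:d:] * lookup (monom_value \<theta> \<mu>) (\<tau> \<mu>) else 0)"
    using f(1) zero by (intro sum.cong) (auto simp: leads_def)
  also have "\<dots> = [:d:] * lookup (monom_value \<theta> \<mu>) (\<tau> \<mu>)"
    using f(1) by (auto simp: leads_def in_keys_iff)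
  also have "lookup (monom_value \<theta> \<mu>) (\<tau> \<mu>) = monom_value c \<mu>"
    using lv[OF f(2)] by (simp add: leads_def)
  finally show ?thesis by (simp add: \<tau>_def)
qed

section \<open>Minors and their main diagonals\<close>

definition diag_monom :: "nat \<Rightarrow> (nat \<Rightarrow> nat) \<Rightarrow> (nat \<Rightarrow> nat) \<Rightarrow> xmonom" where
  "diag_monom t r c = (\<Sum>i<t. single (r i, c i) 1)"

lemma lookup_diag_monom:
  assumes "inj_on r {..<t}" "l < t"
  shows "lookup (diag_monom t r c) (r l, j) = (if c l = j then 1 else 0)"
proof -
  have "lookup (diag_monom t r c) (r l, j) = (\<Sum>i<t. if i = l then (if c l = j then 1 else 0) else 0)"
    unfolding diag_monom_def lookup_sum
    using assms by (intro sum.cong) (auto simp: lookup_single when_def inj_on_def)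
  then show ?thesis using assms by simp
qed

lemma lookup_diag_monom_other:
  assumes "i \<notin> r ` {..<t}"
  shows "lookup (diag_monom t r c) (i, j) = 0"
  unfolding diag_monom_def lookup_sum
  using assms by (auto simp: lookup_single when_def)

lemma lookup_diag_monom_Suc:
  "lookup (diag_monom t Suc c) (i, j) = (if 1 \<le> i \<and> i \<le> t \<and> c (i - 1) = j then 1 else 0)"
proof (cases "1 \<le> i \<and> i \<le> t")
  case True
  then show ?thesis using lookup_diag_monom[of Suc t "i - 1" c j] by (cases i) auto
next
  case False
  then have "i \<notin> Suc ` {..<t}" by auto
  then show ?thesis using lookup_diag_monom_other[of i Suc t c j] False by auto
qed

lemma mdeg_diag_monom: "mdeg (diag_monom t r c) = t"
  by (simp add: diag_monom_def mdeg_sum)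

lemma diag_monom_in_monoms:
  assumes "r ` {..<t} \<subseteq> {1..m}" "c ` {..<t} \<subseteq> {1..n}"
  shows "diag_monom t r c \<in> monoms m n"
proof -
  have "keys (diag_monom t r c) \<subseteq> (\<Union>i<t. keys (single (r i, c i) (1::nat)))"
    unfolding diag_monom_def by (rule Poly_Mapping.keys_sum)
  then show ?thesis using assms unfolding monoms_def by fastforce
qed

lemma prod_single: "(\<Prod>i\<in>A. single (f i) (1::'a::comm_ring_1)) = single (\<Sum>i\<in>A. f i :: xmonom) 1"
  by (induction A rule: infinite_finite_induct) (auto simp: mult_single)

text \<open>
  The Leibniz formula: distinct permutations give distinct monomials when rows and columns are
  distinct, which makes the coefficients visible.
\<close>

lemma minor_expansion:
  "(minor t r c :: 'k::field xpoly)
    = (\<Sum>p | p permutes {0..<t}. single (diag_monom t r (c \<circ> p)) (of_int (sign p)))"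
proof -
  have "(minor t r c :: 'k xpoly) = (\<Sum>p | p permutes {0..<t}.
      signof p * (\<Prod>i = 0..<t. Matrix.mat t t (\<lambda>(i, j). xvar (r i) (c j)) $$ (i, p i)))"
    unfolding minor_def by (rule det_def') simp
  also have "\<dots> = (\<Sum>p | p permutes {0..<t}. single (diag_monom t r (c \<circ> p)) (of_int (sign p)))"
  proof (rule sum.cong[OF refl])
    fix p assume "p \<in> {p. p permutes {0..<t}}"
    then have p: "p permutes {0..<t}" by simp
    have "(\<Prod>i = 0..<t. Matrix.mat t t (\<lambda>(i, j). xvar (r i) (c j)) $$ (i, p i))
        = (\<Prod>i = 0..<t. single (single (r i, c (p i)) 1) (1::'k))"
      using permutes_in_image[OF p] by (intro prod.cong) (auto simp: xvar_def)
    also have "\<dots> = single (diag_monom t r (c \<circ> p)) 1"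
      unfolding prod_single by (simp add: diag_monom_def atLeast0LessThan)
    finally have prod: "(\<Prod>i = 0..<t. Matrix.mat t t (\<lambda>(i, j). xvar (r i) (c j)) $$ (i, p i))
        = single (diag_monom t r (c \<circ> p)) (1::'k)" .
    have sgn: "(signof p :: 'k xpoly) = single 0 (of_int (sign p))" by simp
    show "signof p * (\<Prod>i = 0..<t. Matrix.mat t t (\<lambda>(i, j). xvar (r i) (c j)) $$ (i, p i))
        = single (diag_monom t r (c \<circ> p)) (of_int (sign p) :: 'k)"
      unfolding prod sgn mult_single by simp
  qed
  finally show ?thesis .
qed

lemma keys_minor:
  assumes "\<kappa> \<in> keys (minor t r c :: 'k::field xpoly)"
  obtains p where "p permutes {0..<t}" "\<kappa> = diag_monom t r (c \<circ> p)"
proof -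
  have "keys (minor t r c :: 'k xpoly)
      \<subseteq> (\<Union>p\<in>{p. p permutes {0..<t}}. keys (single (diag_monom t r (c \<circ> p)) (of_int (sign p) :: 'k)))"
    unfolding minor_expansion by (rule Poly_Mapping.keys_sum)
  then show thesis using assms that by (auto split: if_splits)
qed

lemma homogeneous_minor: "homogeneous t (minor t r c :: 'k::field xpoly)"
  unfolding homogeneous_def by (metis keys_minor mdeg_diag_monom)

lemma minor_in_poly_ring:
  assumes "r ` {..<t} \<subseteq> {1..m}" "c ` {..<t} \<subseteq> {1..n}"
  shows "minor t r c \<in> carrier (poly_ring m n)"
  unfolding carrier_poly_ring_iff
proof
  fix \<kappa> assume "\<kappa> \<in> keys (minor t r c)"
  then obtain p where p: "p permutes {0..<t}" "\<kappa> = diag_monom t r (c \<circ> p)" by (rule keys_minor)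
  have "(c \<circ> p) ` {..<t} = c ` {..<t}"
    using permutes_image[OF p(1)] unfolding atLeast0LessThan image_comp[symmetric] by simp
  then show "\<kappa> \<in> monoms m n" unfolding p(2) using assms by (intro diag_monom_in_monoms) auto
qed

lemma lookup_minor_diag:
  assumes "inj_on r {..<t}" "inj_on c {..<t}"
  shows "lookup (minor t r c :: 'k::field xpoly) (diag_monom t r c) = 1"
proof -
  have id: "p = id" if p: "p permutes {0..<t}" and eq: "diag_monom t r (c \<circ> p) = diag_monom t r c" for p
  proof
    fix l
    show "p l = id l"
    proof (cases "l < t")
      case True
      have "lookup (diag_monom t r (c \<circ> p)) (r l, c l) = 1"
        unfolding eq using lookup_diag_monom[OF assms(1) True] by simp
      then have "(if (c \<circ> p) l = c l then 1 else 0) = (1::nat)"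
        unfolding lookup_diag_monom[OF assms(1) True] .
      then have "c (p l) = c l" unfolding comp_def by (rule contrapos_pp) simp
      moreover have "p l < t" using permutes_in_image[OF p, of l] True by simp
      ultimately show ?thesis using assms(2) True by (auto simp: inj_on_def)
    next
      case False
      then show ?thesis using permutes_not_in[OF p, of l] by simp
    qed
  qed
  have "lookup (minor t r c :: 'k xpoly) (diag_monom t r c)
      = (\<Sum>p | p permutes {0..<t}. if p = id then 1 else 0)"
    unfolding minor_expansion lookup_sum
  proof (rule sum.cong[OF refl])
    fix p assume "p \<in> {p. p permutes {0..<t}}"
    then show "lookup (single (diag_monom t r (c \<circ> p)) (of_int (sign p) :: 'k)) (diag_monom t r c)
        = (if p = id then 1 else 0)"
      using id[of p] by (auto simp: lookup_single when_def sign_id)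
  qed
  also have "\<dots> = 1"
    by (simp add: permutes_id finite_permutations sum.delta)
  finally show ?thesis .
qed

text \<open>
  The definition of a diagonal order fixes the initial monomial; the Leibniz formula shows that its
  coefficient is 1, hence in particular that the minor does not vanish.
\<close>

lemma leads_minor:
  assumes ord: "diagonal_order TYPE('k::field) m n ord"
    and r: "selects t {1..m} r" and c: "selects t {1..n} c"
  shows "leads ord (diag_monom t r c) 1 (minor t r c :: 'k xpoly)"
proof (cases "t = 0")
  case True
  have mo: "monomial_order m n ord" using ord by (simp add: diagonal_order_def)
  have "(minor t r c :: 'k xpoly) = 1" using True by (simp add: minor_def)
  moreover have "diag_monom t r c = 0" using True by (simp add: diag_monom_def)
  ultimately show ?thesis using leads_1[OF mo] by metis
next
  case False
  have mo: "monomial_order m n ord" using ord by (simp add: diagonal_order_def)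
  have inj: "inj_on r {..<t}" "inj_on c {..<t}"
    using r c strict_mono_on_imp_inj_on by (auto simp: selects_def)
  have one: "lookup (minor t r c :: 'k xpoly) (diag_monom t r c) = 1"
    by (rule lookup_minor_diag[OF inj])
  then have "(minor t r c :: 'k xpoly) \<noteq> 0" by auto
  moreover have "keys (minor t r c :: 'k xpoly) \<subseteq> monoms m n"
    using minor_in_poly_ring[of r t m c n] r c by (auto simp: selects_def carrier_poly_ring_iff)
  ultimately have "leads ord (init_monom ord (minor t r c :: 'k xpoly))
      (lookup (minor t r c :: 'k xpoly) (init_monom ord (minor t r c :: 'k xpoly))) (minor t r c :: 'k xpoly)"
    by (rule init_monom_leads[OF mo])
  moreover have "init_monom ord (minor t r c :: 'k xpoly) = diag_monom t r c"
    using ord r c False by (simp add: diagonal_order_def diag_monom_def)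
  ultimately show ?thesis using one by simp
qed

lemma selects_Suc: "t \<le> m \<Longrightarrow> selects t {1..m} Suc"
  by (auto simp: selects_def strict_mono_on_def)

lemma selects_mono: "selects t A c \<Longrightarrow> A \<subseteq> B \<Longrightarrow> selects t B c"
  by (auto simp: selects_def)

lemma selects_initial_segment:
  assumes "selects t {1..t} r" "i < t"
  shows "r i = Suc i"
proof -
  have gap: "r i + (j - i) \<le> r j" if "i \<le> j" "j < t" for i j
    using that
  proof (induction j)
    case (Suc j)
    show ?case
    proof (cases "i = Suc j")
      case False
      have "r j < r (Suc j)" using assms(1) Suc.prems by (auto simp: selects_def strict_mono_on_def)
      then show ?thesis using Suc False by simp
    qed simp
  qed simp
  have "1 \<le> r 0" "r (t - 1) \<le> t" using assms by (auto simp: selects_def image_subset_iff)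
  moreover have "r 0 + i \<le> r i" using gap[of 0 i] assms(2) by simp
  moreover have "r i + (t - 1 - i) \<le> r (t - 1)" using gap[of i "t - 1"] assms(2) by simp
  ultimately show ?thesis using assms(2) by linarith
qed

text \<open>
  The rows \<open>{1..t} - {i}\<close> in increasing order, counted from 0.
\<close>

definition skip_row :: "nat \<Rightarrow> nat \<Rightarrow> nat" where
  "skip_row i l = (if Suc l < i then Suc l else Suc (Suc l))"

text \<open>
  The columns \<open>s 0, s 1, ...\<close> with \<open>j\<close> inserted as the \<open>q\<close>-th one, where \<open>q\<close> counts from 1.
\<close>

definition insert_column :: "nat \<Rightarrow> nat \<Rightarrow> (nat \<Rightarrow> nat) \<Rightarrow> nat \<Rightarrow> nat" where
  "insert_column q j s l = (if Suc l < q then s l else if Suc l = q then j else s (l - 1))"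

text \<open>
  Laplace expansion along the inserted column.  Up to the sign \<open>(-1) ^ q\<close>, the coefficients are
  independent of the column: they are the coefficients of the row relation of the skipped columns.
\<close>

lemma minor_insert_column:
  assumes q: "q \<in> {1..t}"
  shows "(minor t Suc (insert_column q j s) :: 'k::field xpoly)
    = (\<Sum>i\<in>{1..t}. (-1) ^ (i + q) * xvar i j * minor (t - 1) (skip_row i) s)"
proof -
  let ?M = "Matrix.mat t t (\<lambda>(i, l). xvar (Suc i) (insert_column q j s l)) :: 'k xpoly mat"
  have M: "?M \<in> carrier_mat t t" by simp
  have del: "mat_delete ?M i (q - 1) = Matrix.mat (t - 1) (t - 1) (\<lambda>(k, l). xvar (skip_row (Suc i) k) (s l))"
    if "i < t" for i
    by (rule eq_matI) (use that q in \<open>auto simp: mat_delete_def skip_row_def insert_column_def\<close>)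
  have "det ?M = (\<Sum>i<t. ?M $$ (i, q - 1) * cofactor ?M i (q - 1))"
    by (rule laplace_expansion_column[OF M]) (use q in auto)
  also have "\<dots> = (\<Sum>i<t. (-1) ^ (Suc i + q) * xvar (Suc i) j * minor (t - 1) (skip_row (Suc i)) s)"
  proof (rule sum.cong[OF refl])
    fix i assume "i \<in> {..<t}"
    then have i: "i < t" by simp
    have "?M $$ (i, q - 1) = xvar (Suc i) j" using i q by (cases q) (auto simp: insert_column_def)
    moreover have "cofactor ?M i (q - 1) = (-1) ^ (Suc i + q) * minor (t - 1) (skip_row (Suc i)) s"
      using q unfolding cofactor_def del[OF i] minor_def by (cases q) simp_all
    ultimately show "?M $$ (i, q - 1) * cofactor ?M i (q - 1)
        = (-1) ^ (Suc i + q) * xvar (Suc i) j * minor (t - 1) (skip_row (Suc i)) s"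
      by (simp only: mult_ac)
  qed
  also have "\<dots> = (\<Sum>i\<in>{1..t}. (-1) ^ (i + q) * xvar i j * minor (t - 1) (skip_row i) s)"
    by (rule sum.reindex_bij_witness[of _ "\<lambda>i. i - 1" Suc]) auto
  finally show ?thesis by (simp add: minor_def)
qed

lemma minor_insert_repeated_column:
  assumes "l < t - 1"
  shows "(minor t Suc (insert_column 1 (s l) s) :: 'k::field xpoly) = 0"
  unfolding minor_def
proof (rule det_identical_columns[where i = 0 and j = "Suc l"])
  show "col (Matrix.mat t t (\<lambda>(i, k). xvar (Suc i) (insert_column 1 (s l) s k))) 0 =
    (col (Matrix.mat t t (\<lambda>(i, k). xvar (Suc i) (insert_column 1 (s l) s k))) (Suc l) :: 'k xpoly Matrix.vec)"
    using assms by (intro eq_vecI) (auto simp: insert_column_def)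
qed (use assms in auto)

lemma diag_monom_insert_column:
  assumes q: "q \<in> {1..t}"
  shows "diag_monom t Suc (insert_column q j s) = single (q, j) 1 + diag_monom (t - 1) (skip_row q) s"
proof -
  let ?e = "\<lambda>l. single (Suc l, insert_column q j s l) (1::nat)"
  have "diag_monom t Suc (insert_column q j s) = ?e (q - 1) + (\<Sum>l\<in>{..<t} - {q - 1}. ?e l)"
    unfolding diag_monom_def using q by (intro sum.remove) auto
  also have "?e (q - 1) = single (q, j) 1" using q by (simp add: insert_column_def)
  also have "(\<Sum>l\<in>{..<t} - {q - 1}. ?e l) = diag_monom (t - 1) (skip_row q) s"
    unfolding diag_monom_def
    by (rule sum.reindex_bij_witness[of _ "\<lambda>l. if Suc l < q then l else Suc l" "\<lambda>l. if Suc l < q then l else l - 1"])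
      (use q in \<open>auto simp: insert_column_def skip_row_def\<close>)
  finally show ?thesis .
qed

section \<open>Staircases and the packing of chains\<close>

text \<open>
  Cells are addressed by their row \<open>i\<close> and their diagonal \<open>d = j - i\<close>.  The main diagonal of a
  \<open>u\<close>-minor of \<open>X\<^sub>u(b)\<close> is a chain of cells, one in each row, on weakly increasing diagonals between
  \<open>b - 1\<close> and \<open>n - u\<close>.  A staircase takes one cell on each of these diagonals, in weakly increasing
  rows; it is a vertex cut that separates the first row from row \<open>u\<close>, and its cells generate a minimal
  prime of \<open>J\<^sub>u(b)\<close>.
\<close>

definition staircase :: "nat \<Rightarrow> nat \<Rightarrow> nat \<Rightarrow> (nat \<Rightarrow> nat) \<Rightarrow> bool" where
  "staircase n u b \<rho> \<longleftrightarrow> mono_on {b - 1..n - u} \<rho> \<and> \<rho> ` {b - 1..n - u} \<subseteq> {1..u}"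

definition crossing :: "nat \<Rightarrow> nat \<Rightarrow> nat \<Rightarrow> (nat \<Rightarrow> nat) \<Rightarrow> xmonom \<Rightarrow> nat" where
  "crossing n u b \<rho> \<mu> = (\<Sum>d = b - 1..n - u. lookup \<mu> (\<rho> d, \<rho> d + d))"

lemma crossing_add: "crossing n u b \<rho> (\<mu> + \<nu>) = crossing n u b \<rho> \<mu> + crossing n u b \<rho> \<nu>"
  by (simp add: crossing_def lookup_add sum.distrib)

definition cells :: "nat \<Rightarrow> nat \<Rightarrow> nat \<Rightarrow> (nat \<Rightarrow> nat) \<Rightarrow> (nat \<times> nat) set" where
  "cells n u b \<rho> = (\<lambda>d. (\<rho> d, \<rho> d + d)) ` {b - 1..n - u}"

lemma finite_cells [simp]: "finite (cells n u b \<rho>)"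
  by (simp add: cells_def)

lemma staircase_column_strict_mono:
  assumes "staircase n u b \<rho>" "d \<in> {b - 1..n - u}" "e \<in> {b - 1..n - u}" "d < e"
  shows "\<rho> d + d < \<rho> e + e"
proof -
  have "\<rho> d \<le> \<rho> e" using assms by (auto simp: staircase_def mono_on_def)
  then show ?thesis using assms(4) by simp
qed

lemma staircase_column_inj:
  assumes "staircase n u b \<rho>" "d \<in> {b - 1..n - u}" "e \<in> {b - 1..n - u}" "\<rho> d + d = \<rho> e + e"
  shows "d = e"
  using staircase_column_strict_mono[OF assms(1-3)] staircase_column_strict_mono[OF assms(1,3,2)] assms(4)
  by (metis less_irrefl linorder_neqE_nat)

lemma crossing_eq_sum_cells:
  assumes "staircase n u b \<rho>"
  shows "crossing n u b \<rho> \<mu> = (\<Sum>x\<in>cells n u b \<rho>. lookup \<mu> x)"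
proof -
  have "inj_on (\<lambda>d. (\<rho> d, \<rho> d + d)) {b - 1..n - u}"
    using staircase_column_inj[OF assms] by (auto simp: inj_on_def)
  then show ?thesis by (simp add: crossing_def cells_def sum.reindex)
qed

text \<open>
  A staircase for \<open>(t, a)\<close> meets each column at most once and leaves out \<open>t - 1\<close> columns in
  \<open>{a..n}\<close>, one at each step from rows at most \<open>l + 1\<close> to rows beyond.  The column of a cell in row \<open>q\<close>
  is preceded by exactly \<open>q - 1\<close> of them, so that the cell lies on the main diagonal of the minor
  formed by this column and the skipped ones.
\<close>

lemma staircase_skipped_columns:
  assumes ta: "1 \<le> t" "1 \<le> a" "t + a \<le> n + 1" and \<rho>: "staircase n t a \<rho>"
  shows "\<exists>s. selects (t - 1) {a..n} s
    \<and> (\<forall>d\<in>{a - 1..n - t}. \<forall>l. (Suc l < \<rho> d \<longrightarrow> s l < \<rho> d + d) \<and> (\<rho> d \<le> Suc l \<longrightarrow> \<rho> d + d < s l))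
    \<and> (\<forall>j\<in>{a..n}. (\<exists>l<t - 1. j = s l) \<or> (\<exists>d\<in>{a - 1..n - t}. j = \<rho> d + d))"
proof -
  let ?D = "{a - 1..n - t}"
  define Q where "Q i d \<longleftrightarrow> a - 1 \<le> d \<and> (n - t < d \<or> i < \<rho> d)" for i d
  \<comment> \<open>The first diagonal on which the staircase is below row \<open>i\<close>, or the end of the range.\<close>
  define \<sigma> where "\<sigma> i = (LEAST d. Q i d)" for i
  have Qn: "Q i (Suc (n - t))" for i using ta by (auto simp: Q_def)
  have Q\<sigma>: "Q i (\<sigma> i)" for i unfolding \<sigma>_def by (rule LeastI[where P = "Q i", OF Qn])
  have \<sigma>le: "\<sigma> i \<le> d" if "Q i d" for i d unfolding \<sigma>_def using that by (rule Least_le)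
  have \<sigma>n: "\<sigma> i \<le> Suc (n - t)" for i by (rule \<sigma>le[OF Qn])
  have \<sigma>a: "a - 1 \<le> \<sigma> i" for i using Q\<sigma>[of i] by (simp add: Q_def)
  have \<sigma>mono: "\<sigma> i \<le> \<sigma> j" if "i \<le> j" for i j
    using Q\<sigma>[of j] that by (intro \<sigma>le) (auto simp: Q_def)
  have \<sigma>1: "\<sigma> i \<le> d" if "d \<in> ?D" "i < \<rho> d" for i d
    using that by (intro \<sigma>le) (auto simp: Q_def)
  have \<sigma>2: "d < \<sigma> i" if d: "d \<in> ?D" "\<rho> d \<le> i" for i d
  proof (rule ccontr)
    assume "\<not> d < \<sigma> i"
    then have le: "\<sigma> i \<le> d" by simp
    then have "i < \<rho> (\<sigma> i)" using Q\<sigma>[of i] d(1) by (auto simp: Q_def)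
    also have "\<rho> (\<sigma> i) \<le> \<rho> d" using \<rho> d(1) le \<sigma>a[of i] by (auto simp: staircase_def mono_on_def)
    finally show False using d(2) by simp
  qed
  define s where "s l = Suc l + \<sigma> (Suc l)" for l
  have smono: "strict_mono_on {..<t - 1} s"
    using \<sigma>mono by (auto simp: strict_mono_on_def s_def add_less_le_mono)
  have srange: "s ` {..<t - 1} \<subseteq> {a..n}"
  proof clarify
    fix l assume "l < t - 1"
    then show "s l \<in> {a..n}" using \<sigma>a[of "Suc l"] \<sigma>n[of "Suc l"] ta by (auto simp: s_def)
  qed
  have before: "s l < \<rho> d + d" if "d \<in> ?D" "Suc l < \<rho> d" for d l
    using \<sigma>1[OF that] that(2) by (simp add: s_def)
  have after: "\<rho> d + d < s l" if "d \<in> ?D" "\<rho> d \<le> Suc l" for d l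
    using \<sigma>2[OF that] that(2) by (simp add: s_def)
  have covers: "(\<exists>l<t - 1. j = s l) \<or> (\<exists>d\<in>?D. j = \<rho> d + d)" if "j \<in> {a..n}" for j
  proof -
    let ?S = "s ` {..<t - 1}" and ?P = "(\<lambda>d. \<rho> d + d) ` ?D"
    have P: "?P \<subseteq> {a..n}"
    proof clarify
      fix d assume d: "d \<in> ?D"
      then have "1 \<le> \<rho> d" "\<rho> d \<le> t" using \<rho> by (auto simp: staircase_def image_subset_iff)
      then show "\<rho> d + d \<in> {a..n}" using d ta by auto
    qed
    have "s l \<noteq> \<rho> d + d" if "d \<in> ?D" for l d
      using before[OF that, of l] after[OF that, of l] by (cases "Suc l < \<rho> d") auto
    then have "?S \<inter> ?P = {}" by auto
    then have "card (?S \<union> ?P) = card ?S + card ?P" by (intro card_Un_disjoint) auto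
    also have "card ?S = t - 1"
      using card_image[OF strict_mono_on_imp_inj_on[OF smono]] by simp
    also have "card ?P = card ?D"
      using staircase_column_inj[OF \<rho>] by (intro card_image) (auto simp: inj_on_def)
    finally have "card (?S \<union> ?P) = card {a..n}" using ta by simp
    then have "?S \<union> ?P = {a..n}" using srange P by (intro card_subset_eq) auto
    then show ?thesis using that by blast
  qed
  show ?thesis
    by (intro exI[of _ s] conjI ballI allI impI) (use smono srange before after covers in \<open>auto simp: selects_def\<close>)
qed

text \<open>
  The greedy choice: \<open>g i\<close> is the first diagonal, not before \<open>g (i - 1)\<close>, on which row \<open>i\<close> is
  occupied.  If the greedy choice fails, the rows at which it waits form an empty staircase.
\<close>

lemma leftmost_chain:
  fixes w :: "nat \<times> nat \<Rightarrow> nat"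
  assumes ta: "1 \<le> t" "1 \<le> a" "t + a \<le> n + 1"
    and pos: "\<And>\<rho>. staircase n t a \<rho> \<Longrightarrow> 0 < (\<Sum>d = a - 1..n - t. w (\<rho> d, \<rho> d + d))"
  obtains g where "g 0 = a - 1" "mono g" "g t \<le> n - t"
    "\<And>i. i < t \<Longrightarrow> 0 < w (Suc i, Suc i + g (Suc i))"
    "\<And>i d. i < t \<Longrightarrow> g i \<le> d \<Longrightarrow> d < g (Suc i) \<Longrightarrow> w (Suc i, Suc i + d) = 0"
proof -
  \<comment> \<open>The second alternative makes the search always succeed, beyond the last admissible diagonal.\<close>
  define Q where "Q = (\<lambda>x i d. x \<le> d \<and> (0 < w (Suc i, Suc i + d) \<or> n - t < d))"
  define g where "g = rec_nat (a - 1) (\<lambda>i x. LEAST d. Q x i d)"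
  have g0: "g 0 = a - 1" and gS: "g (Suc i) = (LEAST d. Q (g i) i d)" for i
    by (simp_all add: g_def)
  have "Q (g i) i (Suc (n - t) + g i)" for i by (simp add: Q_def)
  then have gQ: "Q (g i) i (g (Suc i))" for i unfolding gS by (rule LeastI)
  have gmin: "\<not> Q (g i) i d" if "d < g (Suc i)" for i d
    using that unfolding gS by (rule not_less_Least)
  have gmono: "mono g"
    by (rule incseq_SucI) (use gQ in \<open>auto simp: Q_def\<close>)
  have zero: "w (Suc i, Suc i + d) = 0" if "g i \<le> d" "d < g (Suc i)" for i d
    using gmin[OF that(2)] that(1) by (auto simp: Q_def)
  have gt: "g t \<le> n - t"
  proof (rule ccontr)
    assume contr: "\<not> g t \<le> n - t"
    \<comment> \<open>The row at which the greedy choice waits while it passes diagonal \<open>d\<close>.\<close>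
    define G where "G d = (LEAST i. d < g i)" for d
    have G: "d < g (G d)" "G d \<le> t" if "d \<le> n - t" for d
    proof -
      have "d < g t" using that contr by simp
      then show "d < g (G d)" "G d \<le> t" unfolding G_def by (auto intro: LeastI Least_le)
    qed
    have G1: "1 \<le> G d" "g (G d - 1) \<le> d" if "d \<in> {a - 1..n - t}" for d
    proof -
      show *: "1 \<le> G d" using G(1)[of d] g0 that by (cases "G d") auto
      show "g (G d - 1) \<le> d" using not_less_Least[of "G d - 1" "\<lambda>i. d < g i"] *
        unfolding G_def by (metis diff_less less_le_trans less_numeral_extra(1) not_less)
    qed
    have "mono_on {a - 1..n - t} G"
    proof (rule mono_onI)
      fix d e assume "d \<in> {a - 1..n - t}" "e \<in> {a - 1..n - t}" "d \<le> e"
      then have "d < g (G e)" using G(1)[of e] by simp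
      then show "G d \<le> G e" unfolding G_def[of d] by (rule Least_le)
    qed
    then have "staircase n t a G" using G1 G by (auto simp: staircase_def)
    then have "0 < (\<Sum>d = a - 1..n - t. w (G d, G d + d))" by (rule pos)
    moreover have "w (G d, G d + d) = 0" if "d \<in> {a - 1..n - t}" for d
      using zero[of "G d - 1" d] G1[OF that] G(1)[of d] that by auto
    ultimately show False by simp
  qed
  have "0 < w (Suc i, Suc i + g (Suc i))" if "i < t" for i
  proof -
    have "g (Suc i) \<le> n - t" using monoD[OF gmono, of "Suc i" t] that gt by simp
    then show ?thesis using gQ[of i] by (auto simp: Q_def)
  qed
  then show thesis using that[of g] g0 gmono gt zero by blast
qed

text \<open>
  Removing the leftmost chain can lower the sum along \<open>\<rho>\<close> by more than one, if the chain meets \<open>\<rho>\<close>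
  several times.  But then \<open>\<rho>\<close> can be improved: before the last meeting point, wherever it runs above
  the row at which the chain waits, move it down to this row.  The cells entered in this way are empty by the greedy choice, so that only
  the last meeting point is charged.  The modified staircase may be extended to the left as far as
  column \<open>a\<close> at no cost, which is what pays for chains with \<open>a < b\<close>.
\<close>

lemma staircase_sum_after_removal:
  fixes w w' :: "nat \<times> nat \<Rightarrow> nat"
  assumes g: "g 0 = a - 1" "mono g"
    and zero: "\<And>i d. i < t \<Longrightarrow> g i \<le> d \<Longrightarrow> d < g (Suc i) \<Longrightarrow> w (Suc i, Suc i + d) = 0"
    and w': "\<And>i c. w' (i, c) = w (i, c) - (if 1 \<le> i \<and> i \<le> t \<and> c = i + g i then 1 else 0)"
    and u: "u \<le> t" and ab: "1 \<le> a" "1 \<le> b" and \<rho>: "staircase n u b \<rho>"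
  shows "(\<Sum>d = b - 1..n - u. w (\<rho> d, \<rho> d + d)) = (\<Sum>d = b - 1..n - u. w' (\<rho> d, \<rho> d + d)) \<or>
    (\<exists>\<rho>'. staircase n u (min a b) \<rho>' \<and>
      (\<Sum>d = min a b - 1..n - u. w (\<rho>' d, \<rho>' d + d)) \<le> Suc (\<Sum>d = b - 1..n - u. w' (\<rho> d, \<rho> d + d)))"
proof -
  \<comment> \<open>The diagonals on which the chain meets the staircase; \<open>D\<close> below is the last one.\<close>
  define H where "H = {d \<in> {b - 1..n - u}. g (\<rho> d) = d}"
  have \<rho>1: "1 \<le> \<rho> d" "\<rho> d \<le> u" if "d \<in> {b - 1..n - u}" for d
    using \<rho> that by (auto simp: staircase_def image_subset_iff)
  have \<rho>m: "\<rho> d \<le> \<rho> e" if "d \<in> {b - 1..n - u}" "e \<in> {b - 1..n - u}" "d \<le> e" for d e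
    using \<rho> that by (auto simp: staircase_def mono_on_def)
  have miss: "w' (\<rho> d, \<rho> d + d) = w (\<rho> d, \<rho> d + d)" if "d \<in> {b - 1..n - u}" "d \<notin> H" for d
    using that by (auto simp: w' H_def)
  have hit: "w (\<rho> d, \<rho> d + d) \<le> Suc (w' (\<rho> d, \<rho> d + d))" for d by (auto simp: w')
  show ?thesis
  proof (cases "H = {}")
    case True
    then show ?thesis using miss by (intro disjI1 sum.cong) auto
  next
    case False
    have "finite H" by (simp add: H_def)
    define D where "D = Max H"
    have DH: "D \<in> H" unfolding D_def using \<open>finite H\<close> False by simp
    have Dmax: "d \<notin> H" if "D < d" for d
      using that \<open>finite H\<close> unfolding D_def by (meson Max_ge not_less)
    have D: "D \<in> {b - 1..n - u}" "g (\<rho> D) = D" using DH by (auto simp: H_def)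
    define G where "G d = (LEAST i. d < g i)" for d
    have G: "d < g (G d)" "G d \<le> \<rho> D" if "d < D" for d
    proof -
      have "d < g (\<rho> D)" using that D by simp
      then show "d < g (G d)" "G d \<le> \<rho> D" unfolding G_def by (auto intro: LeastI Least_le)
    qed
    have Gpred: "g i \<le> d" if "i < G d" for i d
      using not_less_Least[of i "\<lambda>i. d < g i"] that unfolding G_def by auto
    have Gmono: "G d \<le> G e" if "d \<le> e" "e < D" for d e
    proof -
      have "d < g (G e)" using G(1)[of e] that by simp
      then show ?thesis unfolding G_def[of d] by (rule Least_le)
    qed
    have Gzero: "w (G d, G d + d) = 0" if "d < D" "1 \<le> G d" for d
    proof -
      have "G d \<noteq> 0" using that by simp
      then obtain j where j: "G d = Suc j" using not0_implies_Suc by blast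
      have "j < t" using G(2)[OF that(1)] \<rho>1[OF D(1)] u j by simp
      then show ?thesis using zero[of j d] Gpred[of j d] G(1)[OF that(1)] j by auto
    qed
    define B where "B d = (if d < b - 1 then 1 else \<rho> d)" for d
    define \<rho>' where "\<rho>' d = (if d < D then max (B d) (G d) else \<rho> d)" for d
    have B1: "1 \<le> B d" "B d \<le> \<rho> D" if "d < D" for d
      using \<rho>1[of d] \<rho>1[OF D(1)] \<rho>m[of d D] that D(1) by (auto simp: B_def)
    have Bmono: "B d \<le> B e" if "d \<le> e" "e < D" for d e
      using \<rho>1[of e] \<rho>m[of d e] that D(1) by (auto simp: B_def)
    have \<rho>'1: "1 \<le> \<rho>' d" "\<rho>' d \<le> u" if "d \<in> {min a b - 1..n - u}" for d
      using \<rho>1[OF D(1)] \<rho>1[of d] B1[of d] G[of d] that D(1) unfolding \<rho>'_def by auto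
    have "mono_on {min a b - 1..n - u} \<rho>'"
    proof (rule mono_onI)
      fix d e assume de: "d \<in> {min a b - 1..n - u}" "e \<in> {min a b - 1..n - u}" "d \<le> e"
      consider "e < D" | "d < D" "D \<le> e" | "D \<le> d" by linarith
      then show "\<rho>' d \<le> \<rho>' e"
      proof cases
        case 1
        then show ?thesis using Bmono[of d e] Gmono[of d e] de by (auto simp: \<rho>'_def)
      next
        case 2
        then have "\<rho>' d \<le> \<rho> D" using B1[of d] G[of d] by (simp add: \<rho>'_def)
        also have "\<dots> \<le> \<rho> e" using \<rho>m[of D e] 2 de D(1) by auto
        finally show ?thesis using 2 by (simp add: \<rho>'_def)
      next
        case 3
        then show ?thesis using \<rho>m[of d e] de D(1) by (auto simp: \<rho>'_def)
      qed
    qed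
    with \<rho>'1 have st: "staircase n u (min a b) \<rho>'" unfolding staircase_def by auto
    define f where "f d = (if b - 1 \<le> d then w' (\<rho> d, \<rho> d + d) else 0)" for d
    have cell: "w (\<rho>' d, \<rho>' d + d) \<le> f d + (if d = D then 1 else 0)"
      if d: "d \<in> {min a b - 1..n - u}" for d
    proof -
      consider "d = D" | "D < d" | "d < D" "B d < G d" | "d < D" "G d \<le> B d" "b - 1 \<le> d"
        | "d < D" "G d \<le> B d" "d < b - 1" by linarith
      then show ?thesis
      proof cases
        case 1
        then show ?thesis using hit[of D] D(1) by (simp add: \<rho>'_def f_def)
      next
        case 2
        then show ?thesis using miss[of d] Dmax[of d] d D(1) by (simp add: \<rho>'_def f_def)
      next
        case 3
        then have "\<rho>' d = G d" by (simp add: \<rho>'_def)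
        then show ?thesis using Gzero[of d] 3 by simp
      next
        case 4
        have "d \<notin> H"
        proof
          assume "d \<in> H"
          then have "g (\<rho> d) = d" by (simp add: H_def)
          moreover have "g (G d) \<le> g (\<rho> d)" using 4 monoD[OF g(2)] by (simp add: B_def)
          ultimately show False using G(1)[of d] 4 by simp
        qed
        then show ?thesis using miss[of d] 4 d by (simp add: \<rho>'_def f_def B_def max_absorb1)
      next
        case 5
        then have "a - 1 \<le> d" using d by (auto simp: min_def split: if_splits)
        then have "G d \<noteq> 0" using G(1)[of d] g(1) 5 by (metis not_less)
        then have "G d = 1" using 5 by (simp add: B_def)
        then show ?thesis using Gzero[of d] 5 by (simp add: \<rho>'_def B_def)
      qed
    qed
    have "(\<Sum>d = min a b - 1..n - u. w (\<rho>' d, \<rho>' d + d))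
        \<le> (\<Sum>d = min a b - 1..n - u. f d + (if d = D then 1 else 0))"
      using cell by (rule sum_mono)
    also have "\<dots> \<le> (\<Sum>d = min a b - 1..n - u. f d) + 1"
      by (simp add: sum.distrib)
    also have "(\<Sum>d = min a b - 1..n - u. f d) = (\<Sum>d = b - 1..n - u. f d)"
      by (rule sum.mono_neutral_right) (auto simp: f_def)
    also have "\<dots> = (\<Sum>d = b - 1..n - u. w' (\<rho> d, \<rho> d + d))"
      by (rule sum.cong) (auto simp: f_def)
    finally show ?thesis using st by auto
  qed
qed

text \<open>
  The combinatorial core, a max-flow min-cut theorem for several kinds of chains at once.  Choose an
  index whose length \<open>t\<close> is maximal and remove the leftmost chain of its kind.  Bounds for
  \<open>u > t\<close> are void.  For \<open>u \<le> t\<close> the bound for \<open>(u, min a b)\<close> counts the chosen index and at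
  least every other index counted for \<open>(u, b)\<close>, and so it exceeds the new bound for \<open>(u, b)\<close> by at
  least one.
\<close>

lemma chain_packing:
  assumes "finite A"
    and "\<And>i. i \<in> A \<Longrightarrow> (t i, a i) \<in> index_pairs m n"
    and "\<And>u b \<rho>. (u, b) \<in> index_pairs m n \<Longrightarrow> staircase n u b \<rho> \<Longrightarrow>
           card {i \<in> A. b \<le> a i \<and> u \<le> t i} \<le> crossing n u b \<rho> \<mu>"
  shows "\<exists>c \<nu>. (\<forall>i\<in>A. selects (t i) {a i..n} (c i)) \<and> \<mu> = (\<Sum>i\<in>A. diag_monom (t i) Suc (c i)) + \<nu>"
  using assms
proof (induction "card A" arbitrary: A \<mu>)
  case 0
  then show ?case by auto
next
  case (Suc k)
  have "A \<noteq> {}" using Suc.hyps(2) by auto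
  then obtain i0 where i0: "i0 \<in> A" "\<And>i. i \<in> A \<Longrightarrow> t i \<le> t i0"
    using Max_in[of "t ` A"] Max_ge[of "t ` A"] Suc.prems(1)
    by (metis (no_types, lifting) empty_is_image finite_imageI image_iff)
  define T where "T = t i0"
  define a0 where "a0 = a i0"
  have ix: "(T, a0) \<in> index_pairs m n" using Suc.prems(2)[OF i0(1)] by (simp add: T_def a0_def)
  then have ta: "1 \<le> T" "1 \<le> a0" "T + a0 \<le> n + 1" by (auto simp: index_pairs_def)
  have pos: "0 < (\<Sum>d = a0 - 1..n - T. lookup \<mu> (\<rho> d, \<rho> d + d))" if "staircase n T a0 \<rho>" for \<rho>
  proof -
    have "0 < card {i \<in> A. a0 \<le> a i \<and> T \<le> t i}"
      using i0(1) Suc.prems(1) by (auto simp: card_gt_0_iff T_def a0_def)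
    then show ?thesis using Suc.prems(3)[OF ix that] by (simp add: crossing_def)
  qed
  obtain g where g: "g 0 = a0 - 1" "mono g" "g T \<le> n - T"
    "\<And>i. i < T \<Longrightarrow> 0 < lookup \<mu> (Suc i, Suc i + g (Suc i))"
    "\<And>i d. i < T \<Longrightarrow> g i \<le> d \<Longrightarrow> d < g (Suc i) \<Longrightarrow> lookup \<mu> (Suc i, Suc i + d) = 0"
    by (rule leftmost_chain[OF ta, where w = "lookup \<mu>"], erule pos, blast)
  define c0 where "c0 l = Suc l + g (Suc l)" for l
  have sel0: "selects T {a0..n} c0"
    unfolding selects_def
  proof
    show "strict_mono_on {..<T} c0"
      using monoD[OF g(2)] by (auto simp: strict_mono_on_def c0_def add_less_le_mono)
    show "c0 ` {..<T} \<subseteq> {a0..n}"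
    proof clarify
      fix l assume "l < T"
      then have "g 0 \<le> g (Suc l)" "g (Suc l) \<le> g T" using monoD[OF g(2)] by auto
      then show "c0 l \<in> {a0..n}" using g(1,3) \<open>l < T\<close> ta by (auto simp: c0_def)
    qed
  qed
  define \<delta> where "\<delta> = diag_monom T Suc c0"
  define \<mu>' where "\<mu>' = \<mu> - \<delta>"
  have l\<delta>: "lookup \<delta> (i, c) = (if 1 \<le> i \<and> i \<le> T \<and> c = i + g i then 1 else 0)" for i c
    by (cases i) (auto simp: \<delta>_def lookup_diag_monom_Suc c0_def)
  have le: "lookup \<delta> x \<le> lookup \<mu> x" for x
  proof (cases x)
    case (Pair i c)
    show ?thesis
    proof (cases "1 \<le> i \<and> i \<le> T \<and> c = i + g i")
      case True
      then have "0 < lookup \<mu> (i, c)" using g(4)[of "i - 1"] by auto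
      then show ?thesis using True by (simp add: l\<delta> Pair)
    next
      case False
      then have "lookup \<delta> x = 0" unfolding Pair l\<delta> by (rule if_not_P)
      then show ?thesis by simp
    qed
  qed
  have \<mu>: "\<mu> = \<delta> + \<mu>'"
    by (rule poly_mapping_eqI) (use le in \<open>simp add: \<mu>'_def lookup_add lookup_minus\<close>)
  let ?A = "A - {i0}"
  have cond: "card {i \<in> ?A. b \<le> a i \<and> u \<le> t i} \<le> crossing n u b \<rho> \<mu>'"
    if ub: "(u, b) \<in> index_pairs m n" and \<rho>: "staircase n u b \<rho>" for u b \<rho>
  proof (cases "u \<le> T")
    case False
    then have "{i \<in> ?A. b \<le> a i \<and> u \<le> t i} = {}" using i0(2) by (fastforce simp: T_def)
    then show ?thesis by (simp only: card.empty le0)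
  next
    case True
    have b: "1 \<le> b" using ub by (simp add: index_pairs_def)
    have "lookup \<mu>' (i, c) = lookup \<mu> (i, c) - (if 1 \<le> i \<and> i \<le> T \<and> c = i + g i then 1 else 0)" for i c
      by (simp add: \<mu>'_def lookup_minus l\<delta>)
    from staircase_sum_after_removal[of g a0 T "lookup \<mu>" "lookup \<mu>'", OF g(1,2,5) this True ta(2) b \<rho>]
    consider "crossing n u b \<rho> \<mu> = crossing n u b \<rho> \<mu>'"
      | \<rho>' where "staircase n u (min a0 b) \<rho>'" "crossing n u (min a0 b) \<rho>' \<mu> \<le> Suc (crossing n u b \<rho> \<mu>')"
      unfolding crossing_def by blast
    then show ?thesis
    proof cases
      case 1
      have "card {i \<in> ?A. b \<le> a i \<and> u \<le> t i} \<le> card {i \<in> A. b \<le> a i \<and> u \<le> t i}"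
        using Suc.prems(1) by (intro card_mono) auto
      then show ?thesis using Suc.prems(3)[OF ub \<rho>] 1 by simp
    next
      case 2
      have ub': "(u, min a0 b) \<in> index_pairs m n" using ub ta by (auto simp: index_pairs_def)
      have "card (insert i0 {i \<in> ?A. b \<le> a i \<and> u \<le> t i}) \<le> card {i \<in> A. min a0 b \<le> a i \<and> u \<le> t i}"
        using Suc.prems(1) i0(1) True by (intro card_mono) (auto simp: T_def a0_def)
      then have "Suc (card {i \<in> ?A. b \<le> a i \<and> u \<le> t i}) \<le> card {i \<in> A. min a0 b \<le> a i \<and> u \<le> t i}"
        using Suc.prems(1) by simp
      then show ?thesis using Suc.prems(3)[OF ub' 2(1)] 2(2) by linarith
    qed
  qed
  have "k = card ?A" using Suc.hyps(2) i0(1) Suc.prems(1) by simp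
  from Suc.hyps(1)[OF this _ _ cond] Suc.prems(1,2) obtain c \<nu> where
    c: "\<forall>i\<in>?A. selects (t i) {a i..n} (c i)" "\<mu>' = (\<Sum>i\<in>?A. diag_monom (t i) Suc (c i)) + \<nu>" by blast
  define c' where "c' = c(i0 := c0)"
  have "\<forall>i\<in>A. selects (t i) {a i..n} (c' i)" using c(1) sel0 by (auto simp: c'_def T_def a0_def)
  moreover have "\<mu> = (\<Sum>i\<in>A. diag_monom (t i) Suc (c' i)) + \<nu>"
  proof -
    have "(\<Sum>i\<in>A. diag_monom (t i) Suc (c' i)) = \<delta> + (\<Sum>i\<in>?A. diag_monom (t i) Suc (c' i))"
      using sum.remove[OF Suc.prems(1) i0(1), of "\<lambda>i. diag_monom (t i) Suc (c' i)"]
      by (simp add: c'_def \<delta>_def T_def)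
    also have "(\<Sum>i\<in>?A. diag_monom (t i) Suc (c' i)) = (\<Sum>i\<in>?A. diag_monom (t i) Suc (c i))"
      by (rule sum.cong) (auto simp: c'_def)
    finally show ?thesis using \<mu> c(2) by (simp add: add.assoc)
  qed
  ultimately show ?case by blast
qed

section \<open>Order of vanishing along a determinantal variety\<close>

text \<open>
  A linear relation between rows modulo \<open>p\<close>, one of whose coefficients is prime to \<open>p\<close>, forces the
  determinant to vanish modulo \<open>p\<close>; multiply the relation by the adjugate matrix.
\<close>

lemma prime_dvd_det:
  fixes M :: "'r::idom mat"
  assumes M: "M \<in> carrier_mat t t" and p: "prime_elem p" and S: "S \<subseteq> {..<t}" "s \<in> S"
    and s: "\<not> p dvd l s"
    and rel: "\<And>k. k < t \<Longrightarrow> p dvd (\<Sum>i\<in>S. l i * M $$ (i, k))"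
  shows "p dvd det M"
proof -
  have st: "s < t" and fin: "finite S" using S finite_subset by auto
  let ?A = "adj_mat M"
  have A: "?A \<in> carrier_mat t t" by (rule adj_mat(1)[OF M])
  have entry: "(\<Sum>k<t. M $$ (i, k) * ?A $$ (k, s)) = (if i = s then det M else 0)" if "i \<in> S" for i
  proof -
    have i: "i < t" using that S(1) by auto
    have "(M * ?A) $$ (i, s) = (\<Sum>k<t. M $$ (i, k) * ?A $$ (k, s))"
      using i st M A by (auto simp: times_mat_def scalar_prod_def atLeast0LessThan)
    moreover have "(M * ?A) $$ (i, s) = (if i = s then det M else 0)"
      unfolding adj_mat(2)[OF M] using i st by simp
    ultimately show ?thesis by simp
  qed
  have "l s * det M = (\<Sum>i\<in>S. l i * (if i = s then det M else 0))"
    using fin S(2) by (simp add: sum.delta' if_distrib cong: if_cong)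
  also have "\<dots> = (\<Sum>i\<in>S. l i * (\<Sum>k<t. M $$ (i, k) * ?A $$ (k, s)))"
    by (rule sum.cong) (auto simp: entry)
  also have "\<dots> = (\<Sum>i\<in>S. \<Sum>k<t. l i * M $$ (i, k) * ?A $$ (k, s))"
    by (simp add: sum_distrib_left mult.assoc)
  also have "\<dots> = (\<Sum>k<t. \<Sum>i\<in>S. l i * M $$ (i, k) * ?A $$ (k, s))"
    by (rule sum.swap)
  also have "\<dots> = (\<Sum>k<t. (\<Sum>i\<in>S. l i * M $$ (i, k)) * ?A $$ (k, s))"
    by (simp add: sum_distrib_right)
  finally have "l s * det M = (\<Sum>k<t. (\<Sum>i\<in>S. l i * M $$ (i, k)) * ?A $$ (k, s))" .
  moreover have "p dvd (\<Sum>k<t. (\<Sum>i\<in>S. l i * M $$ (i, k)) * ?A $$ (k, s))"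
    by (rule dvd_sum) (auto intro: dvd_mult2 rel)
  ultimately have "p dvd l s * det M" by simp
  then show ?thesis using p s by (auto simp: prime_elem_def)
qed

definition tvar :: "nat \<Rightarrow> nat \<Rightarrow> 'k::field poly xpoly" where
  "tvar i j = single (single (i, j) 1) 1"

lemma eps_subst_xvar [simp]: "eps_subst h (xvar i j) = h (i, j)"
proof -
  have "(single 0 [:1::'a:] :: 'a poly xpoly) = 1" by (metis one_pCons single_one)
  then show ?thesis
    unfolding eps_subst_def xvar_def comm_ring_hom.subst_single[OF comm_ring_hom_const_eps]
    by (simp add: monom_value_single)
qed

lemma eps_subst_minor:
  "eps_subst h (minor t r c) = det (Matrix.mat t t (\<lambda>(i, j). h (r i, c j)))"
proof -
  have "map_mat (eps_subst h) (Matrix.mat t t (\<lambda>(i, j). xvar (r i) (c j))) = Matrix.mat t t (\<lambda>(i, j). h (r i, c j))"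
    by (rule eq_matI) auto
  then show ?thesis unfolding minor_def eps_subst.hom_det[symmetric] by simp
qed

text \<open>
  A matrix whose rows \<open>1..u\<close> are, in the columns from \<open>b\<close> on and modulo \<open>eps\<close>, the generic rows
  with the linear relation \<open>\<Sum>l\<le>u. \<lambda>\<^sub>l row\<^sub>l = 0\<close>.  The coefficient \<open>\<lambda>\<^sub>l\<close> is the spare variable at
  position \<open>(0, l)\<close>, and the free direction of deformation uses the spare rows below row \<open>m\<close>.  The
  first \<open>u - 1\<close> rows carry the factor \<open>\<lambda>\<^sub>u\<close>, which avoids a division in row \<open>u\<close>.
\<close>

definition generic_point :: "nat \<Rightarrow> nat \<Rightarrow> nat \<Rightarrow> nat \<times> nat \<Rightarrow> 'k::field poly xpoly" where
  "generic_point m u b = (\<lambda>(i, j).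
     if 1 \<le> i \<and> i < u \<and> b \<le> j then tvar 0 u * tvar i j + eps * tvar (m + i) j
     else if i = u \<and> b \<le> j then eps * tvar (m + u) j - (\<Sum>l\<in>{1..<u}. tvar 0 l * tvar l j)
     else tvar i j)"

text \<open>
  The polynomials that vanish to order \<open>k\<close> along the matrices whose first \<open>u\<close> rows have rank less
  than \<open>u\<close> in the columns from \<open>b\<close> on: the \<open>k\<close>-th symbolic power of \<open>I\<^sub>u(b)\<close>.
\<close>

definition minor_val_ideal :: "nat \<Rightarrow> nat \<Rightarrow> nat \<Rightarrow> nat \<Rightarrow> nat \<Rightarrow> 'k::field xpoly set" where
  "minor_val_ideal m n u b k = val_ideal m n (generic_point m u b) k"

lemma not_eps_dvd_tvar: "\<not> eps dvd (tvar i j :: 'k::field poly xpoly)"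
proof
  assume "eps dvd (tvar i j :: 'k poly xpoly)"
  then have "[:0, 1::'k:] ^ 1 dvd lookup (tvar i j) (single (i, j) 1)"
    by (intro eps_power_dvd_lookup) simp
  then have "[:- 0, 1::'k:] dvd 1" by (simp only: tvar_def lookup_single_eq power_one_right minus_zero)
  then have "poly (1::'k poly) 0 = 0" by (simp only: poly_eq_0_iff_dvd)
  then show False by simp
qed

lemma minor_in_minor_val_ideal:
  assumes u: "1 \<le> u" "u \<le> t" "t \<le> m" and b: "1 \<le> b" "b \<le> a"
    and r: "selects t {1..t} r" and c: "selects t {a..n} c"
  shows "(minor t r c :: 'k::field xpoly) \<in> minor_val_ideal m n u b 1"
proof -
  let ?g = "generic_point m u b :: nat \<times> nat \<Rightarrow> 'k poly xpoly"
  let ?M = "Matrix.mat t t (\<lambda>(i, j). ?g (r i, c j))"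
  have "eps dvd det ?M"
  proof (rule prime_dvd_det[where S = "{..<u}" and s = "u - 1" and l = "\<lambda>i. tvar 0 (Suc i)"])
    show "prime_elem (eps :: 'k poly xpoly)" by (rule prime_elem_eps)
    show "\<not> eps dvd (tvar 0 (Suc (u - 1)) :: 'k poly xpoly)" by (rule not_eps_dvd_tvar)
    fix k assume k: "k < t"
    then have "a \<le> c k" using c by (auto simp: selects_def image_subset_iff)
    then have ck: "b \<le> c k" using b by simp
    have ri: "r i = Suc i" if "i < u" for i using selects_initial_segment[OF r] that u by simp
    let ?q = "\<Sum>i<u. tvar 0 (Suc i) * tvar (m + Suc i) (c k) :: 'k poly xpoly"
    obtain u' where u': "u = Suc u'" using u(1) by (cases u) auto
    have "(\<Sum>i<u. tvar 0 (Suc i) * ?M $$ (i, k)) = (\<Sum>i<u. tvar 0 (Suc i) * ?g (Suc i, c k))"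
      using k u by (intro sum.cong) (auto simp: ri)
    also have "\<dots> = (\<Sum>i<u'. tvar 0 (Suc i) * ?g (Suc i, c k)) + tvar 0 u * ?g (u, c k)"
      by (simp add: u')
    also have "(\<Sum>i<u'. tvar 0 (Suc i) * ?g (Suc i, c k))
        = (\<Sum>i<u'. tvar 0 u * (tvar 0 (Suc i) * tvar (Suc i) (c k)) + eps * (tvar 0 (Suc i) * tvar (m + Suc i) (c k)))"
      using ck by (intro sum.cong) (auto simp: generic_point_def u' algebra_simps)
    also have "\<dots> = tvar 0 u * (\<Sum>i<u'. tvar 0 (Suc i) * tvar (Suc i) (c k))
        + eps * (\<Sum>i<u'. tvar 0 (Suc i) * tvar (m + Suc i) (c k))"
      unfolding sum.distrib sum_distrib_left ..
    also have "?g (u, c k) = eps * tvar (m + u) (c k) - (\<Sum>i<u'. tvar 0 (Suc i) * tvar (Suc i) (c k))"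
    proof -
      have "(\<Sum>l\<in>{1..<u}. tvar 0 l * tvar l (c k)) = (\<Sum>i<u'. tvar 0 (Suc i) * (tvar (Suc i) (c k) :: 'k poly xpoly))"
        by (rule sum.reindex_bij_witness[of _ Suc "\<lambda>l. l - 1"]) (auto simp: u')
      then show ?thesis using ck by (simp add: generic_point_def)
    qed
    finally have "(\<Sum>i<u. tvar 0 (Suc i) * ?M $$ (i, k))
        = eps * ((\<Sum>i<u'. tvar 0 (Suc i) * tvar (m + Suc i) (c k)) + tvar 0 u * tvar (m + u) (c k))"
      by (simp add: algebra_simps)
    then show "eps dvd (\<Sum>i<u. tvar 0 (Suc i) * ?M $$ (i, k))" by (rule dvdI)
  qed (use u in auto)
  moreover have "(minor t r c :: 'k xpoly) \<in> carrier (poly_ring m n)"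
    using r c u b by (intro minor_in_poly_ring) (fastforce simp: selects_def)+
  ultimately show ?thesis by (simp add: minor_val_ideal_def val_ideal_def eps_subst_minor)
qed

text \<open>
  Every other deformation of a matrix with a row relation is a specialization of the generic one, by
  a \<open>K[eps]\<close>-linear homomorphism, and so has at least the same order in \<open>eps\<close>.
\<close>

lemma specialization_dvd:
  fixes \<theta> :: "nat \<times> nat \<Rightarrow> 'k::field poly xpoly" and A B :: "nat \<Rightarrow> nat \<Rightarrow> 'k poly xpoly"
  assumes f: "f \<in> minor_val_ideal m n u b k" and u: "1 \<le> u" "u \<le> m"
    and \<theta>: "\<And>i j. i \<in> {1..u} \<Longrightarrow> j \<in> {b..n} \<Longrightarrow> \<theta> (i, j) = l u * A i j + eps * B i j"
    and rel: "\<And>j. j \<in> {b..n} \<Longrightarrow> (\<Sum>i\<in>{1..u}. l i * A i j) = 0"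
  shows "eps ^ k dvd eps_subst \<theta> f"
proof -
  define h where "h = (\<lambda>(i, j). if i = 0 then l j else if m < i then B (i - m) j
    else if i \<le> u \<and> b \<le> j then A i j else \<theta> (i, j))"
  define \<psi> :: "'k poly xpoly \<Rightarrow> 'k poly xpoly" where "\<psi> = subst (\<lambda>p. single 0 p) h"
  have hc: "comm_ring_hom (\<lambda>p. single 0 p :: 'k poly xpoly)"
    by standard (auto simp: mult_single single_add)
  interpret \<psi>: comm_ring_hom \<psi> unfolding \<psi>_def by (rule comm_ring_hom.comm_ring_hom_subst[OF hc])
  have const: "\<psi> (single 0 p) = single 0 p" for p
    unfolding \<psi>_def comm_ring_hom.subst_single[OF hc] by simp
  have \<psi>eps: "\<psi> eps = eps" by (simp add: eps_def const)
  have \<psi>var: "\<psi> (tvar i j) = h (i, j)" for i j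
    unfolding \<psi>_def tvar_def comm_ring_hom.subst_single[OF hc] by (simp add: monom_value_single)
  have comp: "\<psi> (eps_subst g f) = eps_subst (\<psi> \<circ> g) f" for g
    unfolding eps_subst_def subst_def \<psi>.hom_sum \<psi>.hom_mult const monom_value_def \<psi>.hom_prod \<psi>.hom_power
    by simp
  have fc: "f \<in> carrier (poly_ring m n)" and dvd: "eps ^ k dvd eps_subst (generic_point m u b) f"
    using f by (auto simp: minor_val_ideal_def val_ideal_def)
  have "eps_subst (\<psi> \<circ> generic_point m u b) f = eps_subst \<theta> f"
  proof (rule eps_subst_cong[OF fc])
    fix i j assume ij: "i \<in> {1..m}" "j \<in> {1..n}"
    consider "i < u" "b \<le> j" | "i = u" "b \<le> j" | "u < i \<or> j < b" by linarith
    then show "(\<psi> \<circ> generic_point m u b) (i, j) = \<theta> (i, j)"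
    proof cases
      case 1
      then have "(\<psi> \<circ> generic_point m u b) (i, j) = l u * A i j + eps * B i j"
        using ij u by (simp add: generic_point_def \<psi>.hom_add \<psi>.hom_mult \<psi>eps \<psi>var h_def)
      then show ?thesis using \<theta>[of i j] 1 ij by simp
    next
      case 2
      have "{1..u} = insert u {1..<u}" using u(1) by auto
      then have "(\<Sum>i\<in>{1..<u}. l i * A i j) + l u * A u j = 0"
        using rel[of j] 2 ij by (simp add: add.commute)
      then have *: "l u * A u j = - (\<Sum>i\<in>{1..<u}. l i * A i j)"
        by (rule minus_unique[symmetric])
      have "(\<Sum>l\<in>{1..<u}. h (0, l) * h (l, j)) = (\<Sum>i\<in>{1..<u}. l i * A i j)"
        using u 2 by (intro sum.cong) (auto simp: h_def)
      then have "(\<psi> \<circ> generic_point m u b) (i, j) = eps * B u j - (\<Sum>i\<in>{1..<u}. l i * A i j)"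
        using ij u 2 by (simp add: generic_point_def \<psi>.hom_minus \<psi>.hom_sum \<psi>.hom_mult \<psi>eps \<psi>var) (simp add: h_def)
      then have "(\<psi> \<circ> generic_point m u b) (i, j) = l u * A u j + eps * B u j"
        unfolding * by simp
      then show ?thesis using \<theta>[of i j] 2 ij u by simp
    next
      case 3
      then have "(\<psi> \<circ> generic_point m u b) (i, j) = h (i, j)"
        by (auto simp: generic_point_def \<psi>var)
      then show ?thesis using 3 ij by (auto simp: h_def)
    qed
  qed
  moreover have "eps ^ k dvd \<psi> (eps_subst (generic_point m u b) f)"
    using dvd by (auto simp: dvd_def \<psi>.hom_mult \<psi>.hom_power \<psi>eps)
  ultimately show ?thesis by (simp add: comp)
qed

section \<open>Initial monomials and the order of vanishing\<close>

text \<open>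
  The inclusion of \<open>K[X]\<close> into \<open>K[eps][X]\<close>.
\<close>

definition embed :: "'k::field xpoly \<Rightarrow> 'k poly xpoly" where
  "embed = eps_subst (\<lambda>(i, j). tvar i j)"

interpretation embed: comm_ring_hom embed
  unfolding embed_def by (rule comm_ring_hom_eps_subst)

lemma embed_xvar [simp]: "embed (xvar i j) = tvar i j"
  by (simp add: embed_def)

lemma monom_value_tvar: "monom_value (\<lambda>(i, j). tvar i j :: 'k::field poly xpoly) \<nu> = single \<nu> 1"
proof -
  have pw: "(tvar i j :: 'k poly xpoly) ^ e = single (single (i, j) e) 1" for i j e
    unfolding tvar_def by (induction e) (auto simp: mult_single single_add[symmetric])
  have "monom_value (\<lambda>(i, j). tvar i j :: 'k poly xpoly) \<nu> = (\<Prod>x\<in>keys \<nu>. single (single x (lookup \<nu> x)) 1)"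
    unfolding monom_value_def by (intro prod.cong) (auto simp: pw)
  also have "\<dots> = single \<nu> 1" unfolding prod_single sum_single_lookup ..
  finally show ?thesis .
qed

lemma lookup_embed: "lookup (embed f) \<kappa> = [:lookup f \<kappa>:]"
proof -
  have "lookup (embed f) \<kappa> = (\<Sum>\<nu>\<in>keys f. if \<nu> = \<kappa> then [:lookup f \<nu>:] else 0)"
    unfolding embed_def eps_subst_def subst_def monom_value_tvar lookup_sum lookup_const_mult
    by (intro sum.cong) (auto simp: lookup_single when_def)
  then show ?thesis by (simp add: in_keys_iff)
qed

lemma keys_embed: "keys (embed f) = keys f"
  by (auto simp: in_keys_iff lookup_embed)

lemma leads_embed: "leads ord \<tau> c f \<Longrightarrow> leads ord \<tau> [:c:] (embed f)"
  by (simp add: leads_def lookup_embed keys_embed)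

lemma homogeneous_embed: "homogeneous d f \<Longrightarrow> homogeneous d (embed f)"
  by (simp add: homogeneous_def keys_embed)

text \<open>
  Let \<open>s\<close> be the columns skipped by the staircase and \<open>\<delta> i\<close> the maximal minors of these columns.
  Scaling each variable by \<open>\<delta> t\<close> times the product \<open>D\<close> of all \<open>\<delta> i\<close>, and moving the variables in
  the cells \<open>(i, j)\<close> of the staircase by a multiple of the \<open>t\<close>-minor \<open>\<Delta> i j\<close> on \<open>s\<close> and \<open>j\<close>, gives
  a matrix that satisfies the row relation of the skipped columns.  Restoring \<open>eps\<close> times that
  multiple is a deformation \<open>\<theta>\<close> of it, so \<open>f\<close> has order at least \<open>k\<close> along \<open>\<theta>\<close>.
  
  The cell \<open>(i, j)\<close> lies on the main diagonal of \<open>\<Delta> i j\<close>, so that \<open>\<delta> i\<close> times the variable of the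
  cell and \<open>\<Delta> i j\<close> have the same leading term.  Hence \<open>\<theta>\<close> multiplies each variable by one common
  leading monomial, with coefficient \<open>eps\<close> in the cells of the staircase and 1 elsewhere.  The
  leading coefficient of the image of \<open>f\<close> is therefore a nonzero constant times \<open>eps\<close> to the number
  of times the initial monomial of \<open>f\<close> crosses the staircase.
\<close>

lemma init_monom_crossing:
  fixes f :: "'k::field xpoly"
  assumes ord: "diagonal_order TYPE('k) m n ord" and ta: "(t, a) \<in> index_pairs m n"
    and f: "f \<in> minor_val_ideal m n t a k" "f \<noteq> 0" and \<rho>: "staircase n t a \<rho>"
  shows "k \<le> crossing n t a \<rho> (init_monom ord f)"
proof -
  have mo: "monomial_order m n ord" using ord by (simp add: diagonal_order_def)
  have ta': "1 \<le> t" "1 \<le> a" "t \<le> m" "t + a \<le> n + 1" using ta by (auto simp: index_pairs_def)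
  let ?P = "cells n t a \<rho>"
  have fc: "keys f \<subseteq> monoms m n"
    using f(1) by (auto simp: minor_val_ideal_def val_ideal_def carrier_poly_ring_iff)
  have \<rho>t: "\<rho> d \<in> {1..t}" if "d \<in> {a - 1..n - t}" for d
    using \<rho> that by (auto simp: staircase_def image_subset_iff)
  obtain s where sel: "selects (t - 1) {a..n} s"
    and sep: "\<forall>d\<in>{a - 1..n - t}. \<forall>l. (Suc l < \<rho> d \<longrightarrow> s l < \<rho> d + d) \<and> (\<rho> d \<le> Suc l \<longrightarrow> \<rho> d + d < s l)"
    and covers: "\<forall>j\<in>{a..n}. (\<exists>l<t - 1. j = s l) \<or> (\<exists>d\<in>{a - 1..n - t}. j = \<rho> d + d)"
    using staircase_skipped_columns[OF ta'(1,2,4) \<rho>] by (elim exE conjE)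
  have "{a..n} \<subseteq> {1..n}" using ta'(2) by simp
  then have sel_n: "selects (t - 1) {1..n} s" using sel unfolding selects_def by blast
  have skip: "selects (t - 1) {1..m} (skip_row i)" if "i \<in> {1..t}" for i
    using that ta' by (auto simp: selects_def strict_mono_on_def skip_row_def image_subset_iff)
  have Suc_sel: "selects t {1..m} Suc" by (rule selects_Suc[OF ta'(3)])
  define \<delta> where "\<delta> i = embed (minor (t - 1) (skip_row i) s :: 'k xpoly)" for i
  define \<tau> where "\<tau> i = diag_monom (t - 1) (skip_row i) s" for i
  have \<delta>_leads: "leads ord (\<tau> i) 1 (\<delta> i)" if "i \<in> {1..t}" for i
  proof -
    have "leads ord (\<tau> i) [:1:] (\<delta> i)"
      unfolding \<delta>_def \<tau>_def by (intro leads_embed leads_minor[OF ord] skip that sel_n)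
    then show ?thesis by (simp only: one_pCons[symmetric])
  qed
  have \<delta>_hom: "homogeneous (t - 1) (\<delta> i)" for i
    unfolding \<delta>_def by (intro homogeneous_embed homogeneous_minor)
  define \<Delta> where "\<Delta> i j = embed (minor t Suc (insert_column i j s) :: 'k xpoly)" for i j
  have cellD: "i \<in> {1..t}" "insert_column i j s ` {..<t} \<subseteq> {1..n}" "strict_mono_on {..<t} (insert_column i j s)"
    if "(i, j) \<in> ?P" for i j
  proof -
    from that obtain d where d: "d \<in> {a - 1..n - t}" "i = \<rho> d" "j = \<rho> d + d" by (auto simp: cells_def)
    show it: "i \<in> {1..t}" using \<rho>t[OF d(1)] d(2) by simp
    have bef: "s l < j" if "Suc l < i" for l using sep d that by blast
    have aft: "j < s l" if "i \<le> Suc l" for l using sep d that by blast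
    have s1: "s l \<in> {1..n}" if "l < t - 1" for l using sel_n that by (auto simp: selects_def)
    have smono: "s l < s l'" if "l < l'" "l' < t - 1" for l l'
      using sel_n that by (auto simp: selects_def strict_mono_on_def)
    have jn: "j \<in> {1..n}" using d it ta' by auto
    show "insert_column i j s ` {..<t} \<subseteq> {1..n}"
    proof clarify
      fix l assume "l < t"
      then show "insert_column i j s l \<in> {1..n}"
        using s1[of l] s1[of "l - 1"] jn it by (auto simp: insert_column_def)
    qed
    show "strict_mono_on {..<t} (insert_column i j s)"
    proof (rule strict_mono_onI)
      fix l l' assume l: "l \<in> {..<t}" "l' \<in> {..<t}" "l < l'"
      consider "Suc l' < i" | "Suc l < i" "Suc l' = i" | "Suc l < i" "i < Suc l'"
        | "Suc l = i" "i < Suc l'" | "i < Suc l" using l(3) by linarith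
      then show "insert_column i j s l < insert_column i j s l'"
      proof cases
        case 1
        then show ?thesis using smono[of l l'] l it by (simp add: insert_column_def)
      next
        case 2
        then show ?thesis using bef[of l] by (simp add: insert_column_def)
      next
        case 3
        then show ?thesis using bef[of l] aft[of "l' - 1"] l by (simp add: insert_column_def)
      next
        case 4
        then show ?thesis using aft[of "l' - 1"] l by (simp add: insert_column_def)
      next
        case 5
        then have "l - 1 < l' - 1" "l' - 1 < t - 1" using l it by auto
        then show ?thesis using smono[of "l - 1" "l' - 1"] 5 l by (simp add: insert_column_def)
      qed
    qed
  qed
  have \<Delta>_leads: "leads ord (single (i, j) 1 + \<tau> i) 1 (\<Delta> i j)" if "(i, j) \<in> ?P" for i j
  proof -
    have "selects t {1..n} (insert_column i j s)" using cellD[OF that] by (simp add: selects_def)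
    then have "leads ord (diag_monom t Suc (insert_column i j s)) [:1:] (\<Delta> i j)"
      unfolding \<Delta>_def by (intro leads_embed leads_minor[OF ord] Suc_sel)
    then show ?thesis
      unfolding diag_monom_insert_column[OF cellD(1)[OF that]] \<tau>_def by (simp only: one_pCons[symmetric])
  qed
  have \<Delta>_hom: "homogeneous t (\<Delta> i j)" for i j
    unfolding \<Delta>_def by (intro homogeneous_embed homogeneous_minor)
  define D where "D = (\<Prod>i\<in>{1..t}. \<delta> i)"
  define D' where "D' q = (\<Prod>i\<in>{1..t} - {q}. \<delta> i)" for q
  have D: "D = \<delta> q * D' q" if "q \<in> {1..t}" for q
    unfolding D_def D'_def using that by (intro prod.remove) auto
  define A where "A i j = D * tvar i j - (if (i, j) \<in> ?P then D' i * \<Delta> i j else 0)" for i j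
  define B where "B i j = (if (i, j) \<in> ?P then \<delta> t * (D' i * \<Delta> i j) else 0)" for i j
  define \<theta> where "\<theta> = (\<lambda>(i, j). \<delta> t * A i j + eps * B i j)"
  define l where "l i = (-1) ^ (i + t) * \<delta> i" for i
  \<comment> \<open>The Laplace expansion of \<open>\<Delta> q j\<close> is, up to sign, the linear form of the relation in column \<open>j\<close>.\<close>
  have relation: "(\<Sum>i\<in>{1..t}. l i * tvar i j) = (-1) ^ (q + t) * \<Delta> q j" if "q \<in> {1..t}" for q j
  proof -
    have sgn: "(-1) ^ (q + t) * (-1) ^ (i + q) = ((-1) ^ (i + t) :: 'k poly xpoly)" for i
    proof -
      have "(-1) ^ (q + t) * (-1) ^ (i + q) = ((-1) ^ (i + t) * (-1) ^ (2 * q) :: 'k poly xpoly)"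
        unfolding power_add[symmetric] by (rule arg_cong[where f = "\<lambda>e. (-1) ^ e"]) simp
      then show ?thesis by simp
    qed
    have "(-1) ^ (q + t) * \<Delta> q j = (\<Sum>i\<in>{1..t}. ((-1) ^ (q + t) * (-1) ^ (i + q)) * tvar i j * \<delta> i)"
      unfolding \<Delta>_def minor_insert_column[OF that] \<delta>_def
      by (simp add: embed.hom_sum embed.hom_mult embed.hom_power embed.hom_uminus sum_distrib_left mult.assoc)
    also have "\<dots> = (\<Sum>i\<in>{1..t}. l i * tvar i j)"
      unfolding sgn l_def by (simp add: mult_ac)
    finally show ?thesis by simp
  qed
  \<comment> \<open>In a column of the staircase the correction of one entry cancels the value of the relation;
    in a skipped column the relation holds already.\<close>
  have A_relation: "(\<Sum>i\<in>{1..t}. l i * A i j) = 0" if j: "j \<in> {a..n}" for j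
  proof -
    have "(\<Sum>i\<in>{1..t}. l i * A i j) = D * (\<Sum>i\<in>{1..t}. l i * tvar i j)
        - (\<Sum>i\<in>{1..t}. if (i, j) \<in> ?P then l i * (D' i * \<Delta> i j) else 0)"
      unfolding A_def right_diff_distrib sum_subtractf sum_distrib_left
      by (intro arg_cong2[of _ _ _ _ "(-)"] sum.cong) (auto simp: mult_ac)
    also have "\<dots> = 0"
    proof (cases "\<exists>d\<in>{a - 1..n - t}. j = \<rho> d + d")
      case True
      then obtain d where d: "d \<in> {a - 1..n - t}" "j = \<rho> d + d" by blast
      let ?q = "\<rho> d"
      have q: "?q \<in> {1..t}" by (rule \<rho>t[OF d(1)])
      have "(i, j) \<in> ?P \<longleftrightarrow> i = ?q" for i
      proof
        assume "(i, j) \<in> ?P"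
        then obtain e where e: "e \<in> {a - 1..n - t}" "i = \<rho> e" "j = \<rho> e + e" by (auto simp: cells_def)
        have "\<rho> e + e = \<rho> d + d" unfolding e(3)[symmetric] by (rule d(2))
        then have "e = d" by (rule staircase_column_inj[OF \<rho> e(1) d(1)])
        then show "i = ?q" unfolding e(2) by (rule arg_cong)
      qed (use d in \<open>auto simp: cells_def\<close>)
      then have "(\<Sum>i\<in>{1..t}. if (i, j) \<in> ?P then l i * (D' i * \<Delta> i j) else 0) = l ?q * (D' ?q * \<Delta> ?q j)"
        using q by simp
      also have "\<dots> = D * ((-1) ^ (?q + t) * \<Delta> ?q j)"
        unfolding D[OF q] l_def by (simp add: mult_ac)
      finally show ?thesis unfolding relation[OF q, of j] by simp
    next
      case False
      then obtain k where k: "k < t - 1" "j = s k" using covers j by blast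
      have "(i, j) \<notin> ?P" for i using False by (auto simp: cells_def)
      moreover have "\<Delta> 1 j = 0"
        unfolding \<Delta>_def k(2) minor_insert_repeated_column[OF k(1)] by simp
      then have "(\<Sum>i\<in>{1..t}. l i * tvar i j) = 0" using relation[of 1 j] ta'(1) by simp
      ultimately show ?thesis by simp
    qed
    finally show ?thesis .
  qed
  have lt: "l t = \<delta> t" by (simp add: l_def mult_2[symmetric])
  have dvd: "eps ^ k dvd eps_subst \<theta> f"
    by (rule specialization_dvd[where A = A and B = B and l = l, OF f(1) ta'(1,3) _ A_relation])
      (auto simp: \<theta>_def lt)
  define \<sigma> where "\<sigma> = \<tau> t + (\<Sum>i\<in>{1..t}. \<tau> i)"
  have tt: "t \<in> {1..t}" using ta' by simp
  have \<tau>m: "\<tau> i \<in> monoms m n" if "i \<in> {1..t}" for i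
    unfolding \<tau>_def using skip[OF that] sel_n by (intro diag_monom_in_monoms) (auto simp: selects_def)
  have \<sigma>m: "\<sigma> \<in> monoms m n"
    unfolding \<sigma>_def by (intro monoms_add monoms_sum \<tau>m tt)
  have deg\<sigma>: "mdeg \<sigma> = (t - 1) + t * (t - 1)"
    by (simp add: \<sigma>_def \<tau>_def mdeg_add mdeg_sum mdeg_diag_monom)
  have "leads ord (\<Sum>i\<in>{1..t}. \<tau> i) (\<Prod>i\<in>{1..t}. 1) D"
    unfolding D_def by (intro leads_prod[OF mo] \<delta>_leads)
  then have scale: "leads ord \<sigma> 1 (\<delta> t * D)"
    using leads_mult[OF mo \<delta>_leads[OF tt], of "\<Sum>i\<in>{1..t}. \<tau> i" 1 D] by (simp add: \<sigma>_def)
  have "homogeneous (\<Sum>i\<in>{1..t}. t - 1) D"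
    unfolding D_def by (intro homogeneous_prod \<delta>_hom)
  then have scale_hom: "homogeneous (mdeg \<sigma>) (\<delta> t * D)"
    using homogeneous_mult[OF \<delta>_hom, of "\<Sum>i\<in>{1..t}. t - 1" D t] by (simp add: deg\<sigma>)
  define c :: "nat \<times> nat \<Rightarrow> 'k poly" where "c x = (if x \<in> ?P then [:0, 1:] else 1)" for x
  have \<theta>_split: "\<theta> (i, j) = (\<delta> t * D) * tvar i j
      - (if (i, j) \<in> ?P then (1 - eps) * (\<delta> t * D' i * \<Delta> i j) else 0)" for i j
    by (simp add: \<theta>_def A_def B_def algebra_simps)
  have one_eps: "(1 - eps :: 'k poly xpoly) = single 0 [:1, -1:]"
  proof -
    have one: "(1 :: 'k poly xpoly) = single 0 [:1:]" by (metis one_pCons single_one)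
    show ?thesis unfolding eps_def one single_diff[symmetric] by simp
  qed
  have \<theta>_both: "leads ord (\<sigma> + single x 1) (c x) (\<theta> x) \<and> homogeneous (Suc (mdeg \<sigma>)) (\<theta> x)"
    if x: "x \<in> {1..m} \<times> {1..n}" for x
  proof -
    obtain i j where ij: "x = (i, j)" by (cases x)
    have xm: "single (i, j) 1 \<in> monoms m n" using x ij by (simp add: monoms_def)
    have tl: "leads ord (\<sigma> + single (i, j) 1) 1 ((\<delta> t * D) * tvar i j)"
      using leads_mult[OF mo scale leads_single[OF mo xm, of 1]] by (simp add: tvar_def)
    have th: "homogeneous (Suc (mdeg \<sigma>)) ((\<delta> t * D) * tvar i j)"
      using homogeneous_mult[OF scale_hom homogeneous_single[of "single (i, j) 1" "1::'k poly"]]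
      by (simp add: tvar_def)
    show ?thesis
    proof (cases "(i, j) \<in> ?P")
      case False
      then show ?thesis using tl th by (simp add: ij \<theta>_split c_def)
    next
      case True
      have i: "i \<in> {1..t}" by (rule cellD(1)[OF True])
      have "leads ord (\<Sum>i'\<in>{1..t} - {i}. \<tau> i') (\<Prod>i'\<in>{1..t} - {i}. 1) (D' i)"
        unfolding D'_def by (intro leads_prod[OF mo] \<delta>_leads) auto
      then have D'l: "leads ord (\<Sum>i'\<in>{1..t} - {i}. \<tau> i') 1 (D' i)" by simp
      have z: "leads ord 0 [:1, -1:] (1 - eps :: 'k poly xpoly)"
        unfolding one_eps by (intro leads_single[OF mo]) (simp add: monoms_def)
      have "(\<Sum>i'\<in>{1..t}. \<tau> i') = \<tau> i + (\<Sum>i'\<in>{1..t} - {i}. \<tau> i')"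
        using i by (intro sum.remove) auto
      then have "0 + (\<tau> t + (\<Sum>i'\<in>{1..t} - {i}. \<tau> i') + (single (i, j) 1 + \<tau> i)) = \<sigma> + single (i, j) 1"
        by (simp add: \<sigma>_def add_ac)
      with leads_mult[OF mo z leads_mult[OF mo leads_mult[OF mo \<delta>_leads[OF tt] D'l] \<Delta>_leads[OF True]]]
      have l2: "leads ord (\<sigma> + single (i, j) 1) [:1, -1:] ((1 - eps) * (\<delta> t * D' i * \<Delta> i j))" by simp
      have h1: "homogeneous 0 (1 - eps :: 'k poly xpoly)"
        unfolding one_eps using homogeneous_single[of 0] by simp
      have "homogeneous (\<Sum>i'\<in>{1..t} - {i}. t - 1) (D' i)"
        unfolding D'_def by (intro homogeneous_prod \<delta>_hom)
      then have hD: "homogeneous ((t - 1) * (t - 1)) (D' i)" using i by simp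
      have "0 + (t - 1 + (t - 1) * (t - 1) + t) = Suc (mdeg \<sigma>)"
        unfolding deg\<sigma> using ta'(1) by (cases t) auto
      with homogeneous_mult[OF h1 homogeneous_mult[OF homogeneous_mult[OF \<delta>_hom hD] \<Delta>_hom]]
      have h2: "homogeneous (Suc (mdeg \<sigma>)) ((1 - eps) * (\<delta> t * D' i * \<Delta> i j))" by metis
      have "c x = 1 - [:1, -1:]" using True by (simp add: c_def ij one_pCons)
      then show ?thesis
        using leads_diff[OF mo tl l2] homogeneous_diff[OF th h2] True by (simp add: ij \<theta>_split)
    qed
  qed
  define \<mu> where "\<mu> = init_monom ord f"
  have \<mu>: "leads ord \<mu> (lookup f \<mu>) f" "\<mu> \<in> keys f"
    unfolding \<mu>_def using init_monom_leads[OF mo f(2) fc] by auto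
  then have \<mu>m: "\<mu> \<in> monoms m n" and nz: "lookup f \<mu> \<noteq> 0" using fc by (auto simp: in_keys_iff)
  have "[:0, 1:] ^ k dvd lookup (eps_subst \<theta> f) ((\<Sum>i<mdeg \<mu>. \<sigma>) + \<mu>)"
    by (rule eps_power_dvd_lookup[OF dvd])
  also have "\<dots> = [:lookup f \<mu>:] * monom_value c \<mu>"
    using \<theta>_both by (intro lookup_subst_lead[OF mo _ _ \<sigma>m \<mu>(1) \<mu>m]) auto
  also have "monom_value c \<mu> = [:0, 1:] ^ crossing n t a \<rho> \<mu>"
    unfolding c_def crossing_eq_sum_cells[OF \<rho>] by (rule monom_value_indicator) simp
  finally have "[:0, 1:] ^ k dvd smult (lookup f \<mu>) ([:0, 1:] ^ crossing n t a \<rho> \<mu>)" by simp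
  then show ?thesis unfolding \<mu>_def[symmetric] by (rule X_power_dvd_smult[OF nz])
qed

section \<open>Monomial ideals defined by staircases\<close>

definition cross_monoms :: "nat \<Rightarrow> nat \<Rightarrow> nat \<Rightarrow> nat \<Rightarrow> nat \<Rightarrow> xmonom set" where
  "cross_monoms m n u b k = {\<mu> \<in> monoms m n. \<forall>\<rho>. staircase n u b \<rho> \<longrightarrow> k \<le> crossing n u b \<rho> \<mu>}"

definition monomial_span :: "xmonom set \<Rightarrow> 'k::field xpoly set" where
  "monomial_span C = {f. keys f \<subseteq> C}"

lemma cross_monoms_add:
  assumes "\<mu> \<in> cross_monoms m n u b k" "\<nu> \<in> cross_monoms m n u b l"
  shows "\<mu> + \<nu> \<in> cross_monoms m n u b (k + l)"
  using assms by (auto simp: cross_monoms_def crossing_add monoms_add intro: add_mono)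

lemma cross_monoms_0: "cross_monoms m n u b 0 = monoms m n"
  by (auto simp: cross_monoms_def)

text \<open>
  A staircase for \<open>(u', b')\<close> contains one for \<open>(u, b)\<close>, since there are fewer diagonals and more rows.
\<close>

lemma cross_monoms_antimono:
  assumes "u' \<le> u" "b' \<le> b" and \<mu>: "\<mu> \<in> cross_monoms m n u b k"
  shows "\<mu> \<in> cross_monoms m n u' b' k"
proof -
  have "b' - 1 \<le> b - 1" "n - u \<le> n - u'" using assms(1,2) by auto
  then have sub: "{b - 1..n - u} \<subseteq> {b' - 1..n - u'}" by (simp add: atLeastatMost_subset_iff)
  have "k \<le> crossing n u' b' \<rho> \<mu>" if \<rho>: "staircase n u' b' \<rho>" for \<rho>
  proof -
    have "mono_on {b - 1..n - u} \<rho>"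
      by (rule mono_on_subset[OF _ sub]) (use \<rho> in \<open>simp add: staircase_def\<close>)
    moreover have "\<rho> ` {b - 1..n - u} \<subseteq> {1..u}"
    proof -
      have "\<rho> ` {b - 1..n - u} \<subseteq> \<rho> ` {b' - 1..n - u'}" by (rule image_mono[OF sub])
      also have "\<dots> \<subseteq> {1..u'}" using \<rho> by (simp add: staircase_def)
      also have "\<dots> \<subseteq> {1..u}" using assms(1) by simp
      finally show ?thesis .
    qed
    ultimately have "staircase n u b \<rho>" by (simp add: staircase_def)
    then have "k \<le> crossing n u b \<rho> \<mu>" using \<mu> by (simp add: cross_monoms_def)
    also have "\<dots> \<le> crossing n u' b' \<rho> \<mu>"
      unfolding crossing_def using sub by (intro sum_mono2) auto
    finally show ?thesis .
  qed
  then show ?thesis using \<mu> by (simp add: cross_monoms_def)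
qed

lemma ideal_monomial_span:
  assumes "C \<subseteq> monoms m n" "\<And>\<mu> \<nu>. \<mu> \<in> C \<Longrightarrow> \<nu> \<in> monoms m n \<Longrightarrow> \<nu> + \<mu> \<in> C"
  shows "ideal (monomial_span C) (poly_ring m n :: 'k::field xpoly ring)"
proof (rule poly_idealI)
  show "monomial_span C \<subseteq> carrier (poly_ring m n :: 'k xpoly ring)"
    using assms(1) by (auto simp: monomial_span_def carrier_poly_ring_iff)
  show "0 \<in> monomial_span C" by (simp add: monomial_span_def)
  fix f g :: "'k xpoly" assume f: "f \<in> monomial_span C"
  show "f + g \<in> monomial_span C" if "g \<in> monomial_span C"
    using f that Poly_Mapping.keys_add[of f g] by (auto simp: monomial_span_def)
  show "g * f \<in> monomial_span C" if "g \<in> carrier (poly_ring m n)"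
    using f that Poly_Mapping.keys_mult[of g f] assms(2)
    by (fastforce simp: monomial_span_def carrier_poly_ring_iff)
qed

lemma ideal_span_cross_monoms:
  "ideal (monomial_span (cross_monoms m n u b k)) (poly_ring m n)"
proof (rule ideal_monomial_span)
  show "\<nu> + \<mu> \<in> cross_monoms m n u b k" if "\<mu> \<in> cross_monoms m n u b k" "\<nu> \<in> monoms m n" for \<mu> \<nu>
    using cross_monoms_add[of \<nu> m n u b 0 \<mu> k] that by (simp add: cross_monoms_0)
qed (auto simp: cross_monoms_def)

lemma span_cross_monoms_mult:
  fixes f g :: "'k::field xpoly"
  assumes "f \<in> monomial_span (cross_monoms m n u b k)" "g \<in> monomial_span (cross_monoms m n u b l)"
  shows "f * g \<in> monomial_span (cross_monoms m n u b (k + l))"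
  unfolding monomial_span_def
proof clarify
  fix \<kappa> assume "\<kappa> \<in> keys (f * g)"
  then obtain x y where "\<kappa> = x + y" "x \<in> keys f" "y \<in> keys g"
    using Poly_Mapping.keys_mult[of f g] by blast
  moreover from this have "x \<in> cross_monoms m n u b k" "y \<in> cross_monoms m n u b l"
    using assms by (auto simp: monomial_span_def)
  ultimately show "\<kappa> \<in> cross_monoms m n u b (k + l)" using cross_monoms_add by simp
qed

lemma span_cross_monoms_0: "monomial_span (cross_monoms m n u b 0) = carrier (poly_ring m n)"
  by (auto simp: monomial_span_def cross_monoms_0 carrier_poly_ring_iff)

text \<open>
  Multiplying the variables in \<open>P\<close> by \<open>eps\<close> turns the degree in these variables into an \<open>eps\<close>-adic
  order, so that powers of a monomial prime are valuation ideals too.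
\<close>

definition weight_point :: "(nat \<times> nat) set \<Rightarrow> nat \<times> nat \<Rightarrow> 'k::field poly xpoly" where
  "weight_point P = (\<lambda>(i, j). (if (i, j) \<in> P then eps else 1) * tvar i j)"

lemma val_ideal_weight_point:
  assumes "finite P"
  shows "val_ideal m n (weight_point P) k
    = {f \<in> carrier (poly_ring m n). \<forall>\<kappa>\<in>keys f. k \<le> (\<Sum>x\<in>P. lookup \<kappa> x)}"
proof -
  let ?w = "\<lambda>\<kappa>. \<Sum>x\<in>P. lookup \<kappa> x"
  have mv: "monom_value (weight_point P) \<kappa> = eps ^ ?w \<kappa> * (single \<kappa> 1 :: 'a poly xpoly)" for \<kappa>
  proof -
    have "monom_value (weight_point P) \<kappa>
        = monom_value (\<lambda>x. if x \<in> P then eps else 1) \<kappa> * monom_value (\<lambda>(i, j). tvar i j :: 'a poly xpoly) \<kappa>"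
      unfolding monom_value_def prod.distrib[symmetric]
      by (intro prod.cong) (auto simp: weight_point_def power_mult_distrib)
    then show ?thesis by (simp add: monom_value_indicator[OF assms] monom_value_tvar)
  qed
  have es: "eps_subst (weight_point P) f = (\<Sum>\<nu>\<in>keys f. single \<nu> (smult (lookup f \<nu>) ([:0, 1:] ^ ?w \<nu>)))"
    for f :: "'a xpoly"
    unfolding eps_subst_def subst_def mv eps_power by (simp add: mult_single)
  have lk: "lookup (eps_subst (weight_point P) f) \<kappa> = smult (lookup f \<kappa>) ([:0, 1:] ^ ?w \<kappa>)"
    for f :: "'a xpoly" and \<kappa>
  proof -
    have "lookup (eps_subst (weight_point P) f) \<kappa>
        = (\<Sum>\<nu>\<in>keys f. if \<nu> = \<kappa> then smult (lookup f \<nu>) ([:0, 1:] ^ ?w \<nu>) else 0)"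
      unfolding es lookup_sum by (intro sum.cong) (auto simp: lookup_single when_def)
    then show ?thesis by (simp add: in_keys_iff)
  qed
  have "eps ^ k dvd eps_subst (weight_point P) f \<longleftrightarrow> (\<forall>\<kappa>\<in>keys f. k \<le> ?w \<kappa>)" for f :: "'a xpoly"
  proof
    assume dvd: "eps ^ k dvd eps_subst (weight_point P) f"
    show "\<forall>\<kappa>\<in>keys f. k \<le> ?w \<kappa>"
    proof
      fix \<kappa> assume "\<kappa> \<in> keys f"
      then have "lookup f \<kappa> \<noteq> 0" by (simp add: in_keys_iff)
      then show "k \<le> ?w \<kappa>"
        using eps_power_dvd_lookup[OF dvd, of \<kappa>] unfolding lk by (rule X_power_dvd_smult)
    qed
  next
    assume *: "\<forall>\<kappa>\<in>keys f. k \<le> ?w \<kappa>"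
    show "eps ^ k dvd eps_subst (weight_point P) f"
      unfolding eps_subst_def subst_def mv
      by (intro dvd_sum dvd_mult dvd_mult2 le_imp_power_dvd) (use * in auto)
  qed
  then show ?thesis by (simp add: val_ideal_def)
qed

text \<open>
  The exponent \<open>e\<^sub>u\<^sub>b\<close> of a family of pairs \<open>(t i, a i)\<close>.
\<close>

definition mult_above :: "'i set \<Rightarrow> ('i \<Rightarrow> nat) \<Rightarrow> ('i \<Rightarrow> nat) \<Rightarrow> nat \<Rightarrow> nat \<Rightarrow> nat" where
  "mult_above A t a u b = card {i \<in> A. b \<le> a i \<and> u \<le> t i}"

text \<open>
  The monomials that will turn out to span the initial ideal of the product of the \<open>I\<^sub>t\<^sub>i(a\<^sub>i)\<close>.
\<close>

definition pattern_monoms ::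
    "nat \<Rightarrow> nat \<Rightarrow> 'i set \<Rightarrow> ('i \<Rightarrow> nat) \<Rightarrow> ('i \<Rightarrow> nat) \<Rightarrow> xmonom set" where
  "pattern_monoms m n A t a =
     monoms m n \<inter> (\<Inter>(u, b)\<in>index_pairs m n. cross_monoms m n u b (mult_above A t a u b))"

lemma mult_above_sum:
  "finite A \<Longrightarrow> mult_above A t a u b = (\<Sum>i\<in>A. if b \<le> a i \<and> u \<le> t i then 1 else 0)"
  by (simp only: mult_above_def card_eq_sum sum.inter_filter)

lemma in_pattern_monoms_iff:
  "\<mu> \<in> pattern_monoms m n A t a \<longleftrightarrow> \<mu> \<in> monoms m n \<and>
    (\<forall>u b. (u, b) \<in> index_pairs m n \<longrightarrow> \<mu> \<in> cross_monoms m n u b (mult_above A t a u b))"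
  by (auto simp: pattern_monoms_def)

lemma pattern_monoms_const:
  assumes "(u, b) \<in> index_pairs m n"
  shows "pattern_monoms m n {..<e} (\<lambda>_. u) (\<lambda>_. b) = cross_monoms m n u b e"
proof -
  have e: "mult_above {..<e} (\<lambda>_. u) (\<lambda>_. b) u' b' = (if b' \<le> b \<and> u' \<le> u then e else 0)" for u' b'
    by (simp add: mult_above_def)
  show ?thesis
  proof
    show "pattern_monoms m n {..<e} (\<lambda>_. u) (\<lambda>_. b) \<subseteq> cross_monoms m n u b e"
    proof
      fix \<mu> assume "\<mu> \<in> pattern_monoms m n {..<e} (\<lambda>_. u) (\<lambda>_. b)"
      then have "\<mu> \<in> cross_monoms m n u b (mult_above {..<e} (\<lambda>_. u) (\<lambda>_. b) u b)"
        using assms unfolding pattern_monoms_def by blast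
      then show "\<mu> \<in> cross_monoms m n u b e" by (simp add: e)
    qed
    show "cross_monoms m n u b e \<subseteq> pattern_monoms m n {..<e} (\<lambda>_. u) (\<lambda>_. b)"
      unfolding pattern_monoms_def e
      using cross_monoms_antimono by (auto simp: cross_monoms_0 cross_monoms_def[of m n u b])
  qed
qed

lemma ideal_span_pattern_monoms:
  "ideal (monomial_span (pattern_monoms m n A t a)) (poly_ring m n)"
proof (rule ideal_monomial_span)
  show "\<nu> + \<mu> \<in> pattern_monoms m n A t a" if \<mu>: "\<mu> \<in> pattern_monoms m n A t a" and \<nu>: "\<nu> \<in> monoms m n" for \<mu> \<nu>
    unfolding in_pattern_monoms_iff
  proof (intro conjI allI impI)
    show "\<nu> + \<mu> \<in> monoms m n" using \<mu> \<nu> by (auto simp: in_pattern_monoms_iff intro: monoms_add)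
    fix u b assume "(u, b) \<in> index_pairs m n"
    then have "\<mu> \<in> cross_monoms m n u b (mult_above A t a u b)"
      using \<mu> unfolding pattern_monoms_def by blast
    then show "\<nu> + \<mu> \<in> cross_monoms m n u b (mult_above A t a u b)"
      using cross_monoms_add[of \<nu> m n u b 0 \<mu>] \<nu> by (simp add: cross_monoms_0)
  qed
qed (auto simp: pattern_monoms_def)

lemma pattern_monoms_packing:
  assumes A: "finite A" "\<And>i. i \<in> A \<Longrightarrow> (t i, a i) \<in> index_pairs m n"
    and \<mu>: "\<mu> \<in> pattern_monoms m n A t a"
  shows "\<exists>c \<nu>. (\<forall>i\<in>A. selects (t i) {a i..n} (c i)) \<and> \<nu> \<in> monoms m n
    \<and> \<mu> = (\<Sum>i\<in>A. diag_monom (t i) Suc (c i)) + \<nu>"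
proof -
  have "card {i \<in> A. b \<le> a i \<and> u \<le> t i} \<le> crossing n u b \<rho> \<mu>"
    if "(u, b) \<in> index_pairs m n" "staircase n u b \<rho>" for u b \<rho>
    using \<mu> that by (fastforce simp: pattern_monoms_def cross_monoms_def mult_above_def)
  from chain_packing[OF A this] obtain c \<nu> where c: "\<forall>i\<in>A. selects (t i) {a i..n} (c i)"
    and eq: "\<mu> = (\<Sum>i\<in>A. diag_monom (t i) Suc (c i)) + \<nu>" by blast
  have "keys \<nu> \<subseteq> keys \<mu>" unfolding eq by (auto simp: in_keys_iff lookup_add)
  then have "\<nu> \<in> monoms m n" using \<mu> by (auto simp: pattern_monoms_def monoms_def)
  then show ?thesis using c eq by blast
qed

text \<open>
  The span is the intersection, over all staircases, of powers of the prime generated by the variables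
  in the cells.
\<close>

lemma integrally_closed_span_pattern_monoms:
  "integrally_closed_ideal (poly_ring m n) (monomial_span (pattern_monoms m n A t a) :: 'k::field xpoly set)"
proof -
  define Y where "Y = {(u, b, \<rho>). (u, b) \<in> index_pairs m n \<and> staircase n u b \<rho>}"
  have "monomial_span (pattern_monoms m n A t a) = carrier (poly_ring m n :: 'k xpoly ring)
    \<inter> (\<Inter>y\<in>Y. val_ideal m n ((\<lambda>(u, b, \<rho>). weight_point (cells n u b \<rho>)) y) ((\<lambda>(u, b, \<rho>). mult_above A t a u b) y))"
    (is "?L = ?R")
  proof (rule Set.set_eqI)
    fix f :: "'k xpoly"
    have "f \<in> ?R \<longleftrightarrow> keys f \<subseteq> monoms m n \<and> (\<forall>u b \<rho>. (u, b) \<in> index_pairs m n \<longrightarrow> staircase n u b \<rho> \<longrightarrow>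
        (\<forall>\<kappa>\<in>keys f. mult_above A t a u b \<le> crossing n u b \<rho> \<kappa>))"
      by (auto simp: Y_def val_ideal_weight_point crossing_eq_sum_cells carrier_poly_ring_iff)
    also have "\<dots> \<longleftrightarrow> f \<in> ?L"
      by (fastforce simp: monomial_span_def pattern_monoms_def cross_monoms_def)
    finally show "f \<in> ?L \<longleftrightarrow> f \<in> ?R" by blast
  qed
  then show ?thesis by (rule integrally_closed_Inter_val_ideals)
qed

section \<open>Products of ideals of minors\<close>

lemma minor_in_poly_ring_of_index_pair:
  assumes "(t, a) \<in> index_pairs m n" "selects t {1..t} r" "selects t {a..n} c"
  shows "minor t r c \<in> carrier (poly_ring m n)"
proof (rule minor_in_poly_ring)
  have "{1..t} \<subseteq> {1..m}" "{a..n} \<subseteq> {1..n}" using assms(1) by (auto simp: index_pairs_def)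
  then show "r ` {..<t} \<subseteq> {1..m}" "c ` {..<t} \<subseteq> {1..n}" using assms by (auto simp: selects_def)
qed

lemma minor_ideal_generators:
  assumes "(t, a) \<in> index_pairs m n"
  shows "{minor t r c | r c. selects t {1..t} r \<and> selects t {a..n} c} \<subseteq> carrier (poly_ring m n :: 'k::field xpoly ring)"
  using minor_in_poly_ring_of_index_pair[OF assms] by blast

lemma ideal_minor_ideal:
  assumes "(t, a) \<in> index_pairs m n"
  shows "ideal (minor_ideal m n t a) (poly_ring m n :: 'k::field xpoly ring)"
  unfolding minor_ideal_def by (rule PR.genideal_ideal[OF minor_ideal_generators[OF assms]])

lemma minor_in_minor_ideal:
  assumes "(t, a) \<in> index_pairs m n" "selects t {1..t} r" "selects t {a..n} c"
  shows "minor t r c \<in> (minor_ideal m n t a :: 'k::field xpoly set)"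
  unfolding minor_ideal_def
  using PR.genideal_self[OF minor_ideal_generators[OF assms(1)]] assms(2,3) by blast

lemma minor_ideal_subset_val:
  assumes "(t, a) \<in> index_pairs m n" "1 \<le> u" "u \<le> t" "1 \<le> b" "b \<le> a"
  shows "(minor_ideal m n t a :: 'k::field xpoly set) \<subseteq> minor_val_ideal m n u b 1"
  unfolding minor_ideal_def
proof (rule PR.genideal_minimal)
  show "ideal (minor_val_ideal m n u b 1) (poly_ring m n :: 'k xpoly ring)"
    unfolding minor_val_ideal_def by (rule ideal_val_ideal)
  show "{minor t r c | r c. selects t {1..t} r \<and> selects t {a..n} c} \<subseteq> (minor_val_ideal m n u b 1 :: 'k xpoly set)"
    using minor_in_minor_val_ideal[of u t m b a] assms by (auto simp: index_pairs_def)
qed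

definition minor_product ::
    "nat \<Rightarrow> nat \<Rightarrow> 'i set \<Rightarrow> ('i \<Rightarrow> nat) \<Rightarrow> ('i \<Rightarrow> nat) \<Rightarrow> 'k::field xpoly set" where
  "minor_product m n A t a = (\<Otimes>\<^bsub>ideals_set (poly_ring m n)\<^esub> i\<in>A. minor_ideal m n (t i) (a i))"

lemma init_monom_in_pattern_monoms:
  assumes ord: "diagonal_order TYPE('k::field) m n ord"
    and f: "f \<in> carrier (poly_ring m n)" "f \<noteq> 0"
    and val: "\<And>u b. (u, b) \<in> index_pairs m n \<Longrightarrow>
      (f :: 'k xpoly) \<in> minor_val_ideal m n u b (mult_above A t a u b)"
  shows "init_monom ord f \<in> pattern_monoms m n A t a"
proof -
  have mo: "monomial_order m n ord" using ord by (simp add: diagonal_order_def)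
  have fc: "keys f \<subseteq> monoms m n" using f(1) by (simp add: carrier_poly_ring_iff)
  then have "init_monom ord f \<in> monoms m n" using init_monom_leads(2)[OF mo f(2) fc] by blast
  moreover have "mult_above A t a u b \<le> crossing n u b \<rho> (init_monom ord f)"
    if "(u, b) \<in> index_pairs m n" "staircase n u b \<rho>" for u b \<rho>
    by (rule init_monom_crossing[OF ord that(1) val[OF that(1)] f(2) that(2)])
  ultimately show ?thesis by (auto simp: in_pattern_monoms_iff cross_monoms_def)
qed

context
  fixes m n :: nat and A :: "'i set" and t a :: "'i \<Rightarrow> nat"
  assumes fin: "finite A" and ix: "\<And>i. i \<in> A \<Longrightarrow> (t i, a i) \<in> index_pairs m n"
begin

lemma ideal_minor_product: "ideal (minor_product m n A t a) (poly_ring m n :: 'k::field xpoly ring)"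
  unfolding minor_product_def by (rule ideal_finprod) (rule ideal_minor_ideal[OF ix])

lemma minor_product_subset_val:
  assumes "(u, b) \<in> index_pairs m n"
  shows "(minor_product m n A t a :: 'k::field xpoly set) \<subseteq> minor_val_ideal m n u b (mult_above A t a u b)"
  unfolding minor_product_def mult_above_sum[OF fin] minor_val_ideal_def
proof (rule finprod_subset_filtration[where V = "val_ideal m n (generic_point m u b)", OF fin])
  fix i assume i: "i \<in> A"
  show "ideal (minor_ideal m n (t i) (a i)) (poly_ring m n :: 'k xpoly ring)"
    by (rule ideal_minor_ideal[OF ix[OF i]])
  show "(minor_ideal m n (t i) (a i) :: 'k xpoly set)
    \<subseteq> val_ideal m n (generic_point m u b) (if b \<le> a i \<and> u \<le> t i then 1 else 0)"
    using minor_ideal_subset_val[OF ix[OF i], of u b] poly_idealD(1)[OF ideal_minor_ideal[OF ix[OF i]]] assms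
    by (auto simp: minor_val_ideal_def val_ideal_0 index_pairs_def)
qed (auto simp: ideal_val_ideal val_ideal_0 val_ideal_mult)

text \<open>
  The product of the minors on the packed chains, times the remaining monomial.
\<close>

lemma minor_product_witness:
  assumes ord: "diagonal_order TYPE('k::field) m n ord" and \<mu>: "\<mu> \<in> pattern_monoms m n A t a"
  obtains g :: "'k::field xpoly" where "g \<in> minor_product m n A t a" "leads ord \<mu> 1 g" "homogeneous (mdeg \<mu>) g"
proof -
  have mo: "monomial_order m n ord" using ord by (simp add: diagonal_order_def)
  obtain c \<nu> where "\<forall>i\<in>A. selects (t i) {a i..n} (c i)" and \<nu>: "\<nu> \<in> monoms m n"
    and eq: "\<mu> = (\<Sum>i\<in>A. diag_monom (t i) Suc (c i)) + \<nu>"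
    using pattern_monoms_packing[OF fin ix \<mu>] by blast
  then have c: "selects (t i) {a i..n} (c i)" if "i \<in> A" for i using that by blast
  let ?g = "\<Prod>i\<in>A. minor (t i) Suc (c i) :: 'k xpoly"
  have "?g \<in> minor_product m n A t a"
    unfolding minor_product_def
    by (intro prod_in_finprod fin ideal_minor_ideal ix minor_in_minor_ideal selects_Suc c order_refl)
  then have "single \<nu> 1 * ?g \<in> minor_product m n A t a"
    using \<nu> by (intro poly_idealD(4)[OF ideal_minor_product]) (auto simp: carrier_poly_ring_iff)
  then have 1: "?g * single \<nu> 1 \<in> minor_product m n A t a" by (simp add: mult.commute)
  have "leads ord (\<Sum>i\<in>A. diag_monom (t i) Suc (c i)) (\<Prod>i\<in>A. 1) ?g"
  proof (intro leads_prod[OF mo] leads_minor[OF ord])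
    fix i assume i: "i \<in> A"
    then have "t i \<le> m" "{a i..n} \<subseteq> {1..n}" using ix[OF i] by (auto simp: index_pairs_def)
    then show "selects (t i) {1..m} Suc" "selects (t i) {1..n} (c i)"
      using selects_Suc selects_mono[OF c[OF i]] by auto
  qed
  from leads_mult[OF mo this leads_single[OF mo \<nu>, of 1]]
  have 2: "leads ord \<mu> 1 (?g * single \<nu> 1)" by (simp add: eq)
  have "homogeneous (\<Sum>i\<in>A. t i) ?g" by (intro homogeneous_prod homogeneous_minor)
  from homogeneous_mult[OF this homogeneous_single[of \<nu> "1::'k"]]
  have "homogeneous (mdeg \<mu>) (?g * single \<nu> 1)" by (simp add: eq mdeg_add mdeg_sum mdeg_diag_monom)
  then show thesis using that 1 2 by blast
qed

text \<open>
  Reduction: by the packing theorem, the initial monomial of an element of \<open>W\<close> is that of an element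
  of the product.  Subtracting a multiple of the latter lowers the initial monomial.  The process
  terminates for every order because the subtracted polynomials are homogeneous, which keeps all
  monomials in a finite set of bounded degree.
\<close>

lemma subset_minor_product:
  assumes ord: "diagonal_order TYPE('k::field) m n ord"
    and W: "ideal W (poly_ring m n)" "(minor_product m n A t a :: 'k xpoly set) \<subseteq> W"
    and init: "\<And>f. f \<in> W \<Longrightarrow> f \<noteq> 0 \<Longrightarrow> init_monom ord f \<in> pattern_monoms m n A t a"
  shows "W \<subseteq> minor_product m n A t a"
proof
  fix f0 :: "'k xpoly" assume f0: "f0 \<in> W"
  let ?P = "minor_product m n A t a :: 'k xpoly set"
  have mo: "monomial_order m n ord" using ord by (simp add: diagonal_order_def)
  define N where "N = (\<Sum>\<kappa>\<in>keys f0. mdeg \<kappa>)"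
  define M where "M = {\<kappa> \<in> monoms m n. mdeg \<kappa> \<le> N}"
  have finM: "finite M" unfolding M_def by (rule finite_monoms_bounded)
  have Wc: "keys f \<subseteq> monoms m n" if "f \<in> W" for f
    by (rule poly_ideal_keys[OF W(1) that])
  have "f \<in> ?P" if "f \<in> W" "keys f \<subseteq> M" for f
    using that
  proof (induction "card {\<kappa> \<in> M. (\<kappa>, init_monom ord f) \<in> ord}" arbitrary: f rule: less_induct)
    case less
    show ?case
    proof (cases "f = 0")
      case True
      then show ?thesis using poly_idealD(2)[OF ideal_minor_product] by simp
    next
      case False
      define \<mu> where "\<mu> = init_monom ord f"
      define c where "c = lookup f \<mu>"
      have lf: "leads ord \<mu> c f" and \<mu>f: "\<mu> \<in> keys f"
        unfolding \<mu>_def c_def using init_monom_leads[OF mo False Wc[OF less.prems(1)]] by auto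
      have \<mu>M: "\<mu> \<in> M" using \<mu>f less.prems(2) by blast
      obtain g where g: "g \<in> ?P" "leads ord \<mu> 1 g" "homogeneous (mdeg \<mu>) g"
        using minor_product_witness[OF ord init[OF less.prems(1) False]] unfolding \<mu>_def by blast
      define g' where "g' = single 0 c * g"
      have cc: "single 0 c \<in> carrier (poly_ring m n :: 'k xpoly ring)"
        by (simp add: carrier_poly_ring_iff monoms_def)
      have g'P: "g' \<in> ?P" unfolding g'_def by (rule poly_idealD(4)[OF ideal_minor_product g(1) cc])
      have "leads ord (0 + \<mu>) (c * 1) g'"
        unfolding g'_def by (intro leads_mult[OF mo] g(2) leads_single[OF mo]) (simp add: monoms_def)
      then have lg: "leads ord \<mu> c g'" by simp
      have kg: "keys g' \<subseteq> M"
      proof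
        fix \<kappa> assume \<kappa>: "\<kappa> \<in> keys g'"
        then have "\<kappa> \<in> keys g" by (auto simp: g'_def in_keys_iff lookup_const_mult)
        then have "mdeg \<kappa> = mdeg \<mu>" using g(3) by (simp add: homogeneous_def)
        moreover have "\<kappa> \<in> monoms m n" using Wc[of g'] g'P W(2) \<kappa> by blast
        ultimately show "\<kappa> \<in> M" using \<mu>M by (simp add: M_def)
      qed
      define f' where "f' = f - g'"
      have "f' = f + (- 1) * g'" by (simp add: f'_def)
      also have "\<dots> \<in> W"
        using less.prems(1) g'P W(2) by (intro poly_idealD(3,4)[OF W(1)]) auto
      finally have f'W: "f' \<in> W" .
      have kf': "keys f' \<subseteq> M"
        using Poly_Mapping.keys_diff[of f g'] kg less.prems(2) by (auto simp: f'_def)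
      have lf': "leads ord \<mu> 0 f'" using leads_diff[OF mo lf lg] by (simp add: f'_def)
      have "f' \<in> ?P"
      proof (cases "f' = 0")
        case True
        then show ?thesis using poly_idealD(2)[OF ideal_minor_product] by simp
      next
        case f'0: False
        have in': "init_monom ord f' \<in> keys f'" by (rule init_monom_leads(2)[OF mo f'0 Wc[OF f'W]])
        then have le: "(init_monom ord f', \<mu>) \<in> ord" using lf' by (simp add: leads_def)
        have ne: "init_monom ord f' \<noteq> \<mu>" using in' lf' by (auto simp: leads_def in_keys_iff)
        have "{\<kappa> \<in> M. (\<kappa>, init_monom ord f') \<in> ord} \<subset> {\<kappa> \<in> M. (\<kappa>, \<mu>) \<in> ord}"
        proof
          show "{\<kappa> \<in> M. (\<kappa>, init_monom ord f') \<in> ord} \<subseteq> {\<kappa> \<in> M. (\<kappa>, \<mu>) \<in> ord}"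
            using ord_trans[OF mo _ le] by auto
          have "(\<mu>, init_monom ord f') \<notin> ord" using ord_antisym[OF mo le] ne by blast
          moreover have "(\<mu>, \<mu>) \<in> ord" using \<mu>M by (intro ord_refl[OF mo]) (simp add: M_def)
          ultimately show "{\<kappa> \<in> M. (\<kappa>, init_monom ord f') \<in> ord} \<noteq> {\<kappa> \<in> M. (\<kappa>, \<mu>) \<in> ord}"
            using \<mu>M by blast
        qed
        then have "card {\<kappa> \<in> M. (\<kappa>, init_monom ord f') \<in> ord} < card {\<kappa> \<in> M. (\<kappa>, \<mu>) \<in> ord}"
          using finM by (intro psubset_card_mono) auto
        then show ?thesis using f'W kf' unfolding \<mu>_def by (rule less.hyps)
      qed
      then have "f' + g' \<in> ?P" by (rule poly_idealD(3)[OF ideal_minor_product _ g'P])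
      then show ?thesis by (simp add: f'_def)
    qed
  qed
  moreover have "keys f0 \<subseteq> M"
    using Wc[OF f0] by (auto simp: M_def N_def intro: member_le_sum)
  ultimately show "f0 \<in> ?P" using f0 by blast
qed

text \<open>
  One inclusion is the valuation of the factors; the other is reduction, because every valuation
  bounds the initial monomials along its staircases.
\<close>

lemma minor_product_eq_Inter_val:
  assumes ord: "diagonal_order TYPE('k::field) m n ord"
  shows "(minor_product m n A t a :: 'k xpoly set) = carrier (poly_ring m n)
    \<inter> (\<Inter>(u, b)\<in>index_pairs m n. minor_val_ideal m n u b (mult_above A t a u b))"
    (is "?P = ?W")
proof
  show sub: "?P \<subseteq> ?W"
    using minor_product_subset_val poly_idealD(1)[OF ideal_minor_product] by fastforce
  have W: "?W = carrier (poly_ring m n)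
      \<inter> (\<Inter>j\<in>index_pairs m n. val_ideal m n (generic_point m (fst j) (snd j)) (mult_above A t a (fst j) (snd j)))"
    by (auto simp: minor_val_ideal_def)
  have idW: "ideal ?W (poly_ring m n)"
    using integrally_closed_Inter_val_ideals[OF W] by (simp add: integrally_closed_ideal_def)
  show "?W \<subseteq> ?P"
  proof (rule subset_minor_product[OF ord idW sub])
    fix f assume "f \<in> ?W" "f \<noteq> 0"
    then show "init_monom ord f \<in> pattern_monoms m n A t a"
      by (intro init_monom_in_pattern_monoms[OF ord]) auto
  qed
qed

lemma init_ideal_minor_product:
  assumes ord: "diagonal_order TYPE('k::field) m n ord"
  shows "init_ideal m n ord (minor_product m n A t a :: 'k xpoly set)
    = monomial_span (pattern_monoms m n A t a)"
proof
  let ?P = "minor_product m n A t a :: 'k xpoly set"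
  let ?R = "poly_ring m n :: 'k xpoly ring"
  let ?G = "{single (init_monom ord f) 1 | f. f \<in> ?P \<and> f \<noteq> 0} :: 'k xpoly set"
  have mo: "monomial_order m n ord" using ord by (simp add: diagonal_order_def)
  have Gsub: "?G \<subseteq> monomial_span (pattern_monoms m n A t a)"
  proof clarify
    fix f :: "'k xpoly" assume f: "f \<in> ?P" "f \<noteq> 0"
    then have "init_monom ord f \<in> pattern_monoms m n A t a"
      using poly_idealD(1)[OF ideal_minor_product] minor_product_subset_val
      by (intro init_monom_in_pattern_monoms[OF ord]) blast+
    then show "single (init_monom ord f) 1 \<in> monomial_span (pattern_monoms m n A t a)"
      by (simp add: monomial_span_def)
  qed
  then show "init_ideal m n ord ?P \<subseteq> monomial_span (pattern_monoms m n A t a)"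
    unfolding init_ideal_def by (rule PR.genideal_minimal[OF ideal_span_pattern_monoms])
  have Gc: "?G \<subseteq> carrier ?R"
    using Gsub poly_idealD(1)[OF ideal_span_pattern_monoms[of m n A t a]] by blast
  have id: "ideal (init_ideal m n ord ?P) ?R"
    unfolding init_ideal_def by (rule PR.genideal_ideal[OF Gc])
  show "monomial_span (pattern_monoms m n A t a) \<subseteq> init_ideal m n ord ?P"
  proof
    fix f :: "'k xpoly" assume f: "f \<in> monomial_span (pattern_monoms m n A t a)"
    have "single \<kappa> (lookup f \<kappa>) \<in> init_ideal m n ord ?P" if "\<kappa> \<in> keys f" for \<kappa>
    proof -
      have "\<kappa> \<in> pattern_monoms m n A t a" using f that by (auto simp: monomial_span_def)
      then obtain g :: "'k xpoly" where g: "g \<in> ?P" "leads ord \<kappa> 1 g"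
        using minor_product_witness[OF ord] by blast
      then have "init_monom ord g = \<kappa>" "g \<noteq> 0" using leads_init_monom[OF mo g(2)] by (auto simp: leads_def)
      then have "single \<kappa> 1 \<in> ?G" using g(1) by blast
      then have "single \<kappa> 1 \<in> init_ideal m n ord ?P"
        unfolding init_ideal_def using PR.genideal_self[OF Gc] by blast
      then have "single 0 (lookup f \<kappa>) * single \<kappa> 1 \<in> init_ideal m n ord ?P"
        by (rule poly_idealD(4)[OF id]) (simp add: carrier_poly_ring_iff monoms_def)
      then show ?thesis by (simp add: mult_single)
    qed
    then have "(\<Sum>\<kappa>\<in>keys f. single \<kappa> (lookup f \<kappa>)) \<in> init_ideal m n ord ?P"
      by (intro poly_ideal_sum[OF id])
    then show "f \<in> init_ideal m n ord ?P" by (simp add: sum_single_lookup)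
  qed
qed

end

context
  fixes m n :: nat and ord :: "(xmonom \<times> xmonom) set" and K :: "'k::field itself"
  assumes ord: "diagonal_order TYPE('k) m n ord"
begin

text \<open>
  Ordinary and symbolic powers of \<open>I\<^sub>u(b)\<close> agree.  For the constant family only the bound for
  \<open>(u, b)\<close> itself matters, since it implies all others.
\<close>

lemma ideal_pow_minor_ideal:
  assumes ub: "(u, b) \<in> index_pairs m n"
  shows "ideal_pow (poly_ring m n) (minor_ideal m n u b) e = (minor_val_ideal m n u b e :: 'k xpoly set)"
proof -
  let ?P = "minor_product m n {..<e} (\<lambda>_. u) (\<lambda>_. b) :: 'k xpoly set"
  have P: "ideal_pow (poly_ring m n) (minor_ideal m n u b) e = ?P"
    unfolding minor_product_def by (rule ideal_pow_eq_finprod[OF ideal_minor_ideal[OF ub]])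
  have mo: "monomial_order m n ord" using ord by (simp add: diagonal_order_def)
  have id: "ideal (minor_val_ideal m n u b e) (poly_ring m n :: 'k xpoly ring)"
    unfolding minor_val_ideal_def by (rule ideal_val_ideal)
  have sub: "?P \<subseteq> minor_val_ideal m n u b e"
    using minor_product_subset_val[of "{..<e}" "\<lambda>_. u" "\<lambda>_. b" m n u b] ub by (simp add: mult_above_def)
  have "minor_val_ideal m n u b e \<subseteq> ?P"
  proof (rule subset_minor_product[OF _ _ ord id sub])
    fix f :: "'k xpoly" assume f: "f \<in> minor_val_ideal m n u b e" "f \<noteq> 0"
    have fc: "keys f \<subseteq> monoms m n" by (rule poly_ideal_keys[OF id f(1)])
    then have "init_monom ord f \<in> monoms m n" using init_monom_leads(2)[OF mo f(2) fc] by blast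
    then have "init_monom ord f \<in> cross_monoms m n u b e"
      using init_monom_crossing[OF ord ub f] by (simp add: cross_monoms_def)
    then show "init_monom ord f \<in> pattern_monoms m n {..<e} (\<lambda>_. u) (\<lambda>_. b)"
      by (simp add: pattern_monoms_const[OF ub])
  qed (use ub in auto)
  with sub show ?thesis unfolding P by blast
qed

lemma init_ideal_minor_ideal:
  assumes ub: "(u, b) \<in> index_pairs m n"
  shows "init_ideal m n ord (minor_ideal m n u b :: 'k xpoly set) = monomial_span (cross_monoms m n u b 1)"
proof -
  have "minor_product m n {..<1::nat} (\<lambda>_. u) (\<lambda>_. b) = (minor_ideal m n u b :: 'k xpoly set)"
    unfolding minor_product_def ideal_pow_eq_finprod[OF ideal_minor_ideal[OF ub], symmetric]
    by (rule ideal_pow_1[OF ideal_minor_ideal[OF ub]])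
  then show ?thesis
    using init_ideal_minor_product[of "{..<1::nat}" "\<lambda>_. u" "\<lambda>_. b" m n, OF _ _ ord] ub
    by (simp add: pattern_monoms_const[OF ub, of 1, simplified])
qed

text \<open>
  A product of the initial ideals crosses each staircase often enough since each factor does; the
  converse is the packing theorem.
\<close>

lemma product_init_ideals:
  assumes fin: "finite A" and ix: "\<And>i. i \<in> A \<Longrightarrow> (t i, a i) \<in> index_pairs m n"
  shows "(\<Otimes>\<^bsub>ideals_set (poly_ring m n)\<^esub> i\<in>A. init_ideal m n ord (minor_ideal m n (t i) (a i) :: 'k xpoly set))
    = monomial_span (pattern_monoms m n A t a)" (is "?L = ?M")
proof -
  let ?J = "\<lambda>i. init_ideal m n ord (minor_ideal m n (t i) (a i)) :: 'k xpoly set"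
  let ?R = "poly_ring m n :: 'k xpoly ring"
  have J: "?J i = monomial_span (cross_monoms m n (t i) (a i) 1)" if "i \<in> A" for i
    by (rule init_ideal_minor_ideal[OF ix[OF that]])
  have idJ: "ideal (?J i) ?R" if "i \<in> A" for i
    unfolding J[OF that] by (rule ideal_span_cross_monoms)
  have idL: "ideal ?L ?R" by (rule ideal_finprod) (rule idJ)
  have upper: "?L \<subseteq> monomial_span (cross_monoms m n u b (mult_above A t a u b))" for u b
    unfolding mult_above_sum[OF fin]
  proof (rule finprod_subset_filtration[where V = "\<lambda>k. monomial_span (cross_monoms m n u b k)", OF fin])
    fix i assume i: "i \<in> A"
    show "ideal (?J i) ?R" by (rule idJ[OF i])
    show "?J i \<subseteq> monomial_span (cross_monoms m n u b (if b \<le> a i \<and> u \<le> t i then 1 else 0))"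
    proof (cases "b \<le> a i \<and> u \<le> t i")
      case True
      then show ?thesis unfolding J[OF i] using cross_monoms_antimono[of u "t i" b "a i"]
        by (auto simp: monomial_span_def)
    next
      case False
      then show ?thesis using poly_idealD(1)[OF idJ[OF i]] by (auto simp: span_cross_monoms_0)
    qed
  qed (auto simp: ideal_span_cross_monoms span_cross_monoms_0 span_cross_monoms_mult)
  show ?thesis
  proof
    show "?L \<subseteq> ?M"
    proof
      fix f assume f: "f \<in> ?L"
      then have "keys f \<subseteq> monoms m n" by (rule poly_ideal_keys[OF idL])
      moreover have "keys f \<subseteq> cross_monoms m n u b (mult_above A t a u b)" for u b
        using upper f by (auto simp: monomial_span_def)
      ultimately show "f \<in> ?M" by (auto simp: monomial_span_def pattern_monoms_def)
    qed
    show "?M \<subseteq> ?L"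
    proof
      fix f assume f: "f \<in> ?M"
      have "single \<kappa> (lookup f \<kappa>) \<in> ?L" if "\<kappa> \<in> keys f" for \<kappa>
      proof -
        have "\<kappa> \<in> pattern_monoms m n A t a" using f that by (auto simp: monomial_span_def)
        from pattern_monoms_packing[OF fin ix this]
        obtain c \<nu> where "\<forall>i\<in>A. selects (t i) {a i..n} (c i)" and \<nu>: "\<nu> \<in> monoms m n"
          and eq: "\<kappa> = (\<Sum>i\<in>A. diag_monom (t i) Suc (c i)) + \<nu>" by blast
        then have c: "selects (t i) {a i..n} (c i)" if "i \<in> A" for i using that by blast
        have "single (diag_monom (t i) Suc (c i)) 1 \<in> ?J i" if i: "i \<in> A" for i
        proof -
          have mo: "monomial_order m n ord" using ord by (simp add: diagonal_order_def)
          have tm: "t i \<le> m" "{a i..n} \<subseteq> {1..n}" using ix[OF i] by (auto simp: index_pairs_def)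
          have l: "leads ord (diag_monom (t i) Suc (c i)) 1 (minor (t i) Suc (c i) :: 'k xpoly)"
            using selects_Suc[OF tm(1)] selects_mono[OF c[OF i] tm(2)] by (rule leads_minor[OF ord])
          have nz: "(minor (t i) Suc (c i) :: 'k xpoly) \<noteq> 0" using l by (auto simp: leads_def)
          have in_eq: "init_monom ord (minor (t i) Suc (c i) :: 'k xpoly) = diag_monom (t i) Suc (c i)"
            by (rule leads_init_monom[OF mo l]) simp
          have "(minor (t i) Suc (c i) :: 'k xpoly) \<in> minor_val_ideal m n (t i) (a i) 1"
            using ix[OF i] selects_Suc[OF order_refl] c[OF i]
            by (intro minor_in_minor_val_ideal) (auto simp: index_pairs_def)
          then have "1 \<le> crossing n (t i) (a i) \<rho> (diag_monom (t i) Suc (c i))"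
            if "staircase n (t i) (a i) \<rho>" for \<rho>
            using init_monom_crossing[OF ord ix[OF i] _ nz that] unfolding in_eq by blast
          moreover have "diag_monom (t i) Suc (c i) \<in> monoms m n"
            using selects_Suc[OF tm(1)] selects_mono[OF c[OF i] tm(2)]
            by (intro diag_monom_in_monoms) (auto simp: selects_def)
          ultimately show ?thesis unfolding J[OF i] by (simp add: monomial_span_def cross_monoms_def)
        qed
        then have "(\<Prod>i\<in>A. single (diag_monom (t i) Suc (c i)) (1::'k)) \<in> ?L"
          using prod_in_finprod[OF fin, of ?J m n "\<lambda>i. single (diag_monom (t i) Suc (c i)) (1::'k)"] idJ
          by simp
        then have "single \<nu> (lookup f \<kappa>) * (\<Prod>i\<in>A. single (diag_monom (t i) Suc (c i)) 1) \<in> ?L"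
          by (rule poly_idealD(4)[OF idL]) (use \<nu> in \<open>auto simp: carrier_poly_ring_iff\<close>)
        then show ?thesis unfolding prod_single by (simp add: mult_single eq add.commute)
      qed
      then have "(\<Sum>\<kappa>\<in>keys f. single \<kappa> (lookup f \<kappa>)) \<in> ?L" by (intro poly_ideal_sum[OF idL])
      then show "f \<in> ?L" by (simp add: sum_single_lookup)
    qed
  qed
qed

lemma ideal_pow_init_ideal:
  assumes ub: "(u, b) \<in> index_pairs m n"
  shows "ideal_pow (poly_ring m n) (init_ideal m n ord (minor_ideal m n u b :: 'k xpoly set)) e
    = monomial_span (cross_monoms m n u b e)"
proof -
  have id: "ideal (init_ideal m n ord (minor_ideal m n u b :: 'k xpoly set)) (poly_ring m n)"
    unfolding init_ideal_minor_ideal[OF ub] by (rule ideal_span_cross_monoms)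
  show ?thesis
    unfolding ideal_pow_eq_finprod[OF id]
    using product_init_ideals[of "{..<e}" "\<lambda>_. u" "\<lambda>_. b"] ub by (simp add: pattern_monoms_const[OF ub])
qed

end

lemma finite_index_pairs: "finite (index_pairs m n)"
proof -
  have "index_pairs m n \<subseteq> {..m} \<times> {..n + 1}" by (auto simp: index_pairs_def)
  then show ?thesis by (rule finite_subset) simp
qed

theorem theorem3p4:
  fixes m n :: nat
    and ord :: "(xmonom \<times> xmonom) set"
    and S :: "(nat \<times> nat) list"
  defines "R \<equiv> (poly_ring m n :: 'k::field xpoly ring)"
    and "I \<equiv> (minor_ideal m n :: nat \<Rightarrow> nat \<Rightarrow> 'k xpoly set)"
    and "J \<equiv> (\<lambda>t a. init_ideal m n ord (minor_ideal m n t a :: 'k xpoly set))"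
    and "I\<^sub>S \<equiv> (pattern_ideal m n S :: 'k xpoly set)"
    and "J\<^sub>S \<equiv> init_ideal m n ord (pattern_ideal m n S :: 'k xpoly set)"
    and "e \<equiv> pattern_exp S"
  assumes "diagonal_order TYPE('k) m n ord"
    and "NE_pattern m n S"
  shows "J\<^sub>S = (\<Otimes>\<^bsub>ideals_set R\<^esub> i\<in>{..<length S}. J (fst (S ! i)) (snd (S ! i)))
    \<and> J\<^sub>S = carrier R \<inter> (\<Inter>(u, b)\<in>index_pairs m n. ideal_pow R (J u b) (e u b))
    \<and> I\<^sub>S = carrier R \<inter> (\<Inter>(u, b)\<in>index_pairs m n. ideal_pow R (I u b) (e u b))
    \<and> primary_decomposition R I\<^sub>S
             {ideal_pow R (I u b) (e u b) | u b. (u, b) \<in> index_pairs m n \<and> 0 < e u b}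
    \<and> integrally_closed_ideal R I\<^sub>S
    \<and> integrally_closed_ideal R J\<^sub>S"
proof -
  let ?A = "{..<length S}" and ?t = "\<lambda>i. fst (S ! i)" and ?a = "\<lambda>i. snd (S ! i)"
  note ord = assms(7)
  have ix: "(?t i, ?a i) \<in> index_pairs m n" if "i \<in> ?A" for i
    using assms(8) that by (auto simp: NE_pattern_def)
  have e: "e u b = mult_above ?A ?t ?a u b" for u b
    by (simp add: e_def pattern_exp_def mult_above_def)
  have IS: "I\<^sub>S = minor_product m n ?A ?t ?a"
    by (simp add: I\<^sub>S_def pattern_ideal_def minor_product_def)
  have JS: "J\<^sub>S = monomial_span (pattern_monoms m n ?A ?t ?a)"
    using init_ideal_minor_product[of ?A ?t ?a m n, OF _ ix ord]
    by (simp add: J\<^sub>S_def pattern_ideal_def minor_product_def)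
  have powI: "ideal_pow R (I u b) k = minor_val_ideal m n u b k" if "(u, b) \<in> index_pairs m n" for u b k
    unfolding R_def I_def by (rule ideal_pow_minor_ideal[OF ord that])
  have powJ: "ideal_pow R (J u b) k = monomial_span (cross_monoms m n u b k)" if "(u, b) \<in> index_pairs m n" for u b k
    unfolding R_def J_def by (rule ideal_pow_init_ideal[OF ord that])
  have IS_val: "I\<^sub>S = carrier R \<inter> (\<Inter>(u, b)\<in>index_pairs m n. minor_val_ideal m n u b (e u b))"
    unfolding IS R_def e by (rule minor_product_eq_Inter_val[OF _ ix ord]) auto
  have 1: "J\<^sub>S = (\<Otimes>\<^bsub>ideals_set R\<^esub> i\<in>?A. J (?t i) (?a i))"
    unfolding JS R_def J_def by (rule product_init_ideals[OF ord _ ix, symmetric]) auto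
  have 2: "J\<^sub>S = carrier R \<inter> (\<Inter>(u, b)\<in>index_pairs m n. ideal_pow R (J u b) (e u b))"
  proof -
    have INFJ: "(\<Inter>(u, b)\<in>index_pairs m n. ideal_pow R (J u b) (e u b))
        = (\<Inter>(u, b)\<in>index_pairs m n. monomial_span (cross_monoms m n u b (e u b)))"
      using powJ by (intro INF_cong) auto
    show ?thesis
      unfolding INFJ unfolding JS R_def e
      by (auto simp: monomial_span_def in_pattern_monoms_iff carrier_poly_ring_iff subset_iff)
  qed
  have INF: "(\<Inter>(u, b)\<in>index_pairs m n. ideal_pow R (I u b) (e u b))
      = (\<Inter>(u, b)\<in>index_pairs m n. minor_val_ideal m n u b (e u b))"
    using powI by (intro INF_cong) auto
  have 3: "I\<^sub>S = carrier R \<inter> (\<Inter>(u, b)\<in>index_pairs m n. ideal_pow R (I u b) (e u b))"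
    unfolding INF by (rule IS_val)
  let ?Q = "{ideal_pow R (I u b) (e u b) | u b. (u, b) \<in> index_pairs m n \<and> 0 < e u b}"
  have 4: "primary_decomposition R I\<^sub>S ?Q"
    unfolding primary_decomposition_def
  proof (intro conjI ballI)
    have "?Q \<subseteq> (\<lambda>(u, b). ideal_pow R (I u b) (e u b)) ` index_pairs m n" by auto
    then show "finite ?Q" using finite_index_pairs finite_surj by blast
    show "primary_ideal R Q" if "Q \<in> ?Q" for Q
    proof -
      from that obtain u b where ub: "(u, b) \<in> index_pairs m n" "0 < e u b" "Q = ideal_pow R (I u b) (e u b)"
        by blast
      then show ?thesis
        unfolding ub(3) powI[OF ub(1)] unfolding minor_val_ideal_def R_def by (intro primary_val_ideal) simp
    qed
    have "carrier R \<inter> \<Inter>?Q = carrier R \<inter> (\<Inter>(u, b)\<in>index_pairs m n. ideal_pow R (I u b) (e u b))"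
    proof
      show "carrier R \<inter> \<Inter>?Q \<subseteq> carrier R \<inter> (\<Inter>(u, b)\<in>index_pairs m n. ideal_pow R (I u b) (e u b))"
      proof (clarsimp)
        fix f u b assume f: "f \<in> carrier R" "\<forall>Q. (\<exists>u b. Q = ideal_pow R (I u b) (e u b) \<and> (u, b) \<in> index_pairs m n \<and> 0 < e u b) \<longrightarrow> f \<in> Q"
          and ub: "(u, b) \<in> index_pairs m n"
        show "f \<in> ideal_pow R (I u b) (e u b)"
        proof (cases "e u b = 0")
          case True
          then show ?thesis using f(1) unfolding powI[OF ub] by (simp add: minor_val_ideal_def val_ideal_0 R_def)
        next
          case False
          then show ?thesis using f(2) ub by blast
        qed
      qed
    qed auto
    then show "I\<^sub>S = carrier R \<inter> \<Inter>?Q" using 3 by simp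
  qed
  have 5: "integrally_closed_ideal R I\<^sub>S"
    unfolding R_def
  proof (rule integrally_closed_Inter_val_ideals)
    show "I\<^sub>S = carrier (poly_ring m n) \<inter> (\<Inter>j\<in>index_pairs m n. val_ideal m n (generic_point m (fst j) (snd j)) (e (fst j) (snd j)))"
      unfolding IS_val R_def minor_val_ideal_def by auto
  qed
  have 6: "integrally_closed_ideal R J\<^sub>S"
    unfolding JS R_def by (rule integrally_closed_span_pattern_monoms)
  show ?thesis using 1 2 3 4 5 6 by blast
qed

end
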